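(* Let $\Sigma(x)$ be an $\boldsymbol{e}$-invariant partial type such that $\boldsymbol{e}\in\operatorname{dcl}(c_0)$ for some small tuple $c_0$ of realizations of $\Sigma$. Let $H$ be a subgroup of $\operatorname{Aut}_{\boldsymbol{e}}(\Sigma)$ containing $\operatorname{Autf}_{\mathrm L}(\Sigma,\boldsymbol{e})$ such that $\pi_b[H]$ is a closed subgroup of $\operatorname{Gal}_{\mathrm L}(\Sigma,\boldsymbol{e})$. Then: (1) For any tuples $c$ and $d$ of realizations of $\Sigma$ (indexed by the same set), $c\equiv^H d$ if and only if for all corresponding subtuples $c'$ and $d'$ of $c$ and $d$ which are finite tuples of realizations of $\Sigma$, $c'\equiv^H d'$. (2) Given $\sigma\in\operatorname{Aut}_{\boldsymbol{e}}(\Sigma)$, the following are equivalent: (a) $\sigma\in H$; (b) $\sigma$ fixes all the $\equiv^H$-classes of tuples of realizations of $\Sigma$; (c) $\sigma$ fixes all the $\equiv^H$-classes of finite tuples of realizations of $\Sigma$. Moreover, (2)(a) and (2)(b) are equivalent even when $\pi_b[H]$ is not closed (for $H\le\operatorname{Aut}_{\boldsymbol{e}}(\Sigma)$ containing $\operatorname{Autf}_{\mathrm L}(\Sigma,\boldsymbol{e})$).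
   Context: $T$ is a complete first-order theory with monster model $\mathfrak{C}$; "small" means of size less than the degree of saturation and strong homogeneity of $\mathfrak{C}$. All sets, tuples, ordinals, cardinals and (elementary sub)models considered are small. A hyperimaginary is an equivalence class $a_E$ of an $\emptyset$-type-definable equivalence relation $E$ on $\mathfrak{C}^\alpha$ ($\alpha$ a small ordinal), with representative $a$. $\boldsymbol{e}=a_E$ is a fixed arbitrary hyperimaginary and $\operatorname{Aut}_{\boldsymbol{e}}(\mathfrak{C})=\{f\in\operatorname{Aut}(\mathfrak{C}): f(\boldsymbol{e})=\boldsymbol{e}\text{ setwise}\}$. For a tuple or set $c$, $\boldsymbol{e}\in\operatorname{dcl}(c)$ means every automorphism fixing $c$ pointwise fixes $\boldsymbol{e}$. $\operatorname{Autf}_{\mathrm L}(\mathfrak{C},\boldsymbol{e})$ is the (normal) subgroup of $\operatorname{Aut}_{\boldsymbol{e}}(\mathfrak{C})$ generated by those $f\in\operatorname{Aut}_{\boldsymbol{e}}(\mathfrak{C})$ that fix pointwise some model $M\models T$ with $\boldsymbol{e}\in\operatorname{dcl}(M)$. $c\equiv^{\mathrm L}_{\boldsymbol{e}} d$ means there is $f\in\operatorname{Autf}_{\mathrm L}(\mathfrak{C},\boldsymbol{e})$ with $f(c)=d$. $\Sigma(x)$ is a partial type, $x$ a possibly infinite tuple of variables; $\boldsymbol{e}$-invariant means that for $f\in\operatorname{Aut}_{\boldsymbol{e}}(\mathfrak{C})$, $b\models\Sigma$ iff $f(b)\models\Sigma$. $\Sigma(\mathfrak{C})$ is its solution set. A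 tuple of realizations of $\Sigma$ is a tuple $c=(c_i)_{i<\lambda}$ with each $c_i\models\Sigma$; it is a finite tuple of realizations if $\lambda$ is finite; corresponding subtuples of $(c_i)_{i<\lambda}$ and $(d_i)_{i<\lambda}$ are $(c_i)_{i\in I}$ and $(d_i)_{i\in I}$ for the same $I\subseteq\lambda$. $\operatorname{Aut}_{\boldsymbol{e}}(\Sigma)=\{f\upharpoonright\Sigma(\mathfrak{C}): f\in\operatorname{Aut}_{\boldsymbol{e}}(\mathfrak{C})\}$; $\operatorname{Autf}_{\mathrm L}(\Sigma,\boldsymbol{e})$ is the normal subgroup of all $\sigma\in\operatorname{Aut}_{\boldsymbol{e}}(\Sigma)$ with $b\equiv^{\mathrm L}_{\boldsymbol{e}}\sigma(b)$ for every tuple $b$ (of any length) of realizations of $\Sigma$; $\operatorname{Gal}_{\mathrm L}(\Sigma,\boldsymbol{e})=\operatorname{Aut}_{\boldsymbol{e}}(\Sigma)/\operatorname{Autf}_{\mathrm L}(\Sigma,\boldsymbol{e})$, with quotient map $\pi_b:\operatorname{Aut}_{\boldsymbol{e}}(\Sigma)\to\operatorname{Gal}_{\mathrm L}(\Sigma,\boldsymbol{e})$, $\sigma\mapsto[\sigma]$. For $H\le\operatorname{Aut}_{\boldsymbol{e}}(\Sigma)$ and tuples $c,d$ of realizations of $\Sigma$, $c\equiv^H d$ means there is $h\in H$ with $h(c)=d$. "$\sigma$ fixes all the $\equiv^H$-classes" of a family of tuples means $\sigma(c)\equiv^H c$ for every $c$ in the family. A Lascar tuple is a small tuple $b$ of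 realizations of $\Sigma$ with $\operatorname{Autf}_{\mathrm L}(\Sigma,\boldsymbol{e})=\{\sigma\in\operatorname{Aut}_{\boldsymbol{e}}(\Sigma): b\equiv^{\mathrm L}_{\boldsymbol{e}}\sigma(b)\}$. Under the hypothesis on $c_0$ there is a Lascar tuple $b$ with $\boldsymbol{e}\in\operatorname{dcl}(b)$; $\operatorname{Gal}_{\mathrm L}(\Sigma,\boldsymbol{e})$ carries the quotient topology under the well-defined surjection $\nu_b: S_b(b)=\{\operatorname{tp}(\sigma(b)/b):\sigma\in\operatorname{Aut}_{\boldsymbol{e}}(\Sigma)\}\to\operatorname{Gal}_{\mathrm L}(\Sigma,\boldsymbol{e})$, $\operatorname{tp}(\sigma(b)/b)\mapsto[\sigma]$, where $S_b(b)$ has the logic topology (this topology is independent of $b$ and makes $\operatorname{Gal}_{\mathrm L}(\Sigma,\boldsymbol{e})$ a quasi-compact topological group). *)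

theory Defs
  imports
    "HOL-Algebra.Bij"
    "HOL-Algebra.Generated_Groups"
    "HOL-Analysis.Abstract_Topology"
begin

section \<open>First-order logic\<close>

text \<open>Formulas are polymorphic in the type of variables, because infinite tuples of variables of
  various shapes occur below. \<open>Par m\<close> is a name for the element \<open>m\<close> of the structure:
  L(A)-formulas are those whose parameters lie in \<open>A\<close>.\<close>

datatype ('f, tm_pars: 'a, tm_vars: 'v) tm =
  Var 'v | Par 'a | Fn 'f "('f, 'a, 'v) tm list"

datatype ('f, 'r, fm_pars: 'a, 'v) fm =
    Eq "('f, 'a, 'v) tm" "('f, 'a, 'v) tm"
  | Rel 'r "('f, 'a, 'v) tm list"
  | Neg "('f, 'r, 'a, 'v) fm"
  | Conj "('f, 'r, 'a, 'v) fm" "('f, 'r, 'a, 'v) fm"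
  | Ex 'v "('f, 'r, 'a, 'v) fm"

text \<open>\<open>(g, n) \<in> funs C\<close> means that \<open>g\<close> is an \<open>n\<close>-ary function symbol of the language
  (constants have arity 0). The universe is all of the type \<open>'a\<close>; only the values of the
  interpretations at lists of the right length matter.\<close>

record ('f, 'r, 'a) fo_structure =
  funs :: "('f \<times> nat) set"
  rels :: "('r \<times> nat) set"
  Fint :: "'f \<Rightarrow> 'a list \<Rightarrow> 'a"
  Rint :: "'r \<Rightarrow> 'a list \<Rightarrow> bool"

fun wf_tm :: "('f, 'r, 'a) fo_structure \<Rightarrow> ('f, 'a, 'v) tm \<Rightarrow> bool" where
  "wf_tm C (Var v) \<longleftrightarrow> True"
| "wf_tm C (Par m) \<longleftrightarrow> True"
| "wf_tm C (Fn g ts) \<longleftrightarrow> (g, length ts) \<in> funs C \<and> (\<forall>t\<in>set ts. wf_tm C t)"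

fun wf_fm :: "('f, 'r, 'a) fo_structure \<Rightarrow> ('f, 'r, 'a, 'v) fm \<Rightarrow> bool" where
  "wf_fm C (Eq t u) \<longleftrightarrow> wf_tm C t \<and> wf_tm C u"
| "wf_fm C (Rel R ts) \<longleftrightarrow> (R, length ts) \<in> rels C \<and> (\<forall>t\<in>set ts. wf_tm C t)"
| "wf_fm C (Neg \<phi>) \<longleftrightarrow> wf_fm C \<phi>"
| "wf_fm C (Conj \<phi> \<psi>) \<longleftrightarrow> wf_fm C \<phi> \<and> wf_fm C \<psi>"
| "wf_fm C (Ex v \<phi>) \<longleftrightarrow> wf_fm C \<phi>"

fun fv :: "('f, 'r, 'a, 'v) fm \<Rightarrow> 'v set" where
  "fv (Eq t u) = tm_vars t \<union> tm_vars u"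
| "fv (Rel R ts) = (\<Union>t\<in>set ts. tm_vars t)"
| "fv (Neg \<phi>) = fv \<phi>"
| "fv (Conj \<phi> \<psi>) = fv \<phi> \<union> fv \<psi>"
| "fv (Ex v \<phi>) = fv \<phi> - {v}"

text \<open>The L(A)-formulas in the tuple of variables indexed by \<open>V\<close>.\<close>

definition lform :: "('f, 'r, 'a) fo_structure \<Rightarrow> 'a set \<Rightarrow> 'v set \<Rightarrow> ('f, 'r, 'a, 'v) fm set" where
  "lform C A V = {\<phi>. wf_fm C \<phi> \<and> fm_pars \<phi> \<subseteq> A \<and> fv \<phi> \<subseteq> V}"

fun eval :: "('f, 'r, 'a) fo_structure \<Rightarrow> ('v \<Rightarrow> 'a) \<Rightarrow> ('f, 'a, 'v) tm \<Rightarrow> 'a" where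
  "eval C s (Var v) = s v"
| "eval C s (Par m) = m"
| "eval C s (Fn g ts) = Fint C g (map (eval C s) ts)"

text \<open>Satisfaction in the substructure of \<open>C\<close> with universe \<open>D\<close>.\<close>

fun sat :: "('f, 'r, 'a) fo_structure \<Rightarrow> 'a set \<Rightarrow> ('v \<Rightarrow> 'a) \<Rightarrow> ('f, 'r, 'a, 'v) fm \<Rightarrow> bool" where
  "sat C D s (Eq t u) \<longleftrightarrow> eval C s t = eval C s u"
| "sat C D s (Rel R ts) \<longleftrightarrow> Rint C R (map (eval C s) ts)"
| "sat C D s (Neg \<phi>) \<longleftrightarrow> \<not> sat C D s \<phi>"
| "sat C D s (Conj \<phi> \<psi>) \<longleftrightarrow> sat C D s \<phi> \<and> sat C D s \<psi>"
| "sat C D s (Ex v \<phi>) \<longleftrightarrow> (\<exists>m\<in>D. sat C D (s(v := m)) \<phi>)"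

abbreviation holds :: "('f, 'r, 'a) fo_structure \<Rightarrow> ('v \<Rightarrow> 'a) \<Rightarrow> ('f, 'r, 'a, 'v) fm \<Rightarrow> bool" where
  "holds C \<equiv> sat C UNIV"

definition elementary_sub :: "('f, 'r, 'a) fo_structure \<Rightarrow> 'a set \<Rightarrow> bool" where
  "elementary_sub C M \<longleftrightarrow>
     M \<noteq> {} \<and>
     (\<forall>(g, n)\<in>funs C. \<forall>xs. length xs = n \<and> set xs \<subseteq> M \<longrightarrow> Fint C g xs \<in> M) \<and>
     (\<forall>\<phi>\<in>lform C {} (UNIV :: nat set). \<forall>s. range s \<subseteq> M \<longrightarrow> (sat C M s \<phi> \<longleftrightarrow> holds C s \<phi>))"

definition Auts :: "('f, 'r, 'a) fo_structure \<Rightarrow> ('a \<Rightarrow> 'a) set" where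
  "Auts C = {f. bij f \<and>
     (\<forall>(g, n)\<in>funs C. \<forall>xs. length xs = n \<longrightarrow> f (Fint C g xs) = Fint C g (map f xs)) \<and>
     (\<forall>(R, n)\<in>rels C. \<forall>xs. length xs = n \<longrightarrow> (Rint C R xs \<longleftrightarrow> Rint C R (map f xs)))}"

definition tp :: "('f, 'r, 'a) fo_structure \<Rightarrow> 'a set \<Rightarrow> 'v set \<Rightarrow> ('v \<Rightarrow> 'a) \<Rightarrow> ('f, 'r, 'a, 'v) fm set" where
  "tp C A V s = {\<phi> \<in> lform C A V. holds C s \<phi>}"


section \<open>The monster model\<close>

text \<open>The degree of saturation is a cardinal \<open>\<kappa>\<close>, given as a well-order on a type \<open>'k\<close>. Small index
  sets (of variables, of tuples) are taken to be subsets of \<open>'k\<close>; every small set is equipotent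
  to one of these.\<close>

definition small :: "'k rel \<Rightarrow> 'b set \<Rightarrow> bool" where
  "small \<kappa> A \<longleftrightarrow> (card_of A, \<kappa>) \<in> ordLess"

definition saturated :: "('f, 'r, 'a) fo_structure \<Rightarrow> 'k rel \<Rightarrow> bool" where
  "saturated C \<kappa> \<longleftrightarrow>
     (\<forall>A. small \<kappa> A \<longrightarrow>
       (\<forall>\<Gamma> \<subseteq> lform C A {0 :: nat}.
          (\<forall>\<Delta> \<subseteq> \<Gamma>. finite \<Delta> \<longrightarrow> (\<exists>s. \<forall>\<phi>\<in>\<Delta>. holds C s \<phi>)) \<longrightarrow> (\<exists>s. \<forall>\<phi>\<in>\<Gamma>. holds C s \<phi>)))"

definition strongly_homogeneous :: "('f, 'r, 'a) fo_structure \<Rightarrow> 'k rel \<Rightarrow> bool" where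
  "strongly_homogeneous C \<kappa> \<longleftrightarrow>
     (\<forall>A g. small \<kappa> A \<and>
        (\<forall>\<phi>\<in>lform C {} (UNIV :: nat set). \<forall>s. range s \<subseteq> A \<longrightarrow> (holds C s \<phi> \<longleftrightarrow> holds C (g \<circ> s) \<phi>))
        \<longrightarrow> (\<exists>f\<in>Auts C. \<forall>m\<in>A. f m = g m))"

text \<open>Theories are identified with their deductive closures, so a complete theory contains every
  sentence or its negation (consistency is part of having the monster as a model). As usual,
  the language is small and \<open>\<kappa>\<close> is an uncountable strong limit: the power set of a
  small set is small, which is what makes a bounded number of classes a small number.\<close>

definition complete_theory :: "('f, 'r, 'a) fo_structure \<Rightarrow> ('f, 'r, 'a, nat) fm set \<Rightarrow> bool" where
  "complete_theory C T \<longleftrightarrow>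
     T \<subseteq> lform C {} {} \<and> (\<forall>\<phi>\<in>lform C {} {}. \<phi> \<in> T \<or> Neg \<phi> \<in> T)"

definition monster_model :: "('f, 'r, 'a, nat) fm set \<Rightarrow> ('f, 'r, 'a) fo_structure \<Rightarrow> 'k rel \<Rightarrow> bool" where
  "monster_model T C \<kappa> \<longleftrightarrow>
     complete_theory C T \<and> (\<forall>\<phi>\<in>T. \<forall>s. holds C s \<phi>) \<and>
     card_order_on (Field \<kappa>) \<kappa> \<and>
     small \<kappa> (UNIV :: nat set) \<and> small \<kappa> (funs C) \<and> small \<kappa> (rels C) \<and>
     (\<forall>A :: 'k set. small \<kappa> A \<longrightarrow> small \<kappa> (Pow A)) \<and>
     saturated C \<kappa> \<and> strongly_homogeneous C \<kappa>"


section \<open>Hyperimaginaries and Lascar strong automorphisms\<close>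

text \<open>A tuple indexed by \<open>\<alpha>\<close> is an extensional function on \<open>\<alpha>\<close>, and an automorphism \<open>f\<close> acts on it
  by \<open>compose \<alpha> f\<close>. In formulas defining an equivalence relation \<open>E(x, y)\<close>, the variables are
  \<open>Inl i\<close> for \<open>x\<^sub>i\<close> and \<open>Inr i\<close> for \<open>y\<^sub>i\<close>.\<close>

definition tdef_rel ::
    "('f, 'r, 'a) fo_structure \<Rightarrow> 'k set \<Rightarrow> ('f, 'r, 'a, 'k + 'k) fm set \<Rightarrow> ('k \<Rightarrow> 'a) rel" where
  "tdef_rel C \<alpha> \<Gamma> = {(x, y). x \<in> \<alpha> \<rightarrow>\<^sub>E UNIV \<and> y \<in> \<alpha> \<rightarrow>\<^sub>E UNIV \<and> (\<forall>\<phi>\<in>\<Gamma>. holds C (case_sum x y) \<phi>)}"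

definition hyperimaginary :: "('f, 'r, 'a) fo_structure \<Rightarrow> 'k rel \<Rightarrow> 'k set \<Rightarrow> ('k \<Rightarrow> 'a) set \<Rightarrow> bool" where
  "hyperimaginary C \<kappa> \<alpha> e \<longleftrightarrow>
     small \<kappa> \<alpha> \<and>
     (\<exists>\<Gamma> \<subseteq> lform C {} (\<alpha> <+> \<alpha>).
        equiv (\<alpha> \<rightarrow>\<^sub>E UNIV) (tdef_rel C \<alpha> \<Gamma>) \<and> e \<in> (\<alpha> \<rightarrow>\<^sub>E UNIV) // tdef_rel C \<alpha> \<Gamma>)"

definition Aut_over :: "('f, 'r, 'a) fo_structure \<Rightarrow> 'k set \<Rightarrow> ('k \<Rightarrow> 'a) set \<Rightarrow> ('a \<Rightarrow> 'a) set" where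
  "Aut_over C \<alpha> e = {f \<in> Auts C. compose \<alpha> f ` e = e}"

definition in_dcl :: "('f, 'r, 'a) fo_structure \<Rightarrow> 'k set \<Rightarrow> ('k \<Rightarrow> 'a) set \<Rightarrow> 'a set \<Rightarrow> bool" where
  "in_dcl C \<alpha> e A \<longleftrightarrow> (\<forall>f\<in>Auts C. (\<forall>m\<in>A. f m = m) \<longrightarrow> compose \<alpha> f ` e = e)"

text \<open>The models of the complete theory under consideration are the small elementary
  substructures of the monster.\<close>

definition Autf_L :: "('f, 'r, 'a) fo_structure \<Rightarrow> 'k rel \<Rightarrow> 'k set \<Rightarrow> ('k \<Rightarrow> 'a) set \<Rightarrow> ('a \<Rightarrow> 'a) set" where
  "Autf_L C \<kappa> \<alpha> e =
     generate ((BijGroup UNIV)\<lparr>carrier := Aut_over C \<alpha> e\<rparr>)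
       {f \<in> Aut_over C \<alpha> e.
          \<exists>M. small \<kappa> M \<and> elementary_sub C M \<and> in_dcl C \<alpha> e M \<and> (\<forall>m\<in>M. f m = m)}"


section \<open>Partial types and relativized groups\<close>

text \<open>The variables of a partial type are indexed by \<open>X\<close>. Tuples of realizations are families
  \<open>c i\<close> (\<open>i \<in> I\<close>) of such \<open>X\<close>-tuples; values of \<open>c\<close> outside \<open>I\<close> are irrelevant.\<close>

definition partial_type :: "('f, 'r, 'a) fo_structure \<Rightarrow> 'k rel \<Rightarrow> 'k set \<Rightarrow> ('f, 'r, 'a, 'k) fm set \<Rightarrow> bool" where
  "partial_type C \<kappa> X \<Sigma> \<longleftrightarrow>
     small \<kappa> X \<and> (\<exists>A. small \<kappa> A \<and> \<Sigma> \<subseteq> lform C A X) \<and>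
     (\<forall>\<Delta> \<subseteq> \<Sigma>. finite \<Delta> \<longrightarrow> (\<exists>s. \<forall>\<phi>\<in>\<Delta>. holds C s \<phi>))"

definition realizations :: "('f, 'r, 'a) fo_structure \<Rightarrow> 'k set \<Rightarrow> ('f, 'r, 'a, 'k) fm set \<Rightarrow> ('k \<Rightarrow> 'a) set" where
  "realizations C X \<Sigma> = {b \<in> X \<rightarrow>\<^sub>E UNIV. \<forall>\<phi>\<in>\<Sigma>. holds C b \<phi>}"

definition invariant_over ::
    "('f, 'r, 'a) fo_structure \<Rightarrow> 'k set \<Rightarrow> ('k \<Rightarrow> 'a) set \<Rightarrow> 'k set \<Rightarrow> ('f, 'r, 'a, 'k) fm set \<Rightarrow> bool" where
  "invariant_over C \<alpha> e X \<Sigma> \<longleftrightarrow>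
     (\<forall>f\<in>Aut_over C \<alpha> e. \<forall>b \<in> X \<rightarrow>\<^sub>E UNIV.
        b \<in> realizations C X \<Sigma> \<longleftrightarrow> compose X f b \<in> realizations C X \<Sigma>)"

definition tuple_of :: "'k rel \<Rightarrow> 'b set \<Rightarrow> 'k set \<Rightarrow> ('k \<Rightarrow> 'b) \<Rightarrow> bool" where
  "tuple_of \<kappa> S I c \<longleftrightarrow> small \<kappa> I \<and> c \<in> I \<rightarrow> S"

definition entries :: "'k set \<Rightarrow> 'k set \<Rightarrow> ('k \<Rightarrow> 'k \<Rightarrow> 'a) \<Rightarrow> 'a set" where
  "entries X I c = (\<Union>i\<in>I. c i ` X)"

definition equiv_L ::
    "('f, 'r, 'a) fo_structure \<Rightarrow> 'k rel \<Rightarrow> 'k set \<Rightarrow> ('k \<Rightarrow> 'a) set \<Rightarrow> 'k set \<Rightarrow>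
     'k set \<Rightarrow> ('k \<Rightarrow> 'k \<Rightarrow> 'a) \<Rightarrow> ('k \<Rightarrow> 'k \<Rightarrow> 'a) \<Rightarrow> bool" where
  "equiv_L C \<kappa> \<alpha> e X I c d \<longleftrightarrow> (\<exists>f\<in>Autf_L C \<kappa> \<alpha> e. \<forall>i\<in>I. compose X f (c i) = d i)"

definition equiv_by :: "('b \<Rightarrow> 'b) set \<Rightarrow> 'k set \<Rightarrow> ('k \<Rightarrow> 'b) \<Rightarrow> ('k \<Rightarrow> 'b) \<Rightarrow> bool" where
  "equiv_by H I c d \<longleftrightarrow> (\<exists>h\<in>H. \<forall>i\<in>I. h (c i) = d i)"

definition Aut_type ::
    "('f, 'r, 'a) fo_structure \<Rightarrow> 'k set \<Rightarrow> ('k \<Rightarrow> 'a) set \<Rightarrow> 'k set \<Rightarrow> ('f, 'r, 'a, 'k) fm set \<Rightarrow>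
     (('k \<Rightarrow> 'a) \<Rightarrow> ('k \<Rightarrow> 'a)) monoid" where
  "Aut_type C \<alpha> e X \<Sigma> =
     (BijGroup (realizations C X \<Sigma>))
       \<lparr>carrier := (\<lambda>f. restrict (compose X f) (realizations C X \<Sigma>)) ` Aut_over C \<alpha> e\<rparr>"

definition Autf_L_type ::
    "('f, 'r, 'a) fo_structure \<Rightarrow> 'k rel \<Rightarrow> 'k set \<Rightarrow> ('k \<Rightarrow> 'a) set \<Rightarrow> 'k set \<Rightarrow> ('f, 'r, 'a, 'k) fm set \<Rightarrow>
     (('k \<Rightarrow> 'a) \<Rightarrow> ('k \<Rightarrow> 'a)) set" where
  "Autf_L_type C \<kappa> \<alpha> e X \<Sigma> =
     {\<sigma> \<in> carrier (Aut_type C \<alpha> e X \<Sigma>).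
        \<forall>I c. tuple_of \<kappa> (realizations C X \<Sigma>) I c \<longrightarrow> equiv_L C \<kappa> \<alpha> e X I c (\<sigma> \<circ> c)}"

definition Gal_L ::
    "('f, 'r, 'a) fo_structure \<Rightarrow> 'k rel \<Rightarrow> 'k set \<Rightarrow> ('k \<Rightarrow> 'a) set \<Rightarrow> 'k set \<Rightarrow> ('f, 'r, 'a, 'k) fm set \<Rightarrow>
     (('k \<Rightarrow> 'a) \<Rightarrow> ('k \<Rightarrow> 'a)) set monoid" where
  "Gal_L C \<kappa> \<alpha> e X \<Sigma> = Aut_type C \<alpha> e X \<Sigma> Mod Autf_L_type C \<kappa> \<alpha> e X \<Sigma>"

definition Gal_proj ::
    "('f, 'r, 'a) fo_structure \<Rightarrow> 'k rel \<Rightarrow> 'k set \<Rightarrow> ('k \<Rightarrow> 'a) set \<Rightarrow> 'k set \<Rightarrow> ('f, 'r, 'a, 'k) fm set \<Rightarrow>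
     (('k \<Rightarrow> 'a) \<Rightarrow> ('k \<Rightarrow> 'a)) \<Rightarrow> (('k \<Rightarrow> 'a) \<Rightarrow> ('k \<Rightarrow> 'a)) set" where
  "Gal_proj C \<kappa> \<alpha> e X \<Sigma> \<sigma> = Autf_L_type C \<kappa> \<alpha> e X \<Sigma> #>\<^bsub>Aut_type C \<alpha> e X \<Sigma>\<^esub> \<sigma>"


section \<open>The topology of the relativized Lascar group\<close>

definition Lascar_tuple ::
    "('f, 'r, 'a) fo_structure \<Rightarrow> 'k rel \<Rightarrow> 'k set \<Rightarrow> ('k \<Rightarrow> 'a) set \<Rightarrow> 'k set \<Rightarrow> ('f, 'r, 'a, 'k) fm set \<Rightarrow>
     'k set \<Rightarrow> ('k \<Rightarrow> 'k \<Rightarrow> 'a) \<Rightarrow> bool" where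
  "Lascar_tuple C \<kappa> \<alpha> e X \<Sigma> I b \<longleftrightarrow>
     tuple_of \<kappa> (realizations C X \<Sigma>) I b \<and>
     Autf_L_type C \<kappa> \<alpha> e X \<Sigma> =
       {\<sigma> \<in> carrier (Aut_type C \<alpha> e X \<Sigma>). equiv_L C \<kappa> \<alpha> e X I b (\<sigma> \<circ> b)}"

text \<open>The type of \<open>c\<close> over \<open>b\<close>, both \<open>I\<close>-tuples of \<open>X\<close>-tuples: the variable \<open>(i, j)\<close> stands for
  the \<open>j\<close>-th entry of the \<open>i\<close>-th member.\<close>

definition tp_over ::
    "('f, 'r, 'a) fo_structure \<Rightarrow> 'k set \<Rightarrow> 'k set \<Rightarrow> ('k \<Rightarrow> 'k \<Rightarrow> 'a) \<Rightarrow> ('k \<Rightarrow> 'k \<Rightarrow> 'a) \<Rightarrow>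
     ('f, 'r, 'a, 'k \<times> 'k) fm set" where
  "tp_over C X I c b = tp C (entries X I b) (I \<times> X) (case_prod c)"

definition type_space ::
    "('f, 'r, 'a) fo_structure \<Rightarrow> 'k set \<Rightarrow> ('k \<Rightarrow> 'a) set \<Rightarrow> 'k set \<Rightarrow> ('f, 'r, 'a, 'k) fm set \<Rightarrow>
     'k set \<Rightarrow> ('k \<Rightarrow> 'k \<Rightarrow> 'a) \<Rightarrow> ('f, 'r, 'a, 'k \<times> 'k) fm set set" where
  "type_space C \<alpha> e X \<Sigma> I b = (\<lambda>\<sigma>. tp_over C X I (\<sigma> \<circ> b) b) ` carrier (Aut_type C \<alpha> e X \<Sigma>)"

definition logic_topology ::
    "('f, 'r, 'a) fo_structure \<Rightarrow> 'a set \<Rightarrow> 'v set \<Rightarrow> ('f, 'r, 'a, 'v) fm set set \<Rightarrow>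
     ('f, 'r, 'a, 'v) fm set topology" where
  "logic_topology C A V P = topology_generated_by ((\<lambda>\<phi>. {p \<in> P. \<phi> \<in> p}) ` lform C A V)"

text \<open>The map sending the type of \<open>\<sigma>(b)\<close> over \<open>b\<close> to the class of \<open>\<sigma>\<close>. It is well defined if \<open>b\<close>
  is a Lascar tuple and the hyperimaginary is in the definable closure of \<open>b\<close>.\<close>

definition Gal_of_type ::
    "('f, 'r, 'a) fo_structure \<Rightarrow> 'k rel \<Rightarrow> 'k set \<Rightarrow> ('k \<Rightarrow> 'a) set \<Rightarrow> 'k set \<Rightarrow> ('f, 'r, 'a, 'k) fm set \<Rightarrow>
     'k set \<Rightarrow> ('k \<Rightarrow> 'k \<Rightarrow> 'a) \<Rightarrow> ('f, 'r, 'a, 'k \<times> 'k) fm set \<Rightarrow> (('k \<Rightarrow> 'a) \<Rightarrow> ('k \<Rightarrow> 'a)) set" where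
  "Gal_of_type C \<kappa> \<alpha> e X \<Sigma> I b p =
     (THE g. \<exists>\<sigma>\<in>carrier (Aut_type C \<alpha> e X \<Sigma>).
        p = tp_over C X I (\<sigma> \<circ> b) b \<and> g = Gal_proj C \<kappa> \<alpha> e X \<Sigma> \<sigma>)"

definition quotient_topology :: "'b topology \<Rightarrow> 'c set \<Rightarrow> ('b \<Rightarrow> 'c) \<Rightarrow> 'c topology" where
  "quotient_topology S Y f = topology (\<lambda>U. U \<subseteq> Y \<and> openin S {x \<in> topspace S. f x \<in> U})"

lemma openin_quotient_topology:
  "openin (quotient_topology S Y f) U \<longleftrightarrow> U \<subseteq> Y \<and> openin S {x \<in> topspace S. f x \<in> U}"
proof -
  have "istopology (\<lambda>U. U \<subseteq> Y \<and> openin S {x \<in> topspace S. f x \<in> U})"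
    unfolding istopology_def
  proof (intro conjI allI impI)
    fix U V
    assume "U \<subseteq> Y \<and> openin S {x \<in> topspace S. f x \<in> U}" "V \<subseteq> Y \<and> openin S {x \<in> topspace S. f x \<in> V}"
    moreover have "{x \<in> topspace S. f x \<in> U \<inter> V} =
        {x \<in> topspace S. f x \<in> U} \<inter> {x \<in> topspace S. f x \<in> V}" by auto
    ultimately show "U \<inter> V \<subseteq> Y" "openin S {x \<in> topspace S. f x \<in> U \<inter> V}" by auto
  next
    fix K assume K: "\<forall>U\<in>K. U \<subseteq> Y \<and> openin S {x \<in> topspace S. f x \<in> U}"
    then show "\<Union>K \<subseteq> Y" by auto
    have "{x \<in> topspace S. f x \<in> \<Union>K} = (\<Union>U\<in>K. {x \<in> topspace S. f x \<in> U})" by auto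
    then show "openin S {x \<in> topspace S. f x \<in> \<Union>K}" using K by auto
  qed
  then show ?thesis by (simp add: quotient_topology_def topology_inverse')
qed

lemma quotient_map_quotient_topology:
  assumes "f ` topspace S = Y"
  shows "quotient_map S (quotient_topology S Y f) f"
proof -
  have "{x \<in> topspace S. f x \<in> Y} = topspace S" using assms by auto
  then have "openin (quotient_topology S Y f) Y" by (simp add: openin_quotient_topology)
  then have "topspace (quotient_topology S Y f) = Y"
    by (metis openin_quotient_topology openin_subset openin_topspace subset_antisym)
  then show ?thesis using assms by (auto simp: quotient_map_def openin_quotient_topology)
qed

definition Gal_topology ::
    "('f, 'r, 'a) fo_structure \<Rightarrow> 'k rel \<Rightarrow> 'k set \<Rightarrow> ('k \<Rightarrow> 'a) set \<Rightarrow> 'k set \<Rightarrow> ('f, 'r, 'a, 'k) fm set \<Rightarrow>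
     'k set \<Rightarrow> ('k \<Rightarrow> 'k \<Rightarrow> 'a) \<Rightarrow> (('k \<Rightarrow> 'a) \<Rightarrow> ('k \<Rightarrow> 'a)) set topology" where
  "Gal_topology C \<kappa> \<alpha> e X \<Sigma> I b =
     quotient_topology
       (logic_topology C (entries X I b) (I \<times> X) (type_space C \<alpha> e X \<Sigma> I b))
       (carrier (Gal_L C \<kappa> \<alpha> e X \<Sigma>))
       (Gal_of_type C \<kappa> \<alpha> e X \<Sigma> I b)"

end

theory Submission
  imports Defs
begin

text \<open>The proof rests on two properties of the monster model. Same types are conjugate
  (\<open>same_type_conjugate\<close>), and, by compactness (\<open>automorphism_compactness\<close>): if type-definable
  conditions on the images of a small set under an automorphism \<open>f\<close> can be met together with each
  finite part of a prescription \<open>f(c) = d\<close> for small tuples, then they can be met together with the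
  whole prescription.

  For the passage from finite tuples to arbitrary ones, let \<open>b\<close> be a Lascar tuple with \<open>e \<in> dcl(b)\<close> and let \<open>\<pi>[H]\<close> be closed. The preimage of
  \<open>\<pi>[H]\<close> in the space of types of the conjugates of \<open>b\<close> is closed, so it is cut out by a set of
  formulas over \<open>b\<close>; as \<open>H\<close> contains the kernel of \<open>\<pi>\<close>, satisfying these formulas at \<open>\<sigma>(b)\<close> is
  equivalent to \<open>\<sigma> \<in> H\<close> (\<open>closed_subgroup_type_definable\<close>). Fixing the hyperimaginary \<open>e = a\<^sub>E\<close> amounts
  to the type-definable condition \<open>E(a, f(a))\<close> (\<open>Aut_e_type_definable\<close>). So being an automorphism that
  fixes \<open>e\<close> and restricts to an element of \<open>H\<close> is type-definable, and compactness passes from the finite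
  subtuples of \<open>c\<close> and \<open>d\<close> to \<open>c\<close> and \<open>d\<close> themselves (\<open>equiv_by_finite_character\<close>).

  For the characterization of \<open>H\<close>, suppose that \<open>\<sigma>\<close> fixes all classes of tuples and let \<open>b\<close> be a Lascar tuple. Some \<open>h \<in> H\<close> takes
  \<open>\<sigma>(b)\<close> back to \<open>b\<close>, so \<open>h \<sigma>\<close> fixes \<open>b\<close> and lies in the Lascar group of \<open>\<Sigma>\<close>, which is contained in \<open>H\<close>;
  thus \<open>\<sigma> \<in> H\<close> (\<open>mem_subgroup_iff_fixes_classes\<close>). The previous paragraph, applied to \<open>\<sigma>(c)\<close> and \<open>c\<close>, reduces classes of
  arbitrary tuples to classes of finite ones if \<open>\<pi>[H]\<close> is closed.

  Lascar tuples exist because of compactness and counting (\<open>small_universal_support\<close>). Modulo the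
  Lascar strong automorphisms, an automorphism \<open>k\<close> is determined by the type of \<open>k(M)\<close> over a small model
  \<open>M\<close>, and there is only a small number of these types. A type that no automorphism fixing a given
  tuple of realizations has is, by compactness, already ruled out by a finite subtuple. Putting one such finite
  tuple for each type together gives a small tuple \<open>b\<close> that rules out as much as any other: what is
  congruent to an automorphism fixing \<open>b\<close> is congruent to one fixing any other tuple.\<close>


section \<open>Small sets\<close>

locale degree =
  fixes \<kappa> :: "'k rel"
  assumes card_order: "card_order_on (Field \<kappa>) \<kappa>"
    and small_nat: "small \<kappa> (UNIV :: nat set)"
    and strong_limit: "\<And>A :: 'k set. small \<kappa> A \<Longrightarrow> small \<kappa> (Pow A)"

context degree
  opening cardinal_syntax
begin

lemma small_ordLeq: "small \<kappa> B \<Longrightarrow> |A| \<le>o |B| \<Longrightarrow> small \<kappa> A"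
  unfolding small_def by (rule ordLeq_ordLess_trans)

lemma small_image: "small \<kappa> A \<Longrightarrow> small \<kappa> (f ` A)"
  by (rule small_ordLeq[OF _ card_of_image])

lemma small_subset: "small \<kappa> B \<Longrightarrow> A \<subseteq> B \<Longrightarrow> small \<kappa> A"
  by (rule small_ordLeq[OF _ card_of_mono1])

lemma infinite_Field: "infinite (Field \<kappa>)"
proof
  assume fin: "finite (Field \<kappa>)"
  have "|UNIV :: nat set| \<le>o |Field \<kappa>|"
    using small_nat unfolding small_def
    by (rule ordLeq_ordIso_trans[OF ordLess_imp_ordLeq
          ordIso_symmetric[OF card_of_Field_ordIso[OF card_order]]])
  then show False using fin card_of_ordLeq_finite infinite_UNIV_nat by blast
qed

lemma small_Plus: "small \<kappa> A \<Longrightarrow> small \<kappa> B \<Longrightarrow> small \<kappa> (A <+> B)"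
  unfolding small_def
  by (rule card_of_Plus_ordLess_infinite_Field[OF infinite_Field card_order])

lemma small_Un: "small \<kappa> A \<Longrightarrow> small \<kappa> B \<Longrightarrow> small \<kappa> (A \<union> B)"
  unfolding small_def
  by (rule card_of_Un_ordLess_infinite_Field[OF infinite_Field card_order])

lemma small_Times:
  assumes "small \<kappa> A" "small \<kappa> B"
  shows "small \<kappa> (A \<times> B)"
proof -
  let ?D = "(UNIV :: nat set) <+> (A <+> B)"
  have D: "small \<kappa> ?D" using assms small_nat by (intro small_Plus)
  have inf: "infinite ?D" using infinite_UNIV_nat by auto
  have A: "|A| \<le>o |?D|"
    by (rule ordLeq_transitive[OF card_of_Plus1[of A B] card_of_Plus2])
  have B: "|B| \<le>o |?D|"
    by (rule ordLeq_transitive[OF card_of_Plus2[of B A] card_of_Plus2])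
  have "|A \<times> B| \<le>o |?D|"
    by (rule card_of_Times_ordLeq_infinite_Field) (use inf A B in \<open>simp_all only: Field_card_of card_of_Card_order card_of_card_order_on not_False_eq_True\<close>)
  then show ?thesis by (rule small_ordLeq[OF D])
qed

lemma small_UN_finite:
  assumes "small \<kappa> I" "\<And>i. i \<in> I \<Longrightarrow> finite (A i)"
  shows "small \<kappa> (\<Union>i\<in>I. A i)"
proof -
  have "(\<Union>i\<in>I. A i) \<subseteq> (\<lambda>(i, n). from_nat_into (A i) n) ` (I \<times> (UNIV :: nat set))"
  proof
    fix x assume "x \<in> (\<Union>i\<in>I. A i)"
    then obtain i where i: "i \<in> I" "x \<in> A i" by auto
    then have "from_nat_into (A i) (to_nat_on (A i) x) = x"
      using assms(2) by (simp add: from_nat_into_to_nat_on countable_finite)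
    then show "x \<in> (\<lambda>(i, n). from_nat_into (A i) n) ` (I \<times> (UNIV :: nat set))" 
      using i by (intro image_eqI[of _ _ "(i, to_nat_on (A i) x)"]) auto
  qed
  then show ?thesis
    by (rule small_subset[rotated]) (intro small_image small_Times assms small_nat)
qed

lemma small_finite: "finite A \<Longrightarrow> small \<kappa> A"
  by (rule small_ordLeq[OF small_nat], rule card_of_ordLeq[THEN iffD1])
    (auto dest!: countable_finite simp: countable_def)

lemma small_indexed:
  assumes "small \<kappa> A"
  obtains I :: "'k set" and h where "small \<kappa> I" "bij_betw h I A"
proof -
  have "|A| \<le>o |Field \<kappa>|"
    using assms unfolding small_def
    by (rule ordLeq_ordIso_trans[OF ordLess_imp_ordLeq
          ordIso_symmetric[OF card_of_Field_ordIso[OF card_order]]])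
  then obtain g where g: "inj_on g A" "g ` A \<subseteq> Field \<kappa>"
    by (auto simp: card_of_ordLeq[symmetric])
  show thesis
  proof (rule that)
    show "small \<kappa> (g ` A)" by (rule small_image[OF assms])
    show "bij_betw (the_inv_into A g) (g ` A) A"
      using g(1) by (simp add: bij_betw_the_inv_into inj_on_imp_bij_betw)
  qed
qed

lemma small_Pow:
  assumes "small \<kappa> A"
  shows "small \<kappa> (Pow A)"
proof -
  obtain I :: "'k set" and h where I: "small \<kappa> I" "bij_betw h I A"
    using small_indexed[OF assms] .
  have "Pow A = (\<lambda>J. h ` J) ` Pow I"
    using I(2) by (simp add: image_Pow_surj bij_betw_imp_surj_on)
  then show ?thesis by (simp only: small_image[OF strong_limit[OF I(1)]])
qed

lemma small_countable_functions:
  assumes "small \<kappa> A"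
  shows "small \<kappa> {t :: nat \<Rightarrow> 'b. range t \<subseteq> A}"
proof -
  have "{t :: nat \<Rightarrow> 'b. range t \<subseteq> A} \<subseteq> (\<lambda>r n. SOME m. (n, m) \<in> r) ` Pow (UNIV \<times> A)"
  proof
    fix t :: "nat \<Rightarrow> 'b" assume t: "t \<in> {t. range t \<subseteq> A}"
    define r where "r = range (\<lambda>n. (n, t n))"
    have "(n, m) \<in> r \<longleftrightarrow> m = t n" for n m by (auto simp: r_def)
    then have "t = (\<lambda>n. SOME m. (n, m) \<in> r)" by (simp only: some_eq_trivial)
    moreover have "r \<in> Pow (UNIV \<times> A)" using t by (auto simp: r_def)
    ultimately show "t \<in> (\<lambda>r n. SOME m. (n, m) \<in> r) ` Pow (UNIV \<times> A)"
      by (rule image_eqI)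
  qed
  then show ?thesis
    by (rule small_subset[rotated]) (intro small_image small_Pow small_Times assms small_nat)
qed

lemma small_lists:
  assumes "small \<kappa> A"
  shows "small \<kappa> (lists A)"
proof (cases "A = {}")
  case True
  then show ?thesis by (simp add: small_finite)
next
  case False
  then obtain a where a: "a \<in> A" by auto
  have "lists A \<subseteq> (\<lambda>(n, t). map t [0..<n]) ` (UNIV \<times> {t. range t \<subseteq> A})"
  proof
    fix xs assume xs: "xs \<in> lists A"
    let ?t = "\<lambda>i. if i < length xs then xs ! i else a"
    have "range ?t \<subseteq> A" using xs a by auto
    moreover have "xs = map ?t [0..<length xs]" by (rule nth_equalityI) auto
    ultimately show "xs \<in> (\<lambda>(n, t). map t [0..<n]) ` (UNIV \<times> {t. range t \<subseteq> A})"
      by (intro image_eqI[of _ _ "(length xs, ?t)"]) auto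
  qed
  then show ?thesis
    by (rule small_subset[rotated])
      (intro small_image small_Times assms small_nat small_countable_functions)
qed

end

text \<open>Terms, formulas and Skolem hulls are all generated by finitary operations. Each operation acts
  on lists of every length, so that no arities have to be tracked; this can only enlarge the closure.\<close>

inductive_set closure_under :: "('i \<Rightarrow> 'b list \<Rightarrow> 'b) \<Rightarrow> 'i set \<Rightarrow> 'b set" for op I where
  step: "i \<in> I \<Longrightarrow> xs \<in> lists (closure_under op I) \<Longrightarrow> op i xs \<in> closure_under op I"

text \<open>An element of the closure has a finite construction tree, which is coded by the list of its
  nodes in postfix order: a node \<open>(i, n)\<close> applies the operation \<open>i\<close> to the top \<open>n\<close> entries of a
  stack. There are few lists over a small set.\<close>

lemma (in degree) small_closure_under:
  assumes "small \<kappa> I"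
  shows "small \<kappa> (closure_under op I)"
proof -
  define push where "push = (\<lambda>(i, n) st. op i (rev (take n st)) # drop n st)"
  define run where "run ps st = fold push ps st" for ps st
  have "\<exists>ps \<in> lists (I \<times> UNIV). \<forall>st. run ps st = x # st" if "x \<in> closure_under op I" for x
    using that
  proof induction
    case (step i xs)
    have "\<exists>ps \<in> lists (I \<times> UNIV). \<forall>st. run ps st = rev xs @ st"
      if "\<forall>x\<in>set xs. \<exists>ps \<in> lists (I \<times> UNIV). \<forall>st. run ps st = x # st" for xs
      using that
    proof (induction xs)
      case Nil
      show ?case by (intro bexI[of _ "[]"]) (auto simp: run_def)
    next
      case (Cons x xs)
      then obtain ps qs where ps: "ps \<in> lists (I \<times> UNIV)" "\<And>st. run ps st = x # st"
        and qs: "qs \<in> lists (I \<times> UNIV)" "\<And>st. run qs st = rev xs @ st"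
        by auto
      show ?case
        by (rule bexI[of _ "ps @ qs"]) (use ps qs in \<open>auto simp: run_def\<close>)
    qed
    moreover have "\<forall>x\<in>set xs. \<exists>ps \<in> lists (I \<times> UNIV). \<forall>st. run ps st = x # st"
      using step.IH by auto
    ultimately obtain ps where ps: "ps \<in> lists (I \<times> UNIV)" "\<And>st. run ps st = rev xs @ st"
      by blast
    show ?case
      by (rule bexI[of _ "ps @ [(i, length xs)]"])
        (use ps step.hyps in \<open>auto simp: run_def push_def\<close>)
  qed
  note code = this
  have "closure_under op I \<subseteq> (\<lambda>ps. hd (run ps [])) ` lists (I \<times> (UNIV :: nat set))"
  proof
    fix x assume "x \<in> closure_under op I"
    then obtain ps where "ps \<in> lists (I \<times> (UNIV :: nat set))" "run ps [] = [x]"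
      using code by blast
    then show "x \<in> (\<lambda>ps. hd (run ps [])) ` lists (I \<times> (UNIV :: nat set))"
      by (intro image_eqI[of _ _ ps]) auto
  qed
  then show ?thesis
    by (rule small_subset[rotated]) (intro small_image small_lists small_Times assms small_nat)
qed

section \<open>Substitution and automorphisms\<close>

lemma finite_tm_vars: "finite (tm_vars t)"
  by (induction t) auto

lemma finite_fv: "finite (fv \<phi>)"
  by (induction \<phi>) (auto simp: finite_tm_vars)

lemma eval_cong: "(\<And>v. v \<in> tm_vars t \<Longrightarrow> s v = s' v) \<Longrightarrow> eval C s t = eval C s' t"
proof (induction t)
  case (Fn g ts)
  then have "map (eval C s) ts = map (eval C s') ts" by auto
  then show ?case by (simp only: eval.simps)
qed auto

lemma sat_cong: "(\<And>v. v \<in> fv \<phi> \<Longrightarrow> s v = s' v) \<Longrightarrow> sat C D s \<phi> \<longleftrightarrow> sat C D s' \<phi>"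
proof (induction \<phi> arbitrary: s s')
  case (Eq t u)
  then show ?case using eval_cong[of t s s' C] eval_cong[of u s s' C] by auto
next
  case (Rel R ts)
  then have "map (eval C s) ts = map (eval C s') ts" by (auto intro: eval_cong)
  then show ?case by (simp only: sat.simps)
next
  case (Neg \<phi>)
  then show ?case by (metis fv.simps(3) sat.simps(3))
next
  case (Conj \<phi> \<psi>)
  have "sat C D s \<phi> \<longleftrightarrow> sat C D s' \<phi>" "sat C D s \<psi> \<longleftrightarrow> sat C D s' \<psi>"
    by (rule Conj.IH; use Conj.prems in auto)+
  then show ?case by simp
next
  case (Ex v \<phi>)
  have "sat C D (s(v := m)) \<phi> \<longleftrightarrow> sat C D (s'(v := m)) \<phi>" for m
    by (rule Ex.IH) (use Ex.prems in auto)
  then show ?case by simp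
qed

fun subst_tm :: "('v \<Rightarrow> ('f, 'a, 'w) tm) \<Rightarrow> ('f, 'a, 'v) tm \<Rightarrow> ('f, 'a, 'w) tm" where
  "subst_tm \<rho> (Var v) = \<rho> v"
| "subst_tm \<rho> (Par m) = Par m"
| "subst_tm \<rho> (Fn g ts) = Fn g (map (subst_tm \<rho>) ts)"

text \<open>A bound variable is renamed to one that is fresh for the terms substituted below it; such a
  variable exists if the type of variables on the target side is infinite.\<close>

fun subst_fm ::
    "('v \<Rightarrow> ('f, 'a, 'w) tm) \<Rightarrow> ('f, 'r, 'a, 'v) fm \<Rightarrow> ('f, 'r, 'a, 'w) fm" where
  "subst_fm \<rho> (Eq t u) = Eq (subst_tm \<rho> t) (subst_tm \<rho> u)"
| "subst_fm \<rho> (Rel R ts) = Rel R (map (subst_tm \<rho>) ts)"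
| "subst_fm \<rho> (Neg \<phi>) = Neg (subst_fm \<rho> \<phi>)"
| "subst_fm \<rho> (Conj \<phi> \<psi>) = Conj (subst_fm \<rho> \<phi>) (subst_fm \<rho> \<psi>)"
| "subst_fm \<rho> (Ex v \<phi>) =
     (let w = (SOME w. \<forall>x\<in>fv \<phi> - {v}. w \<notin> tm_vars (\<rho> x)) in Ex w (subst_fm (\<rho>(v := Var w)) \<phi>))"

lemma eval_subst: "eval C s (subst_tm \<rho> t) = eval C (\<lambda>v. eval C s (\<rho> v)) t"
proof (induction t)
  case (Fn g ts)
  then have "map (eval C s \<circ> subst_tm \<rho>) ts = map (eval C (\<lambda>v. eval C s (\<rho> v))) ts" by auto
  then show ?case by (simp only: eval.simps subst_tm.simps list.map_comp)
qed auto

lemma holds_subst: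
  fixes \<rho> :: "'v \<Rightarrow> ('f, 'a, 'w) tm"
  assumes "infinite (UNIV :: 'w set)"
  shows "holds C s (subst_fm \<rho> \<phi>) \<longleftrightarrow> holds C (\<lambda>v. eval C s (\<rho> v)) \<phi>"
proof (induction \<phi> arbitrary: s \<rho>)
  case (Eq t u)
  show ?case by (simp add: eval_subst)
next
  case (Rel R ts)
  have "map (eval C s \<circ> subst_tm \<rho>) ts = map (eval C (\<lambda>v. eval C s (\<rho> v))) ts"
    by (simp add: eval_subst)
  then show ?case by (simp only: sat.simps subst_fm.simps list.map_comp)
next
  case (Ex v \<phi>)
  define w where "w = (SOME w. \<forall>x\<in>fv \<phi> - {v}. w \<notin> tm_vars (\<rho> x))"
  have "finite (\<Union>x\<in>fv \<phi> - {v}. tm_vars (\<rho> x))" by (simp add: finite_fv finite_tm_vars)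
  then have "\<exists>w. w \<notin> (\<Union>x\<in>fv \<phi> - {v}. tm_vars (\<rho> x))" by (rule ex_new_if_finite[OF assms])
  then have w: "\<forall>x\<in>fv \<phi> - {v}. w \<notin> tm_vars (\<rho> x)"
    unfolding w_def by (intro someI_ex[of "\<lambda>w. \<forall>x\<in>fv \<phi> - {v}. w \<notin> tm_vars (\<rho> x)"]) auto
  have "holds C (s(w := m)) (subst_fm (\<rho>(v := Var w)) \<phi>) \<longleftrightarrow>
      holds C ((\<lambda>v. eval C s (\<rho> v))(v := m)) \<phi>" for m
    unfolding Ex.IH
  proof (rule sat_cong)
    fix x assume "x \<in> fv \<phi>"
    then show "eval C (s(w := m)) ((\<rho>(v := Var w)) x) = ((\<lambda>v. eval C s (\<rho> v))(v := m)) x"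
      using w by (auto intro!: eval_cong)
  qed
  then show ?case by (simp add: Let_def w_def[symmetric])
qed auto

lemma subst_tm_syntax:
  assumes "wf_tm C t" "\<And>v. v \<in> tm_vars t \<Longrightarrow> wf_tm C (\<rho> v)"
  shows "wf_tm C (subst_tm \<rho> t)"
  using assms by (induction t) auto

lemma subst_tm_pars: "tm_pars (subst_tm \<rho> t) \<subseteq> tm_pars t \<union> (\<Union>v\<in>tm_vars t. tm_pars (\<rho> v))"
  by (induction t) fastforce+

lemma subst_tm_vars: "tm_vars (subst_tm \<rho> t) = (\<Union>v\<in>tm_vars t. tm_vars (\<rho> v))"
  by (induction t) auto

lemma subst_fm_wf:
  assumes "wf_fm C \<phi>" "\<And>v. v \<in> fv \<phi> \<Longrightarrow> wf_tm C (\<rho> v)"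
  shows "wf_fm C (subst_fm \<rho> \<phi>)"
  using assms by (induction \<phi> arbitrary: \<rho>) (auto intro!: subst_tm_syntax simp: Let_def)

lemma subst_fm_pars: "fm_pars (subst_fm \<rho> \<phi>) \<subseteq> fm_pars \<phi> \<union> (\<Union>v\<in>fv \<phi>. tm_pars (\<rho> v))"
proof (induction \<phi> arbitrary: \<rho>)
  case (Eq t u)
  then show ?case using subst_tm_pars[of \<rho> t] subst_tm_pars[of \<rho> u] by auto
next
  case (Rel R ts)
  then show ?case using subst_tm_pars[of \<rho>] by fastforce
next
  case (Ex v \<phi>)
  let ?w = "SOME w. \<forall>x\<in>fv \<phi> - {v}. w \<notin> tm_vars (\<rho> x)"
  have "fm_pars (subst_fm (\<rho>(v := Var ?w)) \<phi>) \<subseteq>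
      fm_pars \<phi> \<union> (\<Union>x\<in>fv \<phi>. tm_pars ((\<rho>(v := Var ?w)) x))" by (rule Ex)
  also have "\<dots> \<subseteq> fm_pars \<phi> \<union> (\<Union>x\<in>fv \<phi> - {v}. tm_pars (\<rho> x))" by (auto split: if_splits)
  finally show ?case by (simp add: Let_def)
next
  case (Conj \<phi> \<psi>)
  then show ?case by simp blast
qed auto

lemma subst_fm_fv: "fv (subst_fm \<rho> \<phi>) \<subseteq> (\<Union>v\<in>fv \<phi>. tm_vars (\<rho> v))"
proof (induction \<phi> arbitrary: \<rho>)
  case (Ex v \<phi>)
  let ?w = "SOME w. \<forall>x\<in>fv \<phi> - {v}. w \<notin> tm_vars (\<rho> x)"
  have "fv (subst_fm (\<rho>(v := Var ?w)) \<phi>) \<subseteq> (\<Union>x\<in>fv \<phi>. tm_vars ((\<rho>(v := Var ?w)) x))"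
    by (rule Ex)
  also have "\<dots> \<subseteq> insert ?w (\<Union>x\<in>fv \<phi> - {v}. tm_vars (\<rho> x))" by (auto split: if_splits)
  finally show ?case by (auto simp: Let_def)
next
  case (Conj \<phi> \<psi>)
  then show ?case by simp blast
qed (auto simp: subst_tm_vars)

lemma subst_fm_lform:
  assumes "\<phi> \<in> lform C P V" "P \<subseteq> Q"
    and "\<And>v. v \<in> V \<Longrightarrow> wf_tm C (\<rho> v) \<and> tm_pars (\<rho> v) \<subseteq> Q \<and> tm_vars (\<rho> v) \<subseteq> W"
  shows "subst_fm \<rho> \<phi> \<in> lform C Q W"
proof -
  have fv: "\<And>v. v \<in> fv \<phi> \<Longrightarrow> wf_tm C (\<rho> v) \<and> tm_pars (\<rho> v) \<subseteq> Q \<and> tm_vars (\<rho> v) \<subseteq> W"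
    using assms by (auto simp: lform_def)
  have "wf_fm C (subst_fm \<rho> \<phi>)"
    using assms(1) fv by (auto simp: lform_def intro: subst_fm_wf)
  moreover have "fm_pars (subst_fm \<rho> \<phi>) \<subseteq> Q" "fv (subst_fm \<rho> \<phi>) \<subseteq> W"
    using assms(1,2) fv subst_fm_pars[of \<rho> \<phi>] subst_fm_fv[of \<rho> \<phi>] unfolding lform_def by blast+
  ultimately show ?thesis by (simp add: lform_def)
qed

lemma Neg_lform [simp]: "Neg \<phi> \<in> lform C P V \<longleftrightarrow> \<phi> \<in> lform C P V"
  by (simp add: lform_def)

lemma lform_mono: "\<phi> \<in> lform C P V \<Longrightarrow> P \<subseteq> Q \<Longrightarrow> V \<subseteq> W \<Longrightarrow> \<phi> \<in> lform C Q W"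
  by (auto simp: lform_def)

definition verum :: "('f, 'r, 'a, 'v) fm" where
  "verum = Ex undefined (Eq (Var undefined) (Var undefined))"

fun conjs :: "('f, 'r, 'a, 'v) fm list \<Rightarrow> ('f, 'r, 'a, 'v) fm" where
  "conjs [] = verum"
| "conjs (\<phi> # \<phi>s) = Conj \<phi> (conjs \<phi>s)"

fun exs :: "'v list \<Rightarrow> ('f, 'r, 'a, 'v) fm \<Rightarrow> ('f, 'r, 'a, 'v) fm" where
  "exs [] \<phi> = \<phi>"
| "exs (v # vs) \<phi> = Ex v (exs vs \<phi>)"

lemma verum [simp]: "holds C s verum" "verum \<in> lform C P V"
  by (auto simp: verum_def lform_def)

lemma holds_conjs [simp]: "holds C s (conjs \<phi>s) \<longleftrightarrow> (\<forall>\<phi>\<in>set \<phi>s. holds C s \<phi>)"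
  by (induction \<phi>s) auto

lemma conjs_lform: "set \<phi>s \<subseteq> lform C P V \<Longrightarrow> conjs \<phi>s \<in> lform C P V"
proof (induction \<phi>s)
  case (Cons \<phi> \<phi>s)
  then show ?case by (simp add: lform_def)
qed simp

lemma exs_lform: "\<phi> \<in> lform C P V \<Longrightarrow> exs vs \<phi> \<in> lform C P (V - set vs)"
  by (induction vs) (auto simp: lform_def)

lemma holds_exs:
  "holds C s (exs vs \<phi>) \<longleftrightarrow> (\<exists>s'. (\<forall>v. v \<notin> set vs \<longrightarrow> s' v = s v) \<and> holds C s' \<phi>)"
proof (induction vs arbitrary: s)
  case Nil
  have "s' = s" if "\<forall>v. s' v = s v" for s' using that by auto
  then show ?case by auto
next
  case (Cons x vs)
  have "(\<exists>m. \<exists>s'. (\<forall>v. v \<notin> set vs \<longrightarrow> s' v = (s(x := m)) v) \<and> holds C s' \<phi>) \<longleftrightarrow>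
      (\<exists>s'. (\<forall>v. v \<notin> set (x # vs) \<longrightarrow> s' v = s v) \<and> holds C s' \<phi>)" (is "?l \<longleftrightarrow> ?r")
  proof
    assume ?l
    then show ?r by (metis fun_upd_other list.set_intros(1) list.set_intros(2))
  next
    assume ?r
    then obtain s' where "\<forall>v. v \<notin> set (x # vs) \<longrightarrow> s' v = s v" "holds C s' \<phi>" by auto
    then show ?l by (intro exI[of _ "s' x"] exI[of _ s']) auto
  qed
  then show ?case using Cons by simp
qed

lemma Auts_Fint:
  "f \<in> Auts C \<Longrightarrow> (g, length xs) \<in> funs C \<Longrightarrow> f (Fint C g xs) = Fint C g (map f xs)"
  unfolding Auts_def by (drule CollectD, elim conjE, drule (1) bspec) simp

lemma Auts_Rint:
  assumes "f \<in> Auts C" "(R, length xs) \<in> rels C"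
  shows "Rint C R (map f xs) \<longleftrightarrow> Rint C R xs"
proof -
  have "\<forall>(R, n)\<in>rels C. \<forall>xs. length xs = n \<longrightarrow> (Rint C R xs \<longleftrightarrow> Rint C R (map f xs))"
    using assms(1) unfolding Auts_def by blast
  from bspec[OF this assms(2)] show ?thesis by blast
qed

lemma Auts_bij: "f \<in> Auts C \<Longrightarrow> bij f"
  by (simp add: Auts_def)

lemma AutsI:
  assumes "bij f"
    and "\<And>g xs. (g, length xs) \<in> funs C \<Longrightarrow> f (Fint C g xs) = Fint C g (map f xs)"
    and "\<And>R xs. (R, length xs) \<in> rels C \<Longrightarrow> Rint C R (map f xs) \<longleftrightarrow> Rint C R xs"
  shows "f \<in> Auts C"
  using assms by (auto simp: Auts_def)

lemma eval_Auts:
  assumes "f \<in> Auts C" "wf_tm C t" "\<And>m. m \<in> tm_pars t \<Longrightarrow> f m = m"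
  shows "eval C (f \<circ> s) t = f (eval C s t)"
  using assms(2,3)
proof (induction t)
  case (Fn g ts)
  have "eval C (f \<circ> s) t = f (eval C s t)" if "t \<in> set ts" for t
    by (rule Fn.IH) (use Fn.prems that in auto)
  then have eq: "map (eval C (f \<circ> s)) ts = map f (map (eval C s) ts)" by simp
  have "f (Fint C g (map (eval C s) ts)) = Fint C g (map f (map (eval C s) ts))"
    by (rule Auts_Fint[OF assms(1)]) (use Fn.prems in simp)
  then show ?case using eq by (simp only: eval.simps)
qed auto

lemma sat_Auts:
  assumes "f \<in> Auts C" "wf_fm C \<phi>" "\<And>m. m \<in> fm_pars \<phi> \<Longrightarrow> f m = m"
  shows "sat C (f ` D) (f \<circ> s) \<phi> \<longleftrightarrow> sat C D s \<phi>"
  using assms(2,3)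
proof (induction \<phi> arbitrary: s)
  case (Eq t u)
  have "inj f" using assms(1) by (simp add: Auts_def bij_def)
  moreover have "eval C (f \<circ> s) t = f (eval C s t)" "eval C (f \<circ> s) u = f (eval C s u)"
    by (rule eval_Auts[OF assms(1)]; use Eq.prems in simp)+
  ultimately show ?case by (simp only: sat.simps inj_eq)
next
  case (Rel R ts)
  have "eval C (f \<circ> s) t = f (eval C s t)" if "t \<in> set ts" for t
    by (rule eval_Auts[OF assms(1)]) (use Rel.prems that in auto)
  then have eq: "map (eval C (f \<circ> s)) ts = map f (map (eval C s) ts)" by simp
  have "Rint C R (map (eval C s) ts) \<longleftrightarrow> Rint C R (map f (map (eval C s) ts))"
    by (rule Auts_Rint[OF assms(1), symmetric]) (use Rel.prems in simp)
  then show ?case using eq by (simp only: sat.simps)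
next
  case (Ex v \<phi>)
  have upd: "(f \<circ> s)(v := f m) = f \<circ> s(v := m)" for m by (simp add: fun_upd_comp)
  have IH: "sat C (f ` D) (f \<circ> s(v := m)) \<phi> \<longleftrightarrow> sat C D (s(v := m)) \<phi>" for m
    by (rule Ex.IH) (use Ex.prems in auto)
  show ?case by (simp only: bex_simps upd IH sat.simps)
qed auto

lemma holds_Auts:
  assumes "f \<in> Auts C" "wf_fm C \<phi>" "\<And>m. m \<in> fm_pars \<phi> \<Longrightarrow> f m = m"
  shows "holds C (f \<circ> s) \<phi> \<longleftrightarrow> holds C s \<phi>"
  using sat_Auts[OF assms, of UNIV s] Auts_bij[OF assms(1)] by (simp add: bij_is_surj)

lemma id_Auts: "id \<in> Auts C"
  by (auto simp: Auts_def)

lemma comp_Auts: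
  assumes "f \<in> Auts C" "g \<in> Auts C"
  shows "f \<circ> g \<in> Auts C"
proof (rule AutsI)
  show "bij (f \<circ> g)" using assms by (intro bij_comp Auts_bij)
  show "(f \<circ> g) (Fint C h xs) = Fint C h (map (f \<circ> g) xs)" if "(h, length xs) \<in> funs C" for h xs
    using that Auts_Fint[OF assms(2), of h xs] Auts_Fint[OF assms(1), of h "map g xs"] by simp
  show "Rint C R (map (f \<circ> g) xs) \<longleftrightarrow> Rint C R xs" if "(R, length xs) \<in> rels C" for R xs
    using that Auts_Rint[OF assms(2), of R xs] Auts_Rint[OF assms(1), of R "map g xs"] by simp
qed

lemma inv_Auts:
  assumes f: "f \<in> Auts C"
  shows "inv_into UNIV f \<in> Auts C"
proof -
  let ?h = "inv_into UNIV f"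
  have bij: "bij f" using f by (simp add: Auts_def)
  then have surj: "\<And>x. f (?h x) = x" and inj: "\<And>x. ?h (f x) = x"
    by (simp_all add: bij_is_surj surj_f_inv_f bij_is_inj)
  have mm: "map f (map ?h xs) = xs" for xs by (simp add: surj comp_def)
  show ?thesis
  proof (rule AutsI)
    show "bij ?h" by (rule bij_imp_bij_inv[OF bij])
    show "?h (Fint C g xs) = Fint C g (map ?h xs)" if "(g, length xs) \<in> funs C" for g xs
    proof -
      have "f (Fint C g (map ?h xs)) = Fint C g xs"
        using that Auts_Fint[OF f, of g "map ?h xs"] by (simp only: length_map mm)
      then show ?thesis using inj by metis
    qed
    show "Rint C R (map ?h xs) \<longleftrightarrow> Rint C R xs" if "(R, length xs) \<in> rels C" for R xs
      using that Auts_Rint[OF f, of R "map ?h xs"] by (simp only: length_map mm)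
  qed
qed

section \<open>Compactness for types in a small number of variables\<close>

definition fin_sat :: "('f, 'r, 'a) fo_structure \<Rightarrow> ('f, 'r, 'a, 'v) fm set \<Rightarrow> bool" where
  "fin_sat C \<Gamma> \<longleftrightarrow> (\<forall>\<Delta> \<subseteq> \<Gamma>. finite \<Delta> \<longrightarrow> (\<exists>s. \<forall>\<phi>\<in>\<Delta>. holds C s \<phi>))"

locale monster =
  fixes T :: "('f, 'r, 'a, nat) fm set"
    and C :: "('f, 'r, 'a) fo_structure"
    and \<kappa> :: "'k rel"
  assumes monster: "monster_model T C \<kappa>"
begin

sublocale degree \<kappa>
  using monster by unfold_locales (auto simp: monster_model_def)

lemma small_language: "small \<kappa> (funs C)" "small \<kappa> (rels C)"
  using monster by (auto simp: monster_model_def)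

lemma saturation:
  assumes "small \<kappa> A" "\<Gamma> \<subseteq> lform C A {0 :: nat}" "fin_sat C \<Gamma>"
  shows "\<exists>s. \<forall>\<phi>\<in>\<Gamma>. holds C s \<phi>"
  using monster assms unfolding monster_model_def saturated_def fin_sat_def by blast

lemma homogeneity:
  assumes "small \<kappa> A"
    and imp: "\<And>\<phi> s. \<phi> \<in> lform C {} (UNIV :: nat set) \<Longrightarrow> range s \<subseteq> A \<Longrightarrow>
      holds C s \<phi> \<Longrightarrow> holds C (g \<circ> s) \<phi>"
  shows "\<exists>f\<in>Auts C. \<forall>m\<in>A. f m = g m"
proof -
  have "holds C s \<phi> \<longleftrightarrow> holds C (g \<circ> s) \<phi>"
    if "\<phi> \<in> lform C {} (UNIV :: nat set)" "range s \<subseteq> A" for \<phi> s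
    using imp[OF that] imp[of "Neg \<phi>" s] that by auto
  then show ?thesis
    using monster assms(1) unfolding monster_model_def strongly_homogeneous_def by blast
qed

text \<open>Given a variable \<open>v\<close>, existentially quantifying all other variables in the finite
  conjunctions from \<open>\<Gamma>\<close> leaves a finitely satisfiable type in \<open>v\<close> alone; a realization of it is a
  value for \<open>v\<close> that does not spoil finite satisfiability.\<close>

lemma fin_sat_assign_variable:
  fixes v :: 'v
  assumes P: "small \<kappa> P" and \<Gamma>: "\<Gamma> \<subseteq> lform C P UNIV" and sat: "fin_sat C \<Gamma>"
  shows "\<exists>m. fin_sat C (insert (Eq (Var v) (Par m)) \<Gamma>)"
proof -
  define \<Psi> :: "('f, 'r, 'a, nat) fm set" where
    "\<Psi> = {subst_fm (\<lambda>_. Var 0) \<psi> | \<psi>.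
       \<exists>vs \<phi>s. \<psi> = exs vs (conjs \<phi>s) \<and> set \<phi>s \<subseteq> \<Gamma> \<and> \<psi> \<in> lform C P {v} \<and> v \<notin> set vs}"
  have subst: "holds C s (subst_fm (\<lambda>_. Var (0 :: nat)) \<psi>) \<longleftrightarrow> holds C (\<lambda>_. s 0) \<psi>"
    for s and \<psi> :: "('f, 'r, 'a, 'v) fm"
    by (simp add: holds_subst)
  have "\<Psi> \<subseteq> lform C P {0}"
    unfolding \<Psi>_def by (auto intro!: subst_fm_lform)
  moreover have "fin_sat C \<Psi>"
    unfolding fin_sat_def
  proof (intro allI impI)
    fix \<Delta> assume \<Delta>: "\<Delta> \<subseteq> \<Psi>" "finite \<Delta>"
    have "\<forall>\<delta>\<in>\<Delta>. \<exists>vs \<phi>s. \<delta> = subst_fm (\<lambda>_. Var 0) (exs vs (conjs \<phi>s)) \<and> set \<phi>s \<subseteq> \<Gamma> \<and>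
        exs vs (conjs \<phi>s) \<in> lform C P {v} \<and> v \<notin> set vs"
      using \<Delta>(1) unfolding \<Psi>_def by blast
    then obtain vs \<phi>s where \<delta>: "\<And>\<delta>. \<delta> \<in> \<Delta> \<Longrightarrow> \<delta> = subst_fm (\<lambda>_. Var 0) (exs (vs \<delta>) (conjs (\<phi>s \<delta>))) \<and>
        set (\<phi>s \<delta>) \<subseteq> \<Gamma> \<and> exs (vs \<delta>) (conjs (\<phi>s \<delta>)) \<in> lform C P {v} \<and> v \<notin> set (vs \<delta>)"
      by metis
    have "finite (\<Union>\<delta>\<in>\<Delta>. set (\<phi>s \<delta>))" "(\<Union>\<delta>\<in>\<Delta>. set (\<phi>s \<delta>)) \<subseteq> \<Gamma>"
      using \<Delta>(2) \<delta> by auto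
    then obtain s where s: "\<forall>\<phi>\<in>(\<Union>\<delta>\<in>\<Delta>. set (\<phi>s \<delta>)). holds C s \<phi>"
      using sat unfolding fin_sat_def by meson
    have "holds C (\<lambda>_. s v) \<delta>" if "\<delta> \<in> \<Delta>" for \<delta>
    proof -
      let ?\<psi> = "exs (vs \<delta>) (conjs (\<phi>s \<delta>))"
      have "holds C s (conjs (\<phi>s \<delta>))" using s that by auto
      then have "holds C s ?\<psi>" unfolding holds_exs by blast
      moreover have "fv ?\<psi> \<subseteq> {v}" using \<delta>[OF that] by (simp add: lform_def)
      ultimately have "holds C (\<lambda>_. s v) ?\<psi>" using sat_cong[of ?\<psi> s "\<lambda>_. s v" C UNIV] by blast
      then have "holds C (\<lambda>_. s v) (subst_fm (\<lambda>_. Var (0 :: nat)) ?\<psi>)"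
        by (simp only: subst)
      then show ?thesis using \<delta>[OF that] by metis
    qed
    then show "\<exists>s. \<forall>\<delta>\<in>\<Delta>. holds C s \<delta>" by blast
  qed
  ultimately obtain s where s: "\<forall>\<psi>\<in>\<Psi>. holds C s \<psi>" using saturation[OF P] by blast
  have "fin_sat C (insert (Eq (Var v) (Par (s 0))) \<Gamma>)"
    unfolding fin_sat_def
  proof (intro allI impI)
    fix \<Delta> assume \<Delta>: "\<Delta> \<subseteq> insert (Eq (Var v) (Par (s 0))) \<Gamma>" "finite \<Delta>"
    obtain \<phi>s where \<phi>s: "set \<phi>s = \<Delta> - {Eq (Var v) (Par (s 0))}"
      using finite_list[of "\<Delta> - {Eq (Var v) (Par (s 0))}"] \<Delta>(2) by auto
    obtain vs where vs: "set vs = fv (conjs \<phi>s) - {v}"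
      using finite_list[of "fv (conjs \<phi>s) - {v}"] by (auto simp: finite_fv)
    have "set \<phi>s \<subseteq> \<Gamma>" using \<phi>s \<Delta>(1) by auto
    then have "conjs \<phi>s \<in> lform C P UNIV" by (intro conjs_lform) (use \<Gamma> in blast)
    then have "conjs \<phi>s \<in> lform C P (fv (conjs \<phi>s))" by (simp add: lform_def)
    then have "exs vs (conjs \<phi>s) \<in> lform C P {v}"
      by (rule lform_mono[OF exs_lform]) (auto simp: vs)
    moreover have "v \<notin> set vs" by (simp add: vs)
    ultimately have "subst_fm (\<lambda>_. Var 0) (exs vs (conjs \<phi>s)) \<in> \<Psi>"
      unfolding \<Psi>_def using \<open>set \<phi>s \<subseteq> \<Gamma>\<close> by blast
    then have "holds C s (subst_fm (\<lambda>_. Var 0) (exs vs (conjs \<phi>s)))" using s by blast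
    then have "holds C (\<lambda>_. s 0) (exs vs (conjs \<phi>s))" by (simp only: subst)
    then obtain s' where s': "\<forall>x. x \<notin> set vs \<longrightarrow> s' x = s 0" "holds C s' (conjs \<phi>s)"
      unfolding holds_exs by blast
    have "holds C s' \<phi>" if "\<phi> \<in> \<Delta>" for \<phi>
      using that \<phi>s s' \<open>v \<notin> set vs\<close> by (cases "\<phi> = Eq (Var v) (Par (s 0))") auto
    then show "\<exists>s. \<forall>\<phi>\<in>\<Delta>. holds C s \<phi>" by blast
  qed
  then show ?thesis by blast
qed

text \<open>By Zorn's lemma a maximal partial assignment \<open>r\<close> preserving finite satisfiability exists; by
  the preceding lemma it is defined on all of \<open>V\<close>. The values chosen so far are parameters in
  the next step, which is why \<open>V\<close> has to be small.\<close>

theorem compactness: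
  fixes V :: "'v set"
  assumes P: "small \<kappa> P" and V: "small \<kappa> V" and \<Gamma>: "\<Gamma> \<subseteq> lform C P V" and sat: "fin_sat C \<Gamma>"
  shows "\<exists>s. \<forall>\<phi>\<in>\<Gamma>. holds C s \<phi>"
proof -
  define eqs :: "('v \<times> 'a) set \<Rightarrow> ('f, 'r, 'a, 'v) fm set" where
    "eqs r = (\<lambda>(v, m). Eq (Var v) (Par m)) ` r" for r
  define \<A> where "\<A> = {r. r \<subseteq> V \<times> UNIV \<and> fin_sat C (\<Gamma> \<union> eqs r)}"
  have "\<exists>r\<in>\<A>. \<forall>r'\<in>\<A>. r \<subseteq> r' \<longrightarrow> r' = r"
  proof (rule subset_Zorn_nonempty)
    show "\<A> \<noteq> {}" using sat by (auto simp: \<A>_def eqs_def intro!: exI[of _ "{}"])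
  next
    fix \<C> assume \<C>: "\<C> \<noteq> {}" "subset.chain \<A> \<C>"
    have "fin_sat C (\<Gamma> \<union> eqs (\<Union>\<C>))"
      unfolding fin_sat_def
    proof (intro allI impI)
      fix \<Delta> assume \<Delta>: "\<Delta> \<subseteq> \<Gamma> \<union> eqs (\<Union>\<C>)" "finite \<Delta>"
      let ?B = "(\<lambda>r. \<Gamma> \<union> eqs r) ` \<C>"
      have "\<Delta> \<subseteq> \<Union>?B" using \<Delta>(1) \<C>(1) by (auto simp: eqs_def)
      moreover have "subset.chain UNIV ?B"
        unfolding subset_chain_def
      proof (intro conjI ballI)
        fix x y assume "x \<in> ?B" "y \<in> ?B"
        then obtain r r' where "x = \<Gamma> \<union> eqs r" "y = \<Gamma> \<union> eqs r'" "r \<in> \<C>" "r' \<in> \<C>" by blast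
        moreover from this have "eqs r \<subseteq> eqs r' \<or> eqs r' \<subseteq> eqs r"
          using \<C>(2) unfolding subset_chain_def eqs_def by (meson image_mono)
        ultimately show "x \<subseteq> y \<or> y \<subseteq> x" by blast
      qed simp
      ultimately obtain r where "r \<in> \<C>" "\<Delta> \<subseteq> \<Gamma> \<union> eqs r"
        using finite_subset_Union_chain[OF \<Delta>(2)] \<C>(1) by blast
      moreover have "r \<in> \<A>" using \<open>r \<in> \<C>\<close> \<C>(2) unfolding subset_chain_def by blast
      ultimately show "\<exists>s. \<forall>\<phi>\<in>\<Delta>. holds C s \<phi>"
        using \<Delta>(2) by (auto simp: \<A>_def fin_sat_def)
    qed
    moreover have "\<Union>\<C> \<subseteq> V \<times> UNIV" using \<C>(2) unfolding subset_chain_def \<A>_def by blast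
    ultimately show "\<Union>\<C> \<in> \<A>" by (simp add: \<A>_def)
  qed
  then obtain r where "r \<in> \<A>" and "\<forall>r'\<in>\<A>. r \<subseteq> r' \<longrightarrow> r' = r" by (rule bexE)
  then have r: "r \<subseteq> V \<times> UNIV" "fin_sat C (\<Gamma> \<union> eqs r)"
    and max: "\<And>r'. r' \<subseteq> V \<times> UNIV \<Longrightarrow> fin_sat C (\<Gamma> \<union> eqs r') \<Longrightarrow> r \<subseteq> r' \<Longrightarrow> r' = r"
    by (simp_all add: \<A>_def)
  define s where "s v = (THE m. (v, m) \<in> r)" for v
  have s: "s v = m" if "(v, m) \<in> r" for v m
    unfolding s_def
  proof (rule the_equality)
    show "(v, m) \<in> r" by (rule that)
    fix m' assume "(v, m') \<in> r"
    then have "{Eq (Var v) (Par m), Eq (Var v) (Par m')} \<subseteq> \<Gamma> \<union> eqs r"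
      using that by (force simp: eqs_def)
    moreover have "finite {Eq (Var v) (Par m), Eq (Var v) (Par m')}" by simp
    ultimately have "\<exists>s. \<forall>\<phi>\<in>{Eq (Var v) (Par m), Eq (Var v) (Par m')}. holds C s \<phi>"
      using r(2) unfolding fin_sat_def by blast
    then show "m' = m" by auto
  qed
  have "Range r \<subseteq> s ` V" using s r(1) by fastforce
  then have small: "small \<kappa> (P \<union> Range r)"
    by (intro small_Un[OF P] small_subset[OF small_image[OF V]])
  have total: "(v, s v) \<in> r" if "v \<in> V" for v
  proof -
    have "\<Gamma> \<union> eqs r \<subseteq> lform C (P \<union> Range r) UNIV"
      using \<Gamma> by (auto simp: eqs_def lform_def)
    then obtain m where "fin_sat C (insert (Eq (Var v) (Par m)) (\<Gamma> \<union> eqs r))"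
      using fin_sat_assign_variable[OF small _ r(2)] by blast
    then have "fin_sat C (\<Gamma> \<union> eqs (insert (v, m) r))" by (simp add: eqs_def)
    then have "insert (v, m) r = r" by (rule max[rotated]) (use r(1) that in auto)
    then show ?thesis using s[of v m] by auto
  qed
  have "holds C s \<phi>" if "\<phi> \<in> \<Gamma>" for \<phi>
  proof -
    let ?\<Delta> = "insert \<phi> (eqs ((\<lambda>v. (v, s v)) ` fv \<phi>))"
    have "fv \<phi> \<subseteq> V" using that \<Gamma> by (auto simp: lform_def)
    then have "(\<lambda>v. (v, s v)) ` fv \<phi> \<subseteq> r" using total by blast
    then have "?\<Delta> \<subseteq> \<Gamma> \<union> eqs r" using that unfolding eqs_def by blast
    moreover have "finite ?\<Delta>" by (simp add: eqs_def finite_fv)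
    ultimately obtain s' where s': "\<forall>\<phi>\<in>?\<Delta>. holds C s' \<phi>"
      using r(2) unfolding fin_sat_def by meson
    then have "s' v = s v" if "v \<in> fv \<phi>" for v using that by (auto simp: eqs_def)
    then show ?thesis using s' sat_cong[of \<phi> s' s C UNIV] by auto
  qed
  then show ?thesis by blast
qed


section \<open>Finding automorphisms\<close>

text \<open>Conditions on an unknown automorphism \<open>f\<close> are written as formulas in which the variable
  \<open>Inl m\<close> stands for \<open>f m\<close>; the variables \<open>Inr n\<close> are a reserve of bound variables.\<close>

abbreviation images :: "('a \<Rightarrow> 'a) \<Rightarrow> 'a + nat \<Rightarrow> 'a" where
  "images f \<equiv> case_sum f (\<lambda>_. undefined)"

lemma infinite_images_variables: "infinite (UNIV :: ('b + nat) set)"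
  using finite_Plus_UNIV_iff infinite_UNIV_nat by blast

lemma holds_images_subst:
  "holds C (images f) (subst_fm \<rho> \<phi>) \<longleftrightarrow> holds C (\<lambda>v. eval C (images f) (\<rho> v)) \<phi>"
  by (rule holds_subst[OF infinite_images_variables])

lemma holds_images_cong:
  assumes "\<phi> \<in> lform C P (Inl ` A)" "\<And>m. m \<in> A \<Longrightarrow> f m = g m"
  shows "holds C (images f) \<phi> \<longleftrightarrow> holds C (images g) \<phi>"
  by (rule sat_cong) (use assms in \<open>auto simp: lform_def\<close>)

text \<open>Elementarity of the map to be found is itself a type over the empty set, so
  compactness yields an elementary map with the required properties, and homogeneity extends it.\<close>

theorem automorphism_compactness:
  assumes A: "small \<kappa> A" and P: "small \<kappa> P" and \<Gamma>: "\<Gamma> \<subseteq> lform C P (Inl ` A)"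
    and Q: "small \<kappa> (Domain Q)" "small \<kappa> (Range Q)"
    and fin: "\<And>Q'. Q' \<subseteq> Q \<Longrightarrow> finite Q' \<Longrightarrow>
      \<exists>f\<in>Auts C. (\<forall>(x, y)\<in>Q'. f x = y) \<and> (\<forall>\<phi>\<in>\<Gamma>. holds C (images f) \<phi>)"
  shows "\<exists>f\<in>Auts C. (\<forall>(x, y)\<in>Q. f x = y) \<and> (\<forall>\<phi>\<in>\<Gamma>. holds C (images f) \<phi>)"
proof -
  define B where "B = A \<union> Domain Q"
  have B: "small \<kappa> B" unfolding B_def using A Q(1) by (rule small_Un)
  define graph :: "('f, 'r, 'a, 'a + nat) fm set" where
    "graph = (\<lambda>(x, y). Eq (Var (Inl x)) (Par y)) ` Q"
  define elem :: "('f, 'r, 'a, 'a + nat) fm set" where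
    "elem = {subst_fm (\<lambda>n. Var (Inl (t n))) \<phi> | \<phi> t.
       \<phi> \<in> lform C {} (UNIV :: nat set) \<and> range t \<subseteq> B \<and> holds C t \<phi>}"
  have "\<Gamma> \<union> graph \<union> elem \<subseteq> lform C (P \<union> Range Q) (Inl ` B)"
  proof -
    have "elem \<subseteq> lform C (P \<union> Range Q) (Inl ` B)"
      unfolding elem_def by (auto intro!: subst_fm_lform)
    moreover have "graph \<subseteq> lform C (P \<union> Range Q) (Inl ` B)"
      unfolding graph_def B_def by (auto simp: lform_def)
    moreover have "\<Gamma> \<subseteq> lform C (P \<union> Range Q) (Inl ` B)"
      using \<Gamma> lform_mono[of _ C P "Inl ` A" "P \<union> Range Q" "Inl ` B"] unfolding B_def by blast
    ultimately show ?thesis by blast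
  qed
  moreover have "fin_sat C (\<Gamma> \<union> graph \<union> elem)"
    unfolding fin_sat_def
  proof (intro allI impI)
    fix \<Delta> assume \<Delta>: "\<Delta> \<subseteq> \<Gamma> \<union> graph \<union> elem" "finite \<Delta>"
    obtain Q' where Q': "Q' \<subseteq> Q" "finite Q'" "\<Delta> \<inter> graph = (\<lambda>(x, y). Eq (Var (Inl x)) (Par y)) ` Q'"
      using finite_subset_image[of "\<Delta> \<inter> graph" "\<lambda>(x, y). Eq (Var (Inl x)) (Par y)" Q] \<Delta>(2)
      unfolding graph_def by auto
    obtain f where f: "f \<in> Auts C" "\<forall>(x, y)\<in>Q'. f x = y" "\<forall>\<phi>\<in>\<Gamma>. holds C (images f) \<phi>"
      using fin[OF Q'(1,2)] by blast
    have "holds C (images f) \<phi>" if "\<phi> \<in> \<Delta>" for \<phi>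
    proof -
      consider "\<phi> \<in> \<Gamma>" | "\<phi> \<in> \<Delta> \<inter> graph" | "\<phi> \<in> elem" using \<Delta>(1) \<open>\<phi> \<in> \<Delta>\<close> by blast
      then show ?thesis
      proof cases
        case 1
        then show ?thesis using f(3) by blast
      next
        case 2
        then show ?thesis using f(2) unfolding Q'(3) by auto
      next
        case 3
        then obtain \<psi> t where \<psi>: "\<phi> = subst_fm (\<lambda>n. Var (Inl (t n))) \<psi>"
          "\<psi> \<in> lform C {} (UNIV :: nat set)" "holds C t \<psi>" unfolding elem_def by blast
        have "holds C (f \<circ> t) \<psi>"
          using holds_Auts[OF f(1), of \<psi> t] \<psi>(2,3) by (auto simp: lform_def)
        then show ?thesis unfolding \<psi>(1) holds_images_subst by (simp add: comp_def)
      qed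
    qed
    then show "\<exists>s. \<forall>\<phi>\<in>\<Delta>. holds C s \<phi>" by blast
  qed
  ultimately obtain s where s: "\<forall>\<phi>\<in>\<Gamma> \<union> graph \<union> elem. holds C s \<phi>"
    using compactness[OF small_Un[OF P Q(2)] small_image[OF B]] by blast
  have "\<exists>f\<in>Auts C. \<forall>m\<in>B. f m = (s \<circ> Inl) m"
  proof (rule homogeneity[OF B])
    fix \<phi> t assume \<phi>: "\<phi> \<in> lform C {} (UNIV :: nat set)" "range t \<subseteq> B" "holds C t \<phi>"
    then have "subst_fm (\<lambda>n. Var (Inl (t n))) \<phi> \<in> elem" unfolding elem_def by blast
    then have "holds C s (subst_fm (\<lambda>n. Var (Inl (t n))) \<phi>)" using s by blast
    then show "holds C (s \<circ> Inl \<circ> t) \<phi>"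
      by (simp add: holds_subst[OF infinite_images_variables] comp_def)
  qed
  then obtain f where f: "f \<in> Auts C" "\<And>m. m \<in> B \<Longrightarrow> f m = s (Inl m)" by auto
  have "f x = y" if "(x, y) \<in> Q" for x y
  proof -
    have "Eq (Var (Inl x)) (Par y) \<in> graph" using that by (force simp: graph_def)
    then have "holds C s (Eq (Var (Inl x)) (Par y))" using s by blast
    then have "s (Inl x) = y" by simp
    then show ?thesis using f(2) that by (auto simp: B_def)
  qed
  moreover have "holds C (images f) \<phi>" if "\<phi> \<in> \<Gamma>" for \<phi>
  proof -
    have "fv \<phi> \<subseteq> Inl ` A" using that \<Gamma> by (auto simp: lform_def)
    then have "holds C (images f) \<phi> \<longleftrightarrow> holds C s \<phi>"
      by (intro sat_cong) (use f(2) in \<open>auto simp: B_def\<close>)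
    then show ?thesis using s that by blast
  qed
  ultimately show ?thesis using f(1) by blast
qed

text \<open>In a formula about elements of \<open>P\<close> and entries of \<open>p\<close>, the former can be read as parameters and the
  latter as values of variables. So the map that is the identity on \<open>P\<close> and takes \<open>p\<close> to \<open>q\<close> is
  elementary, and homogeneity extends it.\<close>

lemma same_type_conjugate:
  fixes p q :: "'v \<Rightarrow> 'a"
  assumes P: "small \<kappa> P" and V: "small \<kappa> V"
    and imp: "\<And>\<phi> t. \<phi> \<in> lform C P (UNIV :: nat set) \<Longrightarrow> range t \<subseteq> V \<Longrightarrow>
      holds C (p \<circ> t) \<phi> \<Longrightarrow> holds C (q \<circ> t) \<phi>"
  shows "\<exists>g\<in>Auts C. (\<forall>m\<in>P. g m = m) \<and> (\<forall>v\<in>V. g (p v) = q v)"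
proof (cases "V = {}")
  case True
  then show ?thesis by (intro bexI[of _ id] id_Auts) auto
next
  case False
  then obtain v\<^sub>0 where v\<^sub>0: "v\<^sub>0 \<in> V" by blast
  define k where "k m = (SOME v. v \<in> V \<and> p v = m)" for m
  have k: "k m \<in> V \<and> p (k m) = m" if "m \<in> p ` V" for m
    unfolding k_def by (rule someI_ex) (use that in auto)
  define h where "h m = (if m \<in> P then m else q (k m))" for m
  have "small \<kappa> (P \<union> p ` V)" by (intro small_Un small_image P V)
  then have "\<exists>g\<in>Auts C. \<forall>m\<in>P \<union> p ` V. g m = h m"
  proof (rule homogeneity)
    fix \<phi> s assume \<phi>: "\<phi> \<in> lform C {} (UNIV :: nat set)" "range s \<subseteq> P \<union> p ` V" "holds C s \<phi>"
    define \<rho> :: "nat \<Rightarrow> ('f, 'a, nat) tm" where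
      "\<rho> n = (if s n \<in> P then Par (s n) else Var n)" for n
    define t where "t n = (if s n \<in> P then v\<^sub>0 else k (s n))" for n
    have sn: "s n \<in> p ` V" if "s n \<notin> P" for n using \<phi>(2) that by auto
    have "subst_fm \<rho> \<phi> \<in> lform C P UNIV"
      by (rule subst_fm_lform[OF \<phi>(1)]) (auto simp: \<rho>_def)
    moreover have "range t \<subseteq> V" using v\<^sub>0 k sn by (auto simp: t_def)
    moreover have "(\<lambda>n. eval C (p \<circ> t) (\<rho> n)) = s" using k sn by (auto simp: \<rho>_def t_def)
    then have "holds C (p \<circ> t) (subst_fm \<rho> \<phi>)" using \<phi>(3) by (simp add: holds_subst)
    ultimately have "holds C (q \<circ> t) (subst_fm \<rho> \<phi>)" by (rule imp)
    moreover have "(\<lambda>n. eval C (q \<circ> t) (\<rho> n)) = h \<circ> s" by (auto simp: \<rho>_def t_def h_def)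
    ultimately show "holds C (h \<circ> s) \<phi>" by (simp add: holds_subst)
  qed
  then obtain g where g: "g \<in> Auts C" "\<And>m. m \<in> P \<union> p ` V \<Longrightarrow> g m = h m" by blast
  have "h (p v) = q v" if "v \<in> V" for v
  proof (cases "p v \<in> P")
    case True
    then have "holds C (q \<circ> (\<lambda>_. v)) (Eq (Var (0 :: nat)) (Par (p v)))"
      by (intro imp) (use that in \<open>auto simp: lform_def\<close>)
    then show ?thesis using True by (simp add: h_def)
  next
    case False
    have pv: "k (p v) \<in> V" "p (k (p v)) = p v" using k[of "p v"] that by auto
    let ?t = "\<lambda>n :: nat. if n = 0 then v else k (p v)"
    have "holds C (q \<circ> ?t) (Eq (Var 0) (Var 1))"
      by (intro imp) (use that pv in \<open>auto simp: lform_def\<close>)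
    then show ?thesis using False by (simp add: h_def)
  qed
  then show ?thesis using g by (auto simp: h_def intro!: bexI[of _ g])
qed

end

section \<open>Small models\<close>

context monster
begin

text \<open>Only the free variables of a formula in \<open>lform C P V\<close> are restricted to \<open>V\<close>. Its bound variables
  range over the whole type, so smallness needs a small type of variables.\<close>

lemma small_lform:
  assumes P: "small \<kappa> P"
  shows "small \<kappa> (lform C P (UNIV :: nat set))"
proof -
  define tms :: "('f, 'a, nat) tm set" where "tms = {t. wf_tm C t \<and> tm_pars t \<subseteq> P}"
  have "small \<kappa> tms"
  proof -
    define op :: "(nat + 'a) + 'f \<Rightarrow> ('f, 'a, nat) tm list \<Rightarrow> ('f, 'a, nat) tm" where
      "op i ts = (case i of Inl (Inl v) \<Rightarrow> Var v | Inl (Inr m) \<Rightarrow> Par m | Inr g \<Rightarrow> Fn g ts)" for i ts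
    have op: "op (Inl (Inl v)) ts = Var v" "op (Inl (Inr m)) ts = Par m" "op (Inr g) ts = Fn g ts"
      for v m g ts by (simp_all add: op_def)
    define I where "I = ((UNIV :: nat set) <+> P) <+> fst ` funs C"
    have step: "op i ts \<in> closure_under op I" if "i \<in> I" "set ts \<subseteq> closure_under op I" for i ts
      using closure_under.step[of i I ts op] that unfolding lists_eq_set by blast
    have "t \<in> closure_under op I" if "t \<in> tms" for t
      using that
    proof (induction t)
      case (Var v)
      show ?case by (intro step[of "Inl (Inl v)" "[]", unfolded op]) (auto simp: I_def)
    next
      case (Par m)
      then show ?case
        by (intro step[of "Inl (Inr m)" "[]", unfolded op]) (auto simp: I_def tms_def)
    next
      case (Fn g ts)
      then have "set ts \<subseteq> closure_under op I" "g \<in> fst ` funs C" by (force simp: tms_def)+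
      then show ?case by (intro step[of "Inr g" ts, unfolded op]) (auto simp: I_def)
    qed
    then have "tms \<subseteq> closure_under op I" by blast
    then show ?thesis
      unfolding I_def
      by (rule small_subset[rotated])
        (intro small_closure_under small_Plus small_nat P small_image small_language)
  qed
  define atoms :: "('f, 'r, 'a, nat) fm set" where
    "atoms = (\<lambda>(t, u). Eq t u) ` (tms \<times> tms) \<union> (\<lambda>(R, ts). Rel R ts) ` (fst ` rels C \<times> lists tms)"
  have atoms: "small \<kappa> atoms"
    unfolding atoms_def
    by (intro small_Un small_image small_Times small_lists \<open>small \<kappa> tms\<close> small_language)
  define op :: "('f, 'r, 'a, nat) fm + (bool + nat) \<Rightarrow>
      ('f, 'r, 'a, nat) fm list \<Rightarrow> ('f, 'r, 'a, nat) fm" where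
    "op i \<phi>s = (case i of Inl \<phi> \<Rightarrow> \<phi>
      | Inr (Inl b) \<Rightarrow> if b then Neg (\<phi>s ! 0) else Conj (\<phi>s ! 0) (\<phi>s ! 1)
      | Inr (Inr v) \<Rightarrow> Ex v (\<phi>s ! 0))" for i \<phi>s
  have op: "op (Inl \<phi>) \<phi>s = \<phi>" "op (Inr (Inl True)) [\<phi>] = Neg \<phi>"
    "op (Inr (Inl False)) [\<phi>, \<psi>] = Conj \<phi> \<psi>" "op (Inr (Inr v)) [\<phi>] = Ex v \<phi>" for \<phi> \<psi> \<phi>s v
    by (simp_all add: op_def)
  define I where "I = atoms <+> ((UNIV :: bool set) <+> (UNIV :: nat set))"
  have step: "op i \<phi>s \<in> closure_under op I" if "i \<in> I" "set \<phi>s \<subseteq> closure_under op I" for i \<phi>s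
    using closure_under.step[of i I \<phi>s op] that unfolding lists_eq_set by blast
  have "\<phi> \<in> closure_under op I" if "wf_fm C \<phi>" "fm_pars \<phi> \<subseteq> P" for \<phi>
    using that
  proof (induction \<phi>)
    case (Eq t u)
    then have "Eq t u \<in> atoms" by (auto simp: atoms_def tms_def)
    then show ?case by (intro step[of "Inl (Eq t u)" "[]", unfolded op]) (auto simp: I_def)
  next
    case (Rel R ts)
    then have "ts \<in> lists tms" "R \<in> fst ` rels C" by (force simp: tms_def)+
    then have "Rel R ts \<in> atoms" by (auto simp: atoms_def)
    then show ?case by (intro step[of "Inl (Rel R ts)" "[]", unfolded op]) (auto simp: I_def)
  next
    case (Neg \<phi>)
    then show ?case by (intro step[of "Inr (Inl True)" "[\<phi>]", unfolded op]) (auto simp: I_def)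
  next
    case (Conj \<phi> \<psi>)
    then show ?case by (intro step[of "Inr (Inl False)" "[\<phi>, \<psi>]", unfolded op]) (auto simp: I_def)
  next
    case (Ex v \<phi>)
    then show ?case by (intro step[of "Inr (Inr v)" "[\<phi>]", unfolded op]) (auto simp: I_def)
  qed
  then have "lform C P UNIV \<subseteq> closure_under op I" by (auto simp: lform_def)
  then show ?thesis
    unfolding I_def
    by (rule small_subset[rotated])
      (intro small_closure_under small_Plus small_nat small_finite[OF finite_UNIV] atoms)
qed

text \<open>Downward Loewenheim--Skolem: the closure under Skolem functions, which are indexed by a formula
  and the variable to be witnessed, satisfies the Tarski--Vaught criterion.\<close>

lemma small_elementary_sub:
  assumes A: "small \<kappa> A"
  shows "\<exists>M. A \<subseteq> M \<and> small \<kappa> M \<and> elementary_sub C M"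
proof -
  define op :: "('a + ('f, 'r, 'a, nat) fm \<times> nat) + 'f \<Rightarrow> 'a list \<Rightarrow> 'a" where
    "op i xs = (case i of Inl (Inl a) \<Rightarrow> a
      | Inl (Inr (\<phi>, v)) \<Rightarrow> (SOME m. holds C ((\<lambda>n. xs ! n)(v := m)) \<phi>)
      | Inr g \<Rightarrow> Fint C g xs)" for i xs
  define I where "I = (A <+> (lform C {} (UNIV :: nat set) \<times> (UNIV :: nat set))) <+> fst ` funs C"
  define M where "M = closure_under op I"
  have step: "op i xs \<in> M" if "i \<in> I" "set xs \<subseteq> M" for i xs
    using closure_under.step[of i I xs op] that unfolding M_def lists_eq_set by blast
  have "small \<kappa> M"
    unfolding M_def I_def
    by (intro small_closure_under small_Plus small_Times A small_image small_language small_nat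
        small_lform small_finite finite.emptyI)
  moreover have "A \<subseteq> M"
  proof
    fix a assume "a \<in> A"
    then show "a \<in> M" using step[of "Inl (Inl a)" "[]"] by (auto simp: I_def op_def)
  qed
  moreover have "elementary_sub C M"
    unfolding elementary_sub_def
  proof (intro conjI ballI allI impI)
    have "op (Inl (Inr (verum, 0))) [] \<in> M" by (rule step) (auto simp: I_def)
    then show "M \<noteq> {}" by blast
  next
    fix gn assume gn: "gn \<in> funs C"
    have "Fint C (fst gn) xs \<in> M" if "set xs \<subseteq> M" for xs
      using step[of "Inr (fst gn)" xs] that gn by (auto simp: I_def op_def)
    then show "case gn of (g, n) \<Rightarrow> \<forall>xs. length xs = n \<and> set xs \<subseteq> M \<longrightarrow> Fint C g xs \<in> M"
      by (cases gn) auto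
  next
    have TV: "sat C M s \<phi> \<longleftrightarrow> holds C s \<phi>" if "wf_fm C \<phi>" "fm_pars \<phi> = {}" "range s \<subseteq> M"
      for \<phi> :: "('f, 'r, 'a, nat) fm" and s
      using that
    proof (induction \<phi> arbitrary: s)
      case (Ex v \<phi>)
      have IH: "sat C M (s(v := m)) \<phi> \<longleftrightarrow> holds C (s(v := m)) \<phi>" if "m \<in> M" for m
        by (rule Ex.IH) (use Ex.prems that in auto)
      have "\<exists>m\<in>M. holds C (s(v := m)) \<phi>" if m: "holds C (s(v := m)) \<phi>" for m
      proof -
        obtain n where n: "fv \<phi> \<subseteq> {..<n}" using finite_nat_bounded[OF finite_fv] by blast
        define xs where "xs = map s [0..<n]"
        have agree: "holds C ((\<lambda>i. xs ! i)(v := k)) \<phi> \<longleftrightarrow> holds C (s(v := k)) \<phi>" for k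
          by (rule sat_cong) (use n in \<open>auto simp: xs_def\<close>)
        have "op (Inl (Inr (\<phi>, v))) xs \<in> M"
          by (rule step) (use Ex.prems in \<open>auto simp: I_def xs_def lform_def\<close>)
        moreover have "holds C ((\<lambda>i. xs ! i)(v := op (Inl (Inr (\<phi>, v))) xs)) \<phi>"
          unfolding op_def using someI[of "\<lambda>k. holds C ((\<lambda>i. xs ! i)(v := k)) \<phi>" m] m agree
          by simp
        ultimately show ?thesis using agree by blast
      qed
      then show ?case using IH by auto
    qed auto
    fix \<phi> :: "('f, 'r, 'a, nat) fm" and s :: "nat \<Rightarrow> 'a" assume "\<phi> \<in> lform C {} UNIV" "range s \<subseteq> M"
    then show "sat C M s \<phi> \<longleftrightarrow> holds C s \<phi>" by (intro TV) (auto simp: lform_def)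
  qed
  ultimately show ?thesis by blast
qed

lemma elementary_sub_image:
  assumes f: "f \<in> Auts C" and M: "elementary_sub C M"
  shows "elementary_sub C (f ` M)"
  unfolding elementary_sub_def
proof (intro conjI ballI allI impI)
  show "f ` M \<noteq> {}" using M by (simp add: elementary_sub_def)
next
  fix gn assume gn: "gn \<in> funs C"
  have "Fint C (fst gn) xs \<in> f ` M" if xs: "length xs = snd gn" "set xs \<subseteq> f ` M" for xs
  proof -
    define ys where "ys = map (inv_into M f) xs"
    have ys: "set ys \<subseteq> M" "xs = map f ys"
      using xs(2) unfolding ys_def by (auto simp: inv_into_into f_inv_into_f map_idI subset_iff)
    have "\<forall>(g, n)\<in>funs C. \<forall>xs. length xs = n \<and> set xs \<subseteq> M \<longrightarrow> Fint C g xs \<in> M"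
      using M unfolding elementary_sub_def by blast
    from bspec[OF this gn] have "Fint C (fst gn) ys \<in> M"
      using xs(1) ys by (simp add: split_beta)
    then have "f (Fint C (fst gn) ys) \<in> f ` M" by (rule imageI)
    then show ?thesis using Auts_Fint[OF f, of "fst gn" ys] gn xs(1) ys(2) by simp
  qed
  then show "case gn of (g, n) \<Rightarrow> \<forall>xs. length xs = n \<and> set xs \<subseteq> f ` M \<longrightarrow> Fint C g xs \<in> f ` M"
    by (cases gn) auto
next
  fix \<phi> :: "('f, 'r, 'a, nat) fm" and s :: "nat \<Rightarrow> 'a"
  assume \<phi>: "\<phi> \<in> lform C {} UNIV" and s: "range s \<subseteq> f ` M"
  define t where "t = inv_into M f \<circ> s"
  have st: "s = f \<circ> t"
    using s unfolding t_def by (auto simp: fun_eq_iff f_inv_into_f image_subset_iff)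
  have "range t \<subseteq> M" using s unfolding t_def by (auto simp: inv_into_into image_subset_iff)
  then have "sat C M t \<phi> \<longleftrightarrow> holds C t \<phi>" using M \<phi> by (simp add: elementary_sub_def)
  then show "sat C (f ` M) s \<phi> \<longleftrightarrow> holds C s \<phi>"
    using sat_Auts[OF f, of \<phi> M t] holds_Auts[OF f, of \<phi> t] \<phi> by (simp add: st lform_def)
qed

end


section \<open>Automorphisms fixing a hyperimaginary\<close>

lemma compose_comp: "compose S (f \<circ> g) x = compose S f (compose S g x)"
  by (auto simp: compose_def)

lemma compose_compose_image: "compose S (f \<circ> g) ` Z = compose S f ` compose S g ` Z"
  by (simp add: compose_comp image_image)

locale hyperimaginary_setup = monster T C \<kappa>
  for T :: "('f, 'r, 'a, nat) fm set"
    and C :: "('f, 'r, 'a) fo_structure"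
    and \<kappa> :: "'k rel" +
  fixes \<alpha> :: "'k set"
    and e :: "('k \<Rightarrow> 'a) set"
  assumes hyperimaginary: "hyperimaginary C \<kappa> \<alpha> e"
begin

abbreviation Aut_e :: "('a \<Rightarrow> 'a) set" where "Aut_e \<equiv> Aut_over C \<alpha> e"

lemma Aut_e_Auts: "f \<in> Aut_e \<Longrightarrow> f \<in> Auts C"
  by (simp add: Aut_over_def)

lemma in_dcl_iff: "in_dcl C \<alpha> e A \<longleftrightarrow> (\<forall>f\<in>Auts C. (\<forall>m\<in>A. f m = m) \<longrightarrow> f \<in> Aut_e)"
  by (auto simp: in_dcl_def Aut_over_def)

lemma hyperimaginary_extensional: "e \<subseteq> \<alpha> \<rightarrow>\<^sub>E UNIV"
  using hyperimaginary unfolding hyperimaginary_def by (metis in_quotient_imp_subset)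

lemma compose_id_e: "compose \<alpha> id ` e = e"
proof -
  have "compose \<alpha> id x = x" if "x \<in> e" for x
    using that hyperimaginary_extensional by (auto simp: compose_def PiE_def extensional_def fun_eq_iff)
  then show ?thesis by (simp cong: image_cong_simp)
qed

lemma id_Aut_e: "id \<in> Aut_e"
  by (simp add: Aut_over_def id_Auts compose_id_e)

lemma comp_Aut_e: "f \<in> Aut_e \<Longrightarrow> g \<in> Aut_e \<Longrightarrow> f \<circ> g \<in> Aut_e"
  by (simp add: Aut_over_def comp_Auts compose_compose_image)

lemma inv_Aut_e:
  assumes "f \<in> Aut_e"
  shows "inv_into UNIV f \<in> Aut_e"
proof -
  have "inv_into UNIV f \<circ> f = id"
    using Auts_bij[OF Aut_e_Auts[OF assms]] by (simp add: bij_is_inj)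
  then have "compose \<alpha> (inv_into UNIV f) ` compose \<alpha> f ` e = e"
    by (metis compose_compose_image compose_id_e)
  then show ?thesis using assms by (simp add: Aut_over_def inv_Auts)
qed

lemma Aut_e_inverses:
  assumes "f \<in> Aut_e"
  shows "f (inv_into UNIV f x) = x" "inv_into UNIV f (f x) = x"
  using Auts_bij[OF Aut_e_Auts[OF assms]] by (simp_all add: bij_is_surj surj_f_inv_f bij_is_inj)

text \<open>If \<open>a\<close> represents \<open>e\<close>, then an automorphism \<open>f\<close> fixes \<open>e\<close> iff \<open>E(a, f a)\<close>; this is a
  type-definable condition on \<open>f\<close>.\<close>

lemma Aut_e_type_definable:
  obtains A \<Gamma> where "small \<kappa> A" "\<Gamma> \<subseteq> lform C A (Inl ` A)"
    "\<And>f. f \<in> Auts C \<Longrightarrow> f \<in> Aut_e \<longleftrightarrow> (\<forall>\<phi>\<in>\<Gamma>. holds C (images f) \<phi>)"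
proof -
  obtain \<Gamma> where small: "small \<kappa> \<alpha>" and \<Gamma>: "\<Gamma> \<subseteq> lform C {} (\<alpha> <+> \<alpha>)"
    and equiv: "equiv (\<alpha> \<rightarrow>\<^sub>E UNIV) (tdef_rel C \<alpha> \<Gamma>)"
    and e: "e \<in> (\<alpha> \<rightarrow>\<^sub>E UNIV) // tdef_rel C \<alpha> \<Gamma>"
    using hyperimaginary unfolding hyperimaginary_def by blast
  define E where "E = tdef_rel C \<alpha> \<Gamma>"
  obtain a where a: "a \<in> \<alpha> \<rightarrow>\<^sub>E UNIV" "e = E `` {a}"
    using e unfolding E_def by (auto elim: quotientE)
  have sym: "(x, y) \<in> E \<Longrightarrow> (y, x) \<in> E" for x y
    using equiv unfolding E_def[symmetric] by (meson equivE symD)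
  have trans: "(x, y) \<in> E \<Longrightarrow> (y, z) \<in> E \<Longrightarrow> (x, z) \<in> E" for x y z
    using equiv unfolding E_def[symmetric] by (meson equivE transD)
  have refl: "(a, a) \<in> E"
    using equiv a(1) unfolding E_def[symmetric] by (meson equivE refl_onD)
  have ext: "(x, y) \<in> E \<Longrightarrow> y \<in> \<alpha> \<rightarrow>\<^sub>E UNIV" for x y unfolding E_def tdef_rel_def by blast
  have agree: "holds C (case_sum (compose \<alpha> f x) (compose \<alpha> g y)) \<phi> \<longleftrightarrow>
      holds C (case_sum (f \<circ> x) (g \<circ> y)) \<phi>" if "\<phi> \<in> \<Gamma>" for \<phi> f g x y
  proof (rule sat_cong)
    fix v assume "v \<in> fv \<phi>"
    then have "v \<in> \<alpha> <+> \<alpha>" using \<Gamma> that by (auto simp: lform_def)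
    then show "case_sum (compose \<alpha> f x) (compose \<alpha> g y) v = case_sum (f \<circ> x) (g \<circ> y) v"
      by (auto simp: compose_def)
  qed
  have pres: "(compose \<alpha> f x, compose \<alpha> f y) \<in> E" if f: "f \<in> Auts C" and xy: "(x, y) \<in> E" for f x y
  proof -
    have "holds C (case_sum (f \<circ> x) (f \<circ> y)) \<phi>" if "\<phi> \<in> \<Gamma>" for \<phi>
    proof -
      have "holds C (f \<circ> case_sum x y) \<phi> \<longleftrightarrow> holds C (case_sum x y) \<phi>"
        by (rule holds_Auts[OF f]) (use \<Gamma> that in \<open>auto simp: lform_def\<close>)
      moreover have "f \<circ> case_sum x y = case_sum (f \<circ> x) (f \<circ> y)"
        by (auto simp: fun_eq_iff split: sum.split)
      ultimately show ?thesis using xy that unfolding E_def tdef_rel_def by auto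
    qed
    then have "\<forall>\<phi>\<in>\<Gamma>. holds C (case_sum (compose \<alpha> f x) (compose \<alpha> f y)) \<phi>"
      by (blast intro: agree[THEN iffD2])
    moreover have "compose \<alpha> f x \<in> \<alpha> \<rightarrow>\<^sub>E UNIV" "compose \<alpha> f y \<in> \<alpha> \<rightarrow>\<^sub>E UNIV"
      by (simp_all add: compose_def)
    ultimately show ?thesis unfolding E_def tdef_rel_def by blast
  qed
  have iff: "f \<in> Aut_e \<longleftrightarrow> (a, compose \<alpha> f a) \<in> E" if f: "f \<in> Auts C" for f
  proof
    assume "f \<in> Aut_e"
    then have "compose \<alpha> f a \<in> e" using refl a(2) by (auto simp: Aut_over_def)
    then show "(a, compose \<alpha> f a) \<in> E" using a(2) by simp
  next
    assume fa: "(a, compose \<alpha> f a) \<in> E"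
    have "compose \<alpha> f ` e = e"
    proof
      show "compose \<alpha> f ` e \<subseteq> e" using pres[OF f] trans[OF fa] a(2) by auto
    next
      show "e \<subseteq> compose \<alpha> f ` e"
      proof
        fix y assume "y \<in> e"
        then have y: "(a, y) \<in> E" using a(2) by simp
        let ?g = "inv_into UNIV f"
        have bij: "bij f" by (rule Auts_bij[OF f])
        have "(compose \<alpha> f a, y) \<in> E" using trans[OF sym[OF fa] y] .
        then have "(compose \<alpha> ?g (compose \<alpha> f a), compose \<alpha> ?g y) \<in> E"
          by (rule pres[OF inv_Auts[OF f]])
        moreover have "compose \<alpha> ?g (compose \<alpha> f a) = a"
          using bij a(1) by (auto simp: compose_def fun_eq_iff bij_is_inj PiE_def extensional_def)
        moreover have "compose \<alpha> f (compose \<alpha> ?g y) = y"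
          using bij ext[OF y]
          by (auto simp: compose_def fun_eq_iff bij_is_surj surj_f_inv_f PiE_def extensional_def)
        ultimately show "y \<in> compose \<alpha> f ` e" using a(2) by (metis Image_singleton_iff imageI)
      qed
    qed
    then show "f \<in> Aut_e" using f by (simp add: Aut_over_def)
  qed
  define \<rho> :: "'k + 'k \<Rightarrow> ('f, 'a, 'a + nat) tm" where
    "\<rho> = case_sum (\<lambda>i. Par (a i)) (\<lambda>i. Var (Inl (a i)))"
  show thesis
  proof (rule that)
    show "small \<kappa> (a ` \<alpha>)" by (rule small_image[OF small])
    show "subst_fm \<rho> ` \<Gamma> \<subseteq> lform C (a ` \<alpha>) (Inl ` a ` \<alpha>)"
      using \<Gamma> by (auto simp: \<rho>_def intro!: subst_fm_lform)
    fix f assume f: "f \<in> Auts C"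
    have ext_f: "compose \<alpha> f a \<in> \<alpha> \<rightarrow>\<^sub>E UNIV" by (simp add: compose_def)
    have "(\<lambda>v. eval C (images f) (\<rho> v)) = case_sum a (f \<circ> a)"
      by (auto simp: \<rho>_def fun_eq_iff split: sum.split)
    then have "holds C (images f) (subst_fm \<rho> \<phi>) \<longleftrightarrow> holds C (case_sum a (compose \<alpha> f a)) \<phi>"
      if "\<phi> \<in> \<Gamma>" for \<phi>
    proof -
      have "compose \<alpha> id a = a"
        using a(1) by (auto simp: compose_def PiE_def extensional_def fun_eq_iff)
      then show ?thesis
        using agree[OF that, of id a f a] \<open>(\<lambda>v. eval C (images f) (\<rho> v)) = _\<close>
        by (simp add: holds_images_subst)
    qed
    then show "f \<in> Aut_e \<longleftrightarrow> (\<forall>\<phi>\<in>subst_fm \<rho> ` \<Gamma>. holds C (images f) \<phi>)"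
      unfolding iff[OF f] E_def tdef_rel_def using a(1) ext_f by simp
  qed
qed

text \<open>An automorphism that fixes \<open>A\<close> pointwise satisfies the same of these conditions as the identity.\<close>

lemma in_dcl_of_definition:
  assumes "\<Gamma> \<subseteq> lform C A (Inl ` A)"
    "\<And>f. f \<in> Auts C \<Longrightarrow> f \<in> Aut_e \<longleftrightarrow> (\<forall>\<phi>\<in>\<Gamma>. holds C (images f) \<phi>)"
  shows "in_dcl C \<alpha> e A"
  unfolding in_dcl_iff
proof (intro ballI impI)
  fix f assume f: "f \<in> Auts C" "\<forall>m\<in>A. f m = m"
  have "holds C (images f) \<phi> \<longleftrightarrow> holds C (images id) \<phi>" if "\<phi> \<in> \<Gamma>" for \<phi>
    by (rule holds_images_cong) (use assms(1) that f(2) in auto)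
  then show "f \<in> Aut_e" using assms(2)[OF f(1)] assms(2)[OF id_Auts] id_Aut_e by blast
qed

end

section \<open>Lascar strong automorphisms\<close>

context hyperimaginary_setup
begin

lemma Aut_e_group:
  defines "G \<equiv> (BijGroup UNIV)\<lparr>carrier := Aut_e\<rparr>"
  shows "group G" "\<one>\<^bsub>G\<^esub> = id"
    "\<And>f g. f \<in> Aut_e \<Longrightarrow> g \<in> Aut_e \<Longrightarrow> f \<otimes>\<^bsub>G\<^esub> g = f \<circ> g"
    "\<And>f. f \<in> Aut_e \<Longrightarrow> m_inv G f = inv_into UNIV f"
proof -
  show one: "\<one>\<^bsub>G\<^esub> = id" by (auto simp: G_def BijGroup_def)
  have Bij: "f \<in> Bij UNIV" if "f \<in> Aut_e" for f
    using Auts_bij[OF Aut_e_Auts[OF that]] by (simp add: Bij_def)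
  show mult: "f \<otimes>\<^bsub>G\<^esub> g = f \<circ> g" if "f \<in> Aut_e" "g \<in> Aut_e" for f g
    using that Bij by (auto simp: G_def BijGroup_def compose_def)
  have inv: "inv_into UNIV f \<otimes>\<^bsub>G\<^esub> f = \<one>\<^bsub>G\<^esub>" if "f \<in> Aut_e" for f
    using Aut_e_inverses[OF that] that by (auto simp: mult one inv_Aut_e)
  have carrier: "carrier G = Aut_e" by (simp add: G_def)
  show "group G"
  proof (rule groupI)
    show "\<exists>y\<in>carrier G. y \<otimes>\<^bsub>G\<^esub> x = \<one>\<^bsub>G\<^esub>" if "x \<in> carrier G" for x
      using that inv inv_Aut_e unfolding carrier by blast
  qed (auto simp: carrier mult one id_Aut_e comp_Aut_e)
  then show "m_inv G f = inv_into UNIV f" if "f \<in> Aut_e" for f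
    using that inv inv_Aut_e by (intro group.inv_equality) (auto simp: carrier)
qed

definition Lascar_generators :: "('a \<Rightarrow> 'a) set" where
  "Lascar_generators = {f \<in> Aut_e.
     \<exists>M. small \<kappa> M \<and> elementary_sub C M \<and> in_dcl C \<alpha> e M \<and> (\<forall>m\<in>M. f m = m)}"

abbreviation Autf_e :: "('a \<Rightarrow> 'a) set" where "Autf_e \<equiv> Autf_L C \<kappa> \<alpha> e"

lemma Lascar_generators_Aut_e: "f \<in> Lascar_generators \<Longrightarrow> f \<in> Aut_e"
  by (simp add: Lascar_generators_def)

lemma Lascar_generators_inv:
  assumes "f \<in> Lascar_generators"
  shows "inv_into UNIV f \<in> Lascar_generators"
proof -
  have f: "f \<in> Aut_e" by (rule Lascar_generators_Aut_e[OF assms])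
  have "inv_into UNIV f m = m" if "f m = m" for m
    using Aut_e_inverses(2)[OF f, of m] that by simp
  then show ?thesis using assms inv_Aut_e[OF f] unfolding Lascar_generators_def by blast
qed

text \<open>A conjugate \<open>f g f\<inverse>\<close> fixes the model \<open>f(M)\<close> if \<open>g\<close> fixes \<open>M\<close>.\<close>

lemma Lascar_generators_conj:
  assumes f: "f \<in> Aut_e" and g: "g \<in> Lascar_generators"
  shows "f \<circ> g \<circ> inv_into UNIV f \<in> Lascar_generators"
proof -
  let ?f' = "inv_into UNIV f"
  obtain M where M: "small \<kappa> M" "elementary_sub C M" "in_dcl C \<alpha> e M" "\<forall>m\<in>M. g m = m"
    using g unfolding Lascar_generators_def by blast
  have "in_dcl C \<alpha> e (f ` M)"
    unfolding in_dcl_iff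
  proof (intro ballI impI)
    fix h assume h: "h \<in> Auts C" "\<forall>m\<in>f ` M. h m = m"
    have "?f' \<circ> h \<circ> f \<in> Auts C"
      by (intro comp_Auts inv_Auts h(1) Aut_e_Auts[OF f])
    moreover have "\<forall>m\<in>M. (?f' \<circ> h \<circ> f) m = m" using h(2) by (simp add: Aut_e_inverses[OF f])
    ultimately have "?f' \<circ> h \<circ> f \<in> Aut_e" using M(3) unfolding in_dcl_iff by blast
    then have "f \<circ> (?f' \<circ> h \<circ> f) \<circ> ?f' \<in> Aut_e"
      by (rule comp_Aut_e[OF comp_Aut_e[OF f] inv_Aut_e[OF f]])
    moreover have "f \<circ> (?f' \<circ> h \<circ> f) \<circ> ?f' = h" by (simp add: fun_eq_iff Aut_e_inverses[OF f])
    ultimately show "h \<in> Aut_e" by (simp only:)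
  qed
  moreover have "\<forall>m\<in>f ` M. (f \<circ> g \<circ> ?f') m = m" using M(4) by (simp add: Aut_e_inverses[OF f])
  moreover have "f \<circ> g \<circ> ?f' \<in> Aut_e"
    by (intro comp_Aut_e inv_Aut_e f Lascar_generators_Aut_e g)
  moreover have "small \<kappa> (f ` M)" "elementary_sub C (f ` M)"
    using small_image[OF M(1)] elementary_sub_image[OF Aut_e_Auts[OF f] M(2)] by auto
  ultimately show ?thesis unfolding Lascar_generators_def by blast
qed

lemma Autf_e_eq: "Autf_e = generate ((BijGroup UNIV)\<lparr>carrier := Aut_e\<rparr>) Lascar_generators"
  by (simp add: Autf_L_def Lascar_generators_def)

text \<open>There is no step for inverses, because the set of generators is closed under them.\<close>

lemma Autf_e_induct [consumes 1, case_names id generator comp]: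
  assumes "f \<in> Autf_e" and "P id" and gen: "\<And>f. f \<in> Lascar_generators \<Longrightarrow> P f"
    and "\<And>f g. f \<in> Autf_e \<Longrightarrow> g \<in> Autf_e \<Longrightarrow> f \<in> Aut_e \<Longrightarrow> g \<in> Aut_e \<Longrightarrow> P f \<Longrightarrow> P g \<Longrightarrow> P (f \<circ> g)"
  shows "P f"
proof -
  let ?G = "(BijGroup UNIV)\<lparr>carrier := Aut_e\<rparr>"
  have "f \<in> Aut_e \<and> P f" if "f \<in> generate ?G Lascar_generators"
    using that
  proof (induction rule: generate.induct)
    case one
    show ?case unfolding Aut_e_group(2) using assms(2) id_Aut_e by (rule conjI[rotated])
  next
    case (incl h)
    then show ?case by (simp add: gen Lascar_generators_Aut_e)
  next
    case (inv h)
    then show ?case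
      by (simp add: Aut_e_group(4) gen Lascar_generators_Aut_e Lascar_generators_inv inv_Aut_e)
  next
    case (eng h1 h2)
    then have h: "h1 \<in> Aut_e" "h2 \<in> Aut_e" "P h1" "P h2" by blast+
    then have "P (h1 \<circ> h2)" using assms(4)[of h1 h2] eng.hyps by (simp only: Autf_e_eq)
    then show ?case unfolding Aut_e_group(3)[OF h(1,2)] using comp_Aut_e[OF h(1,2)] by blast
  qed
  then show ?thesis using assms(1) by (simp add: Autf_e_eq)
qed

lemma Autf_e_Aut_e: "f \<in> Autf_e \<Longrightarrow> f \<in> Aut_e"
  by (induction rule: Autf_e_induct) (rule id_Aut_e comp_Aut_e Lascar_generators_Aut_e; assumption?)+

lemma generator_Autf_e: "f \<in> Lascar_generators \<Longrightarrow> f \<in> Autf_e"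
  unfolding Autf_L_def Lascar_generators_def by (rule generate.incl)

lemma id_Autf_e: "id \<in> Autf_e"
  using generate.one[of "(BijGroup UNIV)\<lparr>carrier := Aut_e\<rparr>"]
  unfolding Autf_L_def Aut_e_group(2) .

lemma comp_Autf_e:
  assumes "f \<in> Autf_e" "g \<in> Autf_e"
  shows "f \<circ> g \<in> Autf_e"
  using generate.eng[OF assms[unfolded Autf_e_eq]] Aut_e_group(3)[of f g] Autf_e_Aut_e assms
  by (simp only: Autf_e_eq)

lemma inv_Autf_e: "f \<in> Autf_e \<Longrightarrow> inv_into UNIV f \<in> Autf_e"
proof (induction rule: Autf_e_induct)
  case id
  show ?case unfolding inv_id by (rule id_Autf_e)
next
  case (generator f)
  then show ?case by (simp add: generator_Autf_e Lascar_generators_inv)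
next
  case (comp f g)
  have "inv_into UNIV (f \<circ> g) = inv_into UNIV g \<circ> inv_into UNIV f"
    by (rule o_inv_distrib; rule Auts_bij, rule Aut_e_Auts, rule comp.hyps)
  then show ?case using comp_Autf_e[OF comp.IH(2,1)] by (simp only:)
qed

lemma conj_Autf_e:
  assumes f: "f \<in> Aut_e" and "g \<in> Autf_e"
  shows "f \<circ> g \<circ> inv_into UNIV f \<in> Autf_e"
  using assms(2)
proof (induction rule: Autf_e_induct)
  case id
  have "f \<circ> id \<circ> inv_into UNIV f = id" by (simp add: fun_eq_iff Aut_e_inverses[OF f])
  then show ?case using id_Autf_e by (simp only:)
next
  case (generator g)
  then show ?case by (intro generator_Autf_e Lascar_generators_conj f)
next
  case (comp g h)
  have "f \<circ> (g \<circ> h) \<circ> inv_into UNIV f =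
      (f \<circ> g \<circ> inv_into UNIV f) \<circ> (f \<circ> h \<circ> inv_into UNIV f)"
    by (simp add: fun_eq_iff Aut_e_inverses[OF f])
  then show ?case using comp_Autf_e[OF comp.IH] by (simp only:)
qed

text \<open>This is applied with the realizations of a partial type as \<open>R\<close> and the set of entries of \<open>x\<close> as
  \<open>vals x\<close>. Fix a small model \<open>M\<close> with \<open>e \<in> dcl(M)\<close>. The type of \<open>k(M)\<close> over \<open>M\<close> determines \<open>k\<close> modulo
  \<open>Autf_e\<close>, and there is a small number of such types. A set \<open>B\<close> excludes a type if no \<open>k \<in> Aut_e\<close> that fixes
  \<open>B\<close> pointwise has it. By compactness a type excluded by \<open>B\<close> is excluded by a finite subset of \<open>B\<close>;
  \<open>U\<close> collects, for each type that can be excluded, finitely many \<open>x\<close> whose entries exclude it. Being able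
  to choose finite sets matters because \<open>\<kappa>\<close> may be singular, so that small unions of small sets
  need not be small.\<close>

lemma small_universal_support:
  fixes vals :: "'b \<Rightarrow> 'a set" and R :: "'b set"
  assumes big: "\<And>S. S \<subseteq> R \<Longrightarrow> small \<kappa> S \<Longrightarrow> small \<kappa> (\<Union>(vals ` S))"
  obtains U where "U \<subseteq> R" "small \<kappa> U"
    "\<forall>f\<in>Aut_e. \<forall>g\<in>Autf_e. (\<forall>m\<in>\<Union>(vals ` U). f m = g m) \<longrightarrow>
      (\<forall>S \<subseteq> R. small \<kappa> S \<longrightarrow> (\<exists>g'\<in>Autf_e. \<forall>m\<in>\<Union>(vals ` S). f m = g' m))"
proof -
  obtain A\<^sub>e \<Gamma>\<^sub>e where e: "small \<kappa> A\<^sub>e" "\<Gamma>\<^sub>e \<subseteq> lform C A\<^sub>e (Inl ` A\<^sub>e)"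
    "\<And>f. f \<in> Auts C \<Longrightarrow> f \<in> Aut_e \<longleftrightarrow> (\<forall>\<phi>\<in>\<Gamma>\<^sub>e. holds C (images f) \<phi>)"
    using Aut_e_type_definable by blast
  obtain M where M: "A\<^sub>e \<subseteq> M" "small \<kappa> M" "elementary_sub C M"
    using small_elementary_sub[OF e(1)] by blast
  have dcl: "in_dcl C \<alpha> e M"
    using in_dcl_of_definition[OF e(2,3)] M(1) unfolding in_dcl_def by blast
  define L where "L = lform C M (UNIV :: nat set)"
  define mtype where "mtype k = {(\<phi>, t). \<phi> \<in> L \<and> range t \<subseteq> M \<and> holds C (k \<circ> t) \<phi>}" for k :: "'a \<Rightarrow> 'a"
  have mtype_eq: "mtype k = mtype k'" if "mtype k \<subseteq> mtype k'" for k k'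
  proof
    show "mtype k' \<subseteq> mtype k"
    proof clarify
      fix \<phi> t assume "(\<phi>, t) \<in> mtype k'"
      moreover from this have "(Neg \<phi>, t) \<notin> mtype k'" by (simp add: mtype_def)
      with that have "(Neg \<phi>, t) \<notin> mtype k" by blast
      ultimately show "(\<phi>, t) \<in> mtype k" by (auto simp: mtype_def L_def)
    qed
  qed (rule that)
  have conj: "\<exists>h\<in>Lascar_generators. \<forall>m\<in>M. h (k m) = k' m" if "mtype k = mtype k'" for k k'
  proof -
    have "\<exists>h\<in>Auts C. (\<forall>m\<in>M. h m = m) \<and> (\<forall>m\<in>M. h (k m) = k' m)"
    proof (rule same_type_conjugate[OF M(2) M(2)])
      fix \<phi> t assume "\<phi> \<in> lform C M (UNIV :: nat set)" "range t \<subseteq> M" "holds C (k \<circ> t) \<phi>"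
      then have "(\<phi>, t) \<in> mtype k" by (simp add: mtype_def L_def)
      then show "holds C (k' \<circ> t) \<phi>" unfolding that by (simp add: mtype_def)
    qed
    then obtain h where h: "h \<in> Auts C" "\<forall>m\<in>M. h m = m" "\<forall>m\<in>M. h (k m) = k' m" by blast
    then have "h \<in> Aut_e" using dcl unfolding in_dcl_iff by blast
    then show ?thesis using h M dcl unfolding Lascar_generators_def by blast
  qed
  define excl where
    "excl p B \<longleftrightarrow> \<not> (\<exists>k\<in>Aut_e. (\<forall>m\<in>B. k m = m) \<and> mtype k = p)" for p and B :: "'a set"
  have excl_mono: "excl p B \<Longrightarrow> B \<subseteq> B' \<Longrightarrow> excl p B'" for p B B' unfolding excl_def by blast
  have finite_character: "\<exists>B' \<subseteq> B. finite B' \<and> excl (mtype f) B'"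
    if B: "small \<kappa> B" and ex: "excl (mtype f) B" and f: "f \<in> Aut_e" for f B
  proof (rule ccontr)
    assume none: "\<not> ?thesis"
    define \<Gamma> where "\<Gamma> = \<Gamma>\<^sub>e \<union> (\<lambda>(\<phi>, t). subst_fm (\<lambda>n. Var (Inl (t n))) \<phi>) ` mtype f"
    have \<Gamma>_iff: "(\<forall>\<phi>\<in>\<Gamma>. holds C (images k) \<phi>) \<longleftrightarrow> k \<in> Aut_e \<and> mtype k = mtype f"
      if k: "k \<in> Auts C" for k
    proof -
      have "holds C (images k) (subst_fm (\<lambda>n. Var (Inl (t n))) \<phi>) \<longleftrightarrow> (\<phi>, t) \<in> mtype k"
        if "(\<phi>, t) \<in> mtype f" for \<phi> t
        using that by (simp add: holds_images_subst mtype_def comp_def)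
      then have "(\<forall>p\<in>mtype f. holds C (images k) (case p of (\<phi>, t) \<Rightarrow>
          subst_fm (\<lambda>n. Var (Inl (t n))) \<phi>)) \<longleftrightarrow> mtype f \<subseteq> mtype k"
        by auto
      then have "(\<forall>\<phi>\<in>\<Gamma>. holds C (images k) \<phi>) \<longleftrightarrow> k \<in> Aut_e \<and> mtype f \<subseteq> mtype k"
        unfolding \<Gamma>_def e(3)[OF k] ball_Un ball_simps by (simp only:)
      then show ?thesis using mtype_eq by blast
    qed
    have "\<exists>k\<in>Auts C. (\<forall>(x, y)\<in>Id_on B. k x = y) \<and> (\<forall>\<phi>\<in>\<Gamma>. holds C (images k) \<phi>)"
    proof (rule automorphism_compactness)
      show "small \<kappa> M" "small \<kappa> M" by (rule M(2))+
      show "small \<kappa> (Domain (Id_on B))" "small \<kappa> (Range (Id_on B))" using B by auto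
      have "subst_fm (\<lambda>n. Var (Inl (t n))) \<phi> \<in> lform C M (Inl ` M)" if "(\<phi>, t) \<in> mtype f" for \<phi> t
        using that by (intro subst_fm_lform[of \<phi> C M UNIV]) (auto simp: mtype_def L_def)
      moreover have "\<Gamma>\<^sub>e \<subseteq> lform C M (Inl ` M)"
        using e(2) M(1) lform_mono[of _ C A\<^sub>e "Inl ` A\<^sub>e" M "Inl ` M"] by blast
      ultimately show "\<Gamma> \<subseteq> lform C M (Inl ` M)" unfolding \<Gamma>_def by auto
      fix Q' assume Q': "Q' \<subseteq> Id_on B" "finite Q'"
      then have "Domain Q' \<subseteq> B" "finite (Domain Q')" by (auto simp: finite_Domain)
      then have "\<not> excl (mtype f) (Domain Q')" using none by blast
      then obtain k where k: "k \<in> Aut_e" "\<forall>m\<in>Domain Q'. k m = m" "mtype k = mtype f"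
        unfolding excl_def by blast
      then show "\<exists>k\<in>Auts C. (\<forall>(x, y)\<in>Q'. k x = y) \<and> (\<forall>\<phi>\<in>\<Gamma>. holds C (images k) \<phi>)"
        using Q'(1) \<Gamma>_iff Aut_e_Auts[OF k(1)] by (intro bexI[of _ k]) auto
    qed
    then obtain k where k: "k \<in> Auts C" "\<forall>(x, y)\<in>Id_on B. k x = y"
      "\<forall>\<phi>\<in>\<Gamma>. holds C (images k) \<phi>" by blast
    have "k m = m" if "m \<in> B" for m using bspec[OF k(2) Id_onI[OF that]] by simp
    then show False using ex \<Gamma>_iff[OF k(1)] k(3) unfolding excl_def by blast
  qed
  define pick where
    "pick p = (SOME S. finite S \<and> S \<subseteq> R \<and> excl p (\<Union>(vals ` S)))" for p
  define \<P> where "\<P> = {p \<in> mtype ` Aut_e. \<exists>S. finite S \<and> S \<subseteq> R \<and> excl p (\<Union>(vals ` S))}"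
  have pick: "finite (pick p) \<and> pick p \<subseteq> R \<and> excl p (\<Union>(vals ` pick p))" if "p \<in> \<P>" for p
    unfolding pick_def by (rule someI_ex) (use that in \<open>auto simp: \<P>_def\<close>)
  define U where "U = (\<Union>p\<in>\<P>. pick p)"
  have "\<P> \<subseteq> Pow (L \<times> {t. range t \<subseteq> M})" by (auto simp: \<P>_def mtype_def)
  then have "small \<kappa> \<P>"
    by (rule small_subset[rotated])
      (unfold L_def, intro small_Pow small_Times small_lform small_countable_functions M)
  then have smallU: "small \<kappa> U" unfolding U_def by (rule small_UN_finite) (simp add: pick)
  have UR: "U \<subseteq> R" using pick by (auto simp: U_def)
  have universal: "\<not> excl (mtype f) (\<Union>(vals ` S))"
    if f: "f \<in> Aut_e" "\<not> excl (mtype f) (\<Union>(vals ` U))" and S: "S \<subseteq> R" "small \<kappa> S" for f S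
  proof
    assume "excl (mtype f) (\<Union>(vals ` S))"
    then obtain B where B: "B \<subseteq> \<Union>(vals ` S)" "finite B" "excl (mtype f) B"
      using finite_character[OF big[OF S] _ f(1)] by blast
    obtain F where F: "finite F" "F \<subseteq> vals ` S" "B \<subseteq> \<Union>F"
      using finite_subset_Union[OF B(2,1)] by blast
    obtain S' where S': "S' \<subseteq> S" "finite S'" "F = vals ` S'"
      using finite_subset_image[OF F(1,2)] by blast
    have "excl (mtype f) (\<Union>(vals ` S'))" using excl_mono[OF B(3)] F(3) S'(3) by blast
    then have p: "mtype f \<in> \<P>" using S'(1,2) S(1) f(1) unfolding \<P>_def by blast
    have "\<Union>(vals ` pick (mtype f)) \<subseteq> \<Union>(vals ` U)" using p unfolding U_def by blast
    then have "excl (mtype f) (\<Union>(vals ` U))" using pick[OF p] excl_mono by blast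
    then show False using f(2) by blast
  qed
  have "\<exists>g'\<in>Autf_e. \<forall>m\<in>\<Union>(vals ` S). f m = g' m"
    if f: "f \<in> Aut_e" and g: "g \<in> Autf_e" and fg: "\<forall>m\<in>\<Union>(vals ` U). f m = g m"
      and S: "S \<subseteq> R" "small \<kappa> S" for f g S
  proof -
    define k where "k = inv_into UNIV g \<circ> f"
    have gA: "g \<in> Aut_e" by (rule Autf_e_Aut_e[OF g])
    have k: "k \<in> Aut_e" unfolding k_def by (intro comp_Aut_e inv_Aut_e f gA)
    have "\<forall>m\<in>\<Union>(vals ` U). k m = m" using fg by (simp add: k_def Aut_e_inverses[OF gA])
    then have "\<not> excl (mtype k) (\<Union>(vals ` U))" using k unfolding excl_def by blast
    then have "\<not> excl (mtype k) (\<Union>(vals ` S))" by (rule universal[OF k _ S])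
    then obtain k' where k': "k' \<in> Aut_e" "\<forall>m\<in>\<Union>(vals ` S). k' m = m" "mtype k' = mtype k"
      unfolding excl_def by blast
    obtain h where h: "h \<in> Lascar_generators" "\<forall>m\<in>M. h (k' m) = k m"
      using conj[OF k'(3)] by blast
    have hA: "h \<in> Aut_e" by (rule Lascar_generators_Aut_e[OF h(1)])
    \<comment> \<open>\<open>h\<close> and \<open>h'\<close> fix \<open>M\<close> and \<open>k = h k' h'\<close>, so \<open>f = g h (k' h' k'\<inverse>) k'\<close>, where \<open>k'\<close> fixes the given set.\<close>
    define h' where "h' = inv_into UNIV k' \<circ> (inv_into UNIV h \<circ> k)"
    have "h' \<in> Aut_e" unfolding h'_def by (intro comp_Aut_e inv_Aut_e k k'(1) hA)
    moreover have "\<forall>m\<in>M. h' m = m"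
    proof
      fix m assume "m \<in> M"
      then have "k m = h (k' m)" using h(2) by simp
      then show "h' m = m" by (simp add: h'_def Aut_e_inverses[OF hA] Aut_e_inverses[OF k'(1)])
    qed
    ultimately have h': "h' \<in> Lascar_generators"
      using M dcl unfolding Lascar_generators_def by blast
    let ?n = "k' \<circ> h' \<circ> inv_into UNIV k'"
    have n: "?n \<in> Autf_e" by (intro generator_Autf_e Lascar_generators_conj k'(1) h')
    show ?thesis
    proof (rule bexI[of _ "g \<circ> (h \<circ> ?n)"])
      show "g \<circ> (h \<circ> ?n) \<in> Autf_e" by (intro comp_Autf_e g n generator_Autf_e h(1))
      show "\<forall>m\<in>\<Union>(vals ` S). f m = (g \<circ> (h \<circ> ?n)) m"
      proof
        fix m assume "m \<in> \<Union>(vals ` S)"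
        then have "k' m = m" using k'(2) by blast
        then have "inv_into UNIV k' m = m"
          using Aut_e_inverses(2)[OF k'(1), of m] by simp
        then show "f m = (g \<circ> (h \<circ> ?n)) m"
          by (simp add: h'_def k_def Aut_e_inverses[OF hA] Aut_e_inverses[OF k'(1)]
              Aut_e_inverses[OF gA])
      qed
    qed
  qed
  then have "\<forall>f\<in>Aut_e. \<forall>g\<in>Autf_e. (\<forall>m\<in>\<Union>(vals ` U). f m = g m) \<longrightarrow>
      (\<forall>S \<subseteq> R. small \<kappa> S \<longrightarrow> (\<exists>g'\<in>Autf_e. \<forall>m\<in>\<Union>(vals ` S). f m = g' m))"
    by (intro ballI allI impI)
  then show thesis by (rule that[OF UR smallU])
qed

end

section \<open>The relativized groups\<close>

locale relativized_setup = hyperimaginary_setup T C \<kappa> \<alpha> e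
  for T :: "('f, 'r, 'a, nat) fm set"
    and C :: "('f, 'r, 'a) fo_structure"
    and \<kappa> :: "'k rel"
    and \<alpha> :: "'k set"
    and e :: "('k \<Rightarrow> 'a) set" +
  fixes X :: "'k set"
    and \<Sigma> :: "('f, 'r, 'a, 'k) fm set"
  assumes partial_type: "partial_type C \<kappa> X \<Sigma>"
    and invariant: "invariant_over C \<alpha> e X \<Sigma>"
begin

abbreviation R :: "('k \<Rightarrow> 'a) set" where "R \<equiv> realizations C X \<Sigma>"

abbreviation Aut_\<Sigma> :: "(('k \<Rightarrow> 'a) \<Rightarrow> ('k \<Rightarrow> 'a)) monoid" where
  "Aut_\<Sigma> \<equiv> Aut_type C \<alpha> e X \<Sigma>"

abbreviation Autf_\<Sigma> :: "(('k \<Rightarrow> 'a) \<Rightarrow> ('k \<Rightarrow> 'a)) set" where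
  "Autf_\<Sigma> \<equiv> Autf_L_type C \<kappa> \<alpha> e X \<Sigma>"

definition res :: "('a \<Rightarrow> 'a) \<Rightarrow> ('k \<Rightarrow> 'a) \<Rightarrow> ('k \<Rightarrow> 'a)" where
  "res f = restrict (compose X f) R"

lemma small_X: "small \<kappa> X"
  using partial_type by (simp add: partial_type_def)

lemma realization_extensional: "x \<in> R \<Longrightarrow> x \<in> X \<rightarrow>\<^sub>E UNIV"
  by (simp add: realizations_def)

lemma compose_id_realization: "x \<in> R \<Longrightarrow> compose X id x = x"
  by (auto dest!: realization_extensional simp: compose_def fun_eq_iff PiE_def extensional_def)

lemma compose_realization: "f \<in> Aut_e \<Longrightarrow> x \<in> R \<Longrightarrow> compose X f x \<in> R"
  using invariant realization_extensional unfolding invariant_over_def by blast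

lemma compose_eq_realization_iff:
  assumes "y \<in> R"
  shows "compose X f x = y \<longleftrightarrow> (\<forall>j\<in>X. f (x j) = y j)"
  using realization_extensional[OF assms]
  by (auto simp: compose_def fun_eq_iff PiE_def extensional_def)

lemma res_apply: "x \<in> R \<Longrightarrow> res f x = compose X f x"
  by (simp add: res_def)

lemma res_realization: "f \<in> Aut_e \<Longrightarrow> x \<in> R \<Longrightarrow> res f x \<in> R"
  by (simp add: res_apply compose_realization)

lemma res_comp: "f \<in> Aut_e \<Longrightarrow> g \<in> Aut_e \<Longrightarrow> x \<in> R \<Longrightarrow> res f (res g x) = res (f \<circ> g) x"
  by (simp add: res_apply compose_realization compose_comp)

lemma res_inv:
  assumes "f \<in> Aut_e" "x \<in> R"
  shows "res f (res (inv_into UNIV f) x) = x" "res (inv_into UNIV f) (res f x) = x"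
proof -
  have "f \<circ> inv_into UNIV f = id" "inv_into UNIV f \<circ> f = id"
    using Aut_e_inverses[OF assms(1)] by (simp_all add: fun_eq_iff)
  then show "res f (res (inv_into UNIV f) x) = x" "res (inv_into UNIV f) (res f x) = x"
    using assms res_comp[OF assms(1) inv_Aut_e[OF assms(1)] assms(2)]
      res_comp[OF inv_Aut_e[OF assms(1)] assms(1,2)]
    by (simp_all only: res_apply compose_id_realization)
qed

lemma carrier_Aut: "carrier Aut_\<Sigma> = res ` Aut_e"
  by (simp add: Aut_type_def res_def[abs_def])

lemma res_Bij:
  assumes "f \<in> Aut_e"
  shows "res f \<in> Bij R"
proof -
  have "bij_betw (res f) R R"
    by (rule bij_betw_byWitness[where f' = "res (inv_into UNIV f)"])
      (use res_inv[OF assms] res_realization[OF assms] res_realization[OF inv_Aut_e[OF assms]]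
        in auto)
  then show ?thesis by (simp add: Bij_def res_def)
qed

lemma mult_Aut:
  assumes "\<sigma> \<in> carrier Aut_\<Sigma>" "\<tau> \<in> carrier Aut_\<Sigma>"
  shows "\<sigma> \<otimes>\<^bsub>Aut_\<Sigma>\<^esub> \<tau> = compose R \<sigma> \<tau>"
  using assms res_Bij unfolding carrier_Aut by (auto simp: Aut_type_def BijGroup_def)

lemma mult_res:
  assumes "f \<in> Aut_e" "g \<in> Aut_e"
  shows "res f \<otimes>\<^bsub>Aut_\<Sigma>\<^esub> res g = res (f \<circ> g)"
proof -
  have "compose R (res f) (res g) = res (f \<circ> g)"
  proof (rule extensionalityI)
    show "compose R (res f) (res g) \<in> extensional R" by simp
    show "res (f \<circ> g) \<in> extensional R" unfolding res_def by simp
    show "compose R (res f) (res g) x = res (f \<circ> g) x" if "x \<in> R" for x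
      using that res_comp[OF assms that] by (simp only: compose_eq)
  qed
  then show ?thesis using mult_Aut assms by (simp add: carrier_Aut)
qed

lemma one_Aut: "\<one>\<^bsub>Aut_\<Sigma>\<^esub> = res id"
proof -
  have "\<one>\<^bsub>Aut_\<Sigma>\<^esub> = (\<lambda>x\<in>R. x)" by (simp add: Aut_type_def BijGroup_def)
  also have "\<dots> = res id"
    unfolding res_def by (rule restrict_ext) (simp only: compose_id_realization)
  finally show ?thesis .
qed

lemma res_inverse_mult:
  assumes "f \<in> Aut_e"
  shows "res (inv_into UNIV f) \<otimes>\<^bsub>Aut_\<Sigma>\<^esub> res f = \<one>\<^bsub>Aut_\<Sigma>\<^esub>"
proof -
  have "inv_into UNIV f \<circ> f = id" using Aut_e_inverses[OF assms] by (simp add: fun_eq_iff)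
  then show ?thesis by (simp only: mult_res inv_Aut_e assms one_Aut)
qed

lemma group_Aut: "group Aut_\<Sigma>"
proof (rule groupI)
  fix x y z assume "x \<in> carrier Aut_\<Sigma>" "y \<in> carrier Aut_\<Sigma>" "z \<in> carrier Aut_\<Sigma>"
  then obtain f g h where fgh: "f \<in> Aut_e" "g \<in> Aut_e" "h \<in> Aut_e"
    and xyz: "x = res f" "y = res g" "z = res h"
    unfolding carrier_Aut by blast
  show "x \<otimes>\<^bsub>Aut_\<Sigma>\<^esub> y \<in> carrier Aut_\<Sigma>"
    unfolding xyz carrier_Aut using comp_Aut_e fgh by (simp only: mult_res) blast
  show "x \<otimes>\<^bsub>Aut_\<Sigma>\<^esub> y \<otimes>\<^bsub>Aut_\<Sigma>\<^esub> z = x \<otimes>\<^bsub>Aut_\<Sigma>\<^esub> (y \<otimes>\<^bsub>Aut_\<Sigma>\<^esub> z)"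
    unfolding xyz using fgh by (simp only: mult_res comp_Aut_e o_assoc)
  show "\<one>\<^bsub>Aut_\<Sigma>\<^esub> \<otimes>\<^bsub>Aut_\<Sigma>\<^esub> x = x"
    unfolding xyz one_Aut using fgh by (simp only: mult_res id_Aut_e id_o)
  show "\<exists>y\<in>carrier Aut_\<Sigma>. y \<otimes>\<^bsub>Aut_\<Sigma>\<^esub> x = \<one>\<^bsub>Aut_\<Sigma>\<^esub>"
    unfolding xyz carrier_Aut using res_inverse_mult inv_Aut_e fgh(1) by blast
next
  show "\<one>\<^bsub>Aut_\<Sigma>\<^esub> \<in> carrier Aut_\<Sigma>" unfolding one_Aut carrier_Aut by (intro imageI id_Aut_e)
qed

sublocale A: group Aut_\<Sigma>
  by (rule group_Aut)

lemma inv_res: "f \<in> Aut_e \<Longrightarrow> m_inv Aut_\<Sigma> (res f) = res (inv_into UNIV f)"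
  by (rule A.inv_equality) (auto simp: res_inverse_mult carrier_Aut inv_Aut_e)

lemma Aut_realization: "\<sigma> \<in> carrier Aut_\<Sigma> \<Longrightarrow> x \<in> R \<Longrightarrow> \<sigma> x \<in> R"
  unfolding carrier_Aut by (auto simp: res_realization)

lemma mult_apply:
  "\<sigma> \<in> carrier Aut_\<Sigma> \<Longrightarrow> \<tau> \<in> carrier Aut_\<Sigma> \<Longrightarrow> x \<in> R \<Longrightarrow> (\<sigma> \<otimes>\<^bsub>Aut_\<Sigma>\<^esub> \<tau>) x = \<sigma> (\<tau> x)"
  by (simp add: mult_Aut compose_def)

lemma inv_apply:
  assumes "\<sigma> \<in> carrier Aut_\<Sigma>" "x \<in> R"
  shows "m_inv Aut_\<Sigma> \<sigma> (\<sigma> x) = x" "\<sigma> (m_inv Aut_\<Sigma> \<sigma> x) = x"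
  using assms unfolding carrier_Aut by (auto simp: inv_res res_inv)

lemma tuple_of_realization: "tuple_of \<kappa> R I c \<Longrightarrow> i \<in> I \<Longrightarrow> c i \<in> R"
  by (auto simp: tuple_of_def)

lemma tuple_of_comp: "tuple_of \<kappa> R I c \<Longrightarrow> \<sigma> \<in> carrier Aut_\<Sigma> \<Longrightarrow> tuple_of \<kappa> R I (\<sigma> \<circ> c)"
  unfolding tuple_of_def Pi_iff by (simp add: Aut_realization)

lemma small_entries: "tuple_of \<kappa> R I c \<Longrightarrow> small \<kappa> (entries X I c)"
proof -
  assume c: "tuple_of \<kappa> R I c"
  have "entries X I c = case_prod c ` (I \<times> X)" by (auto simp: entries_def)
  then show ?thesis
    using c small_X by (simp add: tuple_of_def small_image small_Times)
qed

abbreviation lascar_eq :: "'k set \<Rightarrow> ('k \<Rightarrow> 'k \<Rightarrow> 'a) \<Rightarrow> ('k \<Rightarrow> 'k \<Rightarrow> 'a) \<Rightarrow> bool" where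
  "lascar_eq I c d \<equiv> equiv_L C \<kappa> \<alpha> e X I c d"

lemma lascar_eq_refl: "tuple_of \<kappa> R I c \<Longrightarrow> (\<And>i. i \<in> I \<Longrightarrow> d i = c i) \<Longrightarrow> lascar_eq I c d"
  unfolding equiv_L_def
  by (intro bexI[of _ id] id_Autf_e) (auto simp: compose_id_realization tuple_of_realization)

lemma Autf_memD:
  "\<sigma> \<in> Autf_\<Sigma> \<Longrightarrow> tuple_of \<kappa> R I c \<Longrightarrow> \<exists>g\<in>Autf_e. \<forall>i\<in>I. compose X g (c i) = \<sigma> (c i)"
  unfolding Autf_L_type_def equiv_L_def by auto

lemma Autf_memI:
  assumes "\<sigma> \<in> carrier Aut_\<Sigma>"
    and "\<And>I c. tuple_of \<kappa> R I c \<Longrightarrow> \<exists>g\<in>Autf_e. \<forall>i\<in>I. compose X g (c i) = \<sigma> (c i)"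
  shows "\<sigma> \<in> Autf_\<Sigma>"
  using assms unfolding Autf_L_type_def equiv_L_def by simp

lemma Autf_carrier: "\<sigma> \<in> Autf_\<Sigma> \<Longrightarrow> \<sigma> \<in> carrier Aut_\<Sigma>"
  by (simp add: Autf_L_type_def)

lemma subgroup_Autf: "subgroup Autf_\<Sigma> Aut_\<Sigma>"
proof (rule A.subgroupI)
  show "Autf_\<Sigma> \<subseteq> carrier Aut_\<Sigma>" by (auto simp: Autf_carrier)
  have "\<one>\<^bsub>Aut_\<Sigma>\<^esub> \<in> Autf_\<Sigma>"
  proof (rule Autf_memI)
    fix I and c :: "'k \<Rightarrow> 'k \<Rightarrow> 'a" assume "tuple_of \<kappa> R I c"
    then show "\<exists>g\<in>Autf_e. \<forall>i\<in>I. compose X g (c i) = \<one>\<^bsub>Aut_\<Sigma>\<^esub> (c i)"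
      by (intro bexI[of _ id] id_Autf_e) (simp add: one_Aut res_apply tuple_of_realization)
  qed simp
  then show "Autf_\<Sigma> \<noteq> {}" by blast
next
  fix \<sigma> assume \<sigma>: "\<sigma> \<in> Autf_\<Sigma>"
  note \<sigma>A = Autf_carrier[OF \<sigma>]
  show "m_inv Aut_\<Sigma> \<sigma> \<in> Autf_\<Sigma>"
  proof (rule Autf_memI)
    fix I and c :: "'k \<Rightarrow> 'k \<Rightarrow> 'a" assume c: "tuple_of \<kappa> R I c"
    obtain g where g: "g \<in> Autf_e"
      "\<And>i. i \<in> I \<Longrightarrow> compose X g (m_inv Aut_\<Sigma> \<sigma> (c i)) = \<sigma> (m_inv Aut_\<Sigma> \<sigma> (c i))"
      using Autf_memD[OF \<sigma> tuple_of_comp[OF c A.inv_closed[OF \<sigma>A]]] by auto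
    have gA: "g \<in> Aut_e" by (rule Autf_e_Aut_e[OF g(1)])
    have "compose X (inv_into UNIV g) (c i) = m_inv Aut_\<Sigma> \<sigma> (c i)" if "i \<in> I" for i
    proof -
      have ci: "c i \<in> R" by (rule tuple_of_realization[OF c that])
      have mi: "m_inv Aut_\<Sigma> \<sigma> (c i) \<in> R" by (rule Aut_realization[OF A.inv_closed[OF \<sigma>A] ci])
      have "compose X g (m_inv Aut_\<Sigma> \<sigma> (c i)) = c i"
        using g(2)[OF that] inv_apply(2)[OF \<sigma>A ci] by simp
      then have "compose X (inv_into UNIV g) (c i) =
          res (inv_into UNIV g) (res g (m_inv Aut_\<Sigma> \<sigma> (c i)))"
        using mi ci by (simp add: res_apply)
      then show ?thesis using res_inv(2)[OF gA mi] by simp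
    qed
    then show "\<exists>g\<in>Autf_e. \<forall>i\<in>I. compose X g (c i) = m_inv Aut_\<Sigma> \<sigma> (c i)"
      using inv_Autf_e[OF g(1)] by blast
  qed (rule A.inv_closed[OF \<sigma>A])
next
  fix \<sigma> \<tau> assume \<sigma>: "\<sigma> \<in> Autf_\<Sigma>" and \<tau>: "\<tau> \<in> Autf_\<Sigma>"
  note \<sigma>A = Autf_carrier[OF \<sigma>] and \<tau>A = Autf_carrier[OF \<tau>]
  show "\<sigma> \<otimes>\<^bsub>Aut_\<Sigma>\<^esub> \<tau> \<in> Autf_\<Sigma>"
  proof (rule Autf_memI)
    fix I and c :: "'k \<Rightarrow> 'k \<Rightarrow> 'a" assume c: "tuple_of \<kappa> R I c"
    obtain g where g: "g \<in> Autf_e" "\<And>i. i \<in> I \<Longrightarrow> compose X g (c i) = \<tau> (c i)"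
      using Autf_memD[OF \<tau> c] by blast
    obtain h where h: "h \<in> Autf_e" "\<And>i. i \<in> I \<Longrightarrow> compose X h (\<tau> (c i)) = \<sigma> (\<tau> (c i))"
      using Autf_memD[OF \<sigma> tuple_of_comp[OF c \<tau>A]] by auto
    have "compose X (h \<circ> g) (c i) = (\<sigma> \<otimes>\<^bsub>Aut_\<Sigma>\<^esub> \<tau>) (c i)" if "i \<in> I" for i
      using g(2)[OF that] h(2)[OF that] tuple_of_realization[OF c that]
      by (simp only: compose_comp mult_apply[OF \<sigma>A \<tau>A])
    then show "\<exists>g\<in>Autf_e. \<forall>i\<in>I. compose X g (c i) = (\<sigma> \<otimes>\<^bsub>Aut_\<Sigma>\<^esub> \<tau>) (c i)"
      using comp_Autf_e[OF h(1) g(1)] by blast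
  qed (rule A.m_closed[OF \<sigma>A \<tau>A])
qed

lemma conj_Autf:
  assumes \<sigma>: "\<sigma> \<in> carrier Aut_\<Sigma>" and n: "n \<in> Autf_\<Sigma>"
  shows "\<sigma> \<otimes>\<^bsub>Aut_\<Sigma>\<^esub> n \<otimes>\<^bsub>Aut_\<Sigma>\<^esub> m_inv Aut_\<Sigma> \<sigma> \<in> Autf_\<Sigma>"
proof (rule Autf_memI)
  note nA = Autf_carrier[OF n]
  show "\<sigma> \<otimes>\<^bsub>Aut_\<Sigma>\<^esub> n \<otimes>\<^bsub>Aut_\<Sigma>\<^esub> m_inv Aut_\<Sigma> \<sigma> \<in> carrier Aut_\<Sigma>" using \<sigma> nA by simp
  obtain f where f: "f \<in> Aut_e" "\<sigma> = res f" using \<sigma> unfolding carrier_Aut by blast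
  fix I and c :: "'k \<Rightarrow> 'k \<Rightarrow> 'a" assume c: "tuple_of \<kappa> R I c"
  obtain g where g: "g \<in> Autf_e"
    "\<And>i. i \<in> I \<Longrightarrow> compose X g (m_inv Aut_\<Sigma> \<sigma> (c i)) = n (m_inv Aut_\<Sigma> \<sigma> (c i))"
    using Autf_memD[OF n tuple_of_comp[OF c A.inv_closed[OF \<sigma>]]] by auto
  have "compose X (f \<circ> g \<circ> inv_into UNIV f) (c i) =
      (\<sigma> \<otimes>\<^bsub>Aut_\<Sigma>\<^esub> n \<otimes>\<^bsub>Aut_\<Sigma>\<^esub> m_inv Aut_\<Sigma> \<sigma>) (c i)" if "i \<in> I" for i
  proof -
    have ci: "c i \<in> R" by (rule tuple_of_realization[OF c that])
    let ?x = "m_inv Aut_\<Sigma> \<sigma> (c i)"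
    have x: "?x \<in> R" by (rule Aut_realization[OF A.inv_closed[OF \<sigma>] ci])
    have "?x = compose X (inv_into UNIV f) (c i)" using ci f by (simp add: inv_res res_apply)
    then have "compose X (f \<circ> g \<circ> inv_into UNIV f) (c i) = compose X f (compose X g ?x)"
      by (simp only: compose_comp)
    also have "\<dots> = \<sigma> (n ?x)"
      using g(2)[OF that] Aut_realization[OF nA x] f(2) by (simp add: res_apply)
    also have "\<dots> = (\<sigma> \<otimes>\<^bsub>Aut_\<Sigma>\<^esub> n \<otimes>\<^bsub>Aut_\<Sigma>\<^esub> m_inv Aut_\<Sigma> \<sigma>) (c i)"
      using \<sigma> nA ci x by (simp add: mult_apply)
    finally show ?thesis .
  qed
  then show "\<exists>g\<in>Autf_e. \<forall>i\<in>I. compose X g (c i) =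
      (\<sigma> \<otimes>\<^bsub>Aut_\<Sigma>\<^esub> n \<otimes>\<^bsub>Aut_\<Sigma>\<^esub> m_inv Aut_\<Sigma> \<sigma>) (c i)"
    using conj_Autf_e[OF f(1) g(1)] by blast
qed

abbreviation \<pi> :: "(('k \<Rightarrow> 'a) \<Rightarrow> ('k \<Rightarrow> 'a)) \<Rightarrow> (('k \<Rightarrow> 'a) \<Rightarrow> ('k \<Rightarrow> 'a)) set" where
  "\<pi> \<equiv> Gal_proj C \<kappa> \<alpha> e X \<Sigma>"

lemma Gal_proj_mult:
  assumes "n \<in> Autf_\<Sigma>" "\<sigma> \<in> carrier Aut_\<Sigma>"
  shows "\<pi> (n \<otimes>\<^bsub>Aut_\<Sigma>\<^esub> \<sigma>) = \<pi> \<sigma>"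
proof -
  have "Autf_\<Sigma> #>\<^bsub>Aut_\<Sigma>\<^esub> n = Autf_\<Sigma>"
    by (rule A.coset_join2[OF Autf_carrier[OF assms(1)] subgroup_Autf assms(1)])
  then show ?thesis
    using A.coset_mult_assoc[of Autf_\<Sigma> n \<sigma>] subgroup.subset[OF subgroup_Autf] assms
    by (simp add: Gal_proj_def Autf_carrier)
qed

text \<open>\<open>H\<close> is a union of cosets of \<open>Autf\<^sub>L(\<Sigma>)\<close>, as it contains \<open>Autf\<^sub>L(\<Sigma>)\<close>.\<close>

lemma Gal_proj_mem_iff:
  assumes H: "subgroup H Aut_\<Sigma>" "Autf_\<Sigma> \<subseteq> H" and \<sigma>: "\<sigma> \<in> carrier Aut_\<Sigma>"
  shows "\<pi> \<sigma> \<in> \<pi> ` H \<longleftrightarrow> \<sigma> \<in> H"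
proof
  assume "\<pi> \<sigma> \<in> \<pi> ` H"
  then obtain h where h: "h \<in> H" "\<pi> \<sigma> = \<pi> h" by blast
  have "\<sigma> \<in> \<pi> \<sigma>"
    unfolding Gal_proj_def by (rule A.rcos_self[OF \<sigma> subgroup_Autf])
  then have "\<sigma> \<in> \<pi> h" by (simp only: h(2))
  then obtain n where n: "n \<in> Autf_\<Sigma>" "\<sigma> = n \<otimes>\<^bsub>Aut_\<Sigma>\<^esub> h"
    unfolding Gal_proj_def r_coset_def by auto
  have "n \<in> H" using H(2) n(1) by blast
  then show "\<sigma> \<in> H" unfolding n(2) by (rule subgroup.m_closed[OF H(1) _ h(1)])
qed simp

end

section \<open>Lascar tuples\<close>

context relativized_setup
begin

text \<open>Let \<open>b\<close> enumerate the small set \<open>U\<close> of the lemma \<open>small_universal_support\<close>. If \<open>\<sigma>(b)\<close> is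
  Lascar equivalent to \<open>b\<close>, then \<open>\<sigma>\<close> agrees with a Lascar strong automorphism on \<open>U\<close>, hence with one on
  each small set of realizations.\<close>

lemma Lascar_tuple_exists: "\<exists>I b. Lascar_tuple C \<kappa> \<alpha> e X \<Sigma> I b"
proof -
  have big: "small \<kappa> (\<Union>((\<lambda>x. x ` X) ` S))" if "S \<subseteq> R" and S: "small \<kappa> S" for S :: "('k \<Rightarrow> 'a) set"
  proof -
    have "\<Union>((\<lambda>x. x ` X) ` S) = (\<lambda>(x, j). x j) ` (S \<times> X)" by auto
    then show ?thesis using S small_X by (simp only: small_image small_Times)
  qed
  obtain U where U: "U \<subseteq> R" "small \<kappa> U"
    and univ: "\<forall>f\<in>Aut_e. \<forall>g\<in>Autf_e. (\<forall>m\<in>\<Union>((\<lambda>x. x ` X) ` U). f m = g m) \<longrightarrow>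
      (\<forall>S \<subseteq> R. small \<kappa> S \<longrightarrow> (\<exists>g'\<in>Autf_e. \<forall>m\<in>\<Union>((\<lambda>x. x ` X) ` S). f m = g' m))"
    using small_universal_support[of R "\<lambda>x. x ` X", OF big] .
  obtain I :: "'k set" and b where I: "small \<kappa> I" "bij_betw b I U"
    using small_indexed[OF U(2)] .
  have bU: "b ` I = U" using I(2) by (rule bij_betw_imp_surj_on)
  have tup: "tuple_of \<kappa> R I b" using I(1) bU U(1) by (auto simp: tuple_of_def)
  have "\<sigma> \<in> Autf_\<Sigma>" if \<sigma>: "\<sigma> \<in> carrier Aut_\<Sigma>" and L: "lascar_eq I b (\<sigma> \<circ> b)" for \<sigma>
  proof (rule Autf_memI[OF \<sigma>])
    fix J and c :: "'k \<Rightarrow> 'k \<Rightarrow> 'a" assume c: "tuple_of \<kappa> R J c"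
    obtain f where f: "f \<in> Aut_e" "\<sigma> = res f" using \<sigma> unfolding carrier_Aut by blast
    obtain g where g: "g \<in> Autf_e" "\<And>i. i \<in> I \<Longrightarrow> compose X g (b i) = \<sigma> (b i)"
      using L unfolding equiv_L_def by auto
    have "f (b i j) = g (b i j)" if "i \<in> I" "j \<in> X" for i j
    proof -
      have "compose X g (b i) j = compose X f (b i) j"
        using g(2)[OF that(1)] tuple_of_realization[OF tup that(1)] f(2) by (simp add: res_apply)
      then show ?thesis using that(2) by (simp add: compose_def)
    qed
    then have fg: "\<forall>m\<in>\<Union>((\<lambda>x. x ` X) ` U). f m = g m" unfolding bU[symmetric] by blast
    have cJ: "c ` J \<subseteq> R" "small \<kappa> (c ` J)" using c by (auto simp: tuple_of_def small_image)
    obtain g' where g': "g' \<in> Autf_e" "\<forall>m\<in>\<Union>((\<lambda>x. x ` X) ` c ` J). f m = g' m"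
      using mp[OF spec[OF mp[OF bspec[OF bspec[OF univ f(1)] g(1)] fg], of "c ` J"]] cJ by meson
    have "compose X g' (c i) = \<sigma> (c i)" if "i \<in> J" for i
      using g'(2) that f(2) tuple_of_realization[OF c that]
      by (auto simp: res_apply compose_def fun_eq_iff)
    then show "\<exists>g\<in>Autf_e. \<forall>i\<in>J. compose X g (c i) = \<sigma> (c i)" using g'(1) by blast
  qed
  moreover have "lascar_eq I b (\<sigma> \<circ> b)" if "\<sigma> \<in> Autf_\<Sigma>" for \<sigma>
    using that tup by (simp add: Autf_L_type_def)
  ultimately have "Autf_\<Sigma> = {\<sigma> \<in> carrier Aut_\<Sigma>. lascar_eq I b (\<sigma> \<circ> b)}"
    using Autf_carrier by blast
  then show ?thesis using tup unfolding Lascar_tuple_def by blast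
qed

lemma Lascar_tuple_fixed:
  assumes b: "Lascar_tuple C \<kappa> \<alpha> e X \<Sigma> I b" and \<sigma>: "\<sigma> \<in> carrier Aut_\<Sigma>"
    and fix_b: "\<And>i. i \<in> I \<Longrightarrow> \<sigma> (b i) = b i"
  shows "\<sigma> \<in> Autf_\<Sigma>"
proof -
  have "lascar_eq I b (\<sigma> \<circ> b)"
    using b fix_b by (intro lascar_eq_refl) (auto simp: Lascar_tuple_def)
  then show ?thesis using b \<sigma> unfolding Lascar_tuple_def by blast
qed

text \<open>If \<open>h \<in> H\<close> brings the image of a Lascar tuple under \<open>\<sigma>\<close> back, then \<open>h \<sigma>\<close> fixes that tuple,
  hence lies in \<open>Autf\<^sub>L(\<Sigma>) \<subseteq> H\<close>.\<close>

lemma mem_subgroup_iff_fixes_classes: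
  assumes H: "subgroup H Aut_\<Sigma>" "Autf_\<Sigma> \<subseteq> H" and \<sigma>: "\<sigma> \<in> carrier Aut_\<Sigma>"
  shows "\<sigma> \<in> H \<longleftrightarrow> (\<forall>I c. tuple_of \<kappa> R I c \<longrightarrow> equiv_by H I (\<sigma> \<circ> c) c)"
proof
  assume "\<sigma> \<in> H"
  then have "m_inv Aut_\<Sigma> \<sigma> \<in> H" by (rule subgroup.m_inv_closed[OF H(1)])
  then show "\<forall>I c. tuple_of \<kappa> R I c \<longrightarrow> equiv_by H I (\<sigma> \<circ> c) c"
    unfolding equiv_by_def using inv_apply(1)[OF \<sigma>] tuple_of_realization
    by (metis comp_apply)
next
  assume all: "\<forall>I c. tuple_of \<kappa> R I c \<longrightarrow> equiv_by H I (\<sigma> \<circ> c) c"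
  obtain I b where b: "Lascar_tuple C \<kappa> \<alpha> e X \<Sigma> I b" using Lascar_tuple_exists by blast
  then have tup: "tuple_of \<kappa> R I b" by (simp add: Lascar_tuple_def)
  then have "equiv_by H I (\<sigma> \<circ> b) b" using all by blast
  then obtain h where h: "h \<in> H" "\<And>i. i \<in> I \<Longrightarrow> h (\<sigma> (b i)) = b i"
    unfolding equiv_by_def by auto
  have hA: "h \<in> carrier Aut_\<Sigma>" using subgroup.mem_carrier[OF H(1) h(1)] .
  have "h \<otimes>\<^bsub>Aut_\<Sigma>\<^esub> \<sigma> \<in> Autf_\<Sigma>"
    by (rule Lascar_tuple_fixed[OF b])
      (use hA \<sigma> h(2) tuple_of_realization[OF tup] in \<open>simp_all add: mult_apply\<close>)
  then have "h \<otimes>\<^bsub>Aut_\<Sigma>\<^esub> \<sigma> \<in> H" using H(2) by blast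
  then have "m_inv Aut_\<Sigma> h \<otimes>\<^bsub>Aut_\<Sigma>\<^esub> (h \<otimes>\<^bsub>Aut_\<Sigma>\<^esub> \<sigma>) \<in> H"
    by (rule subgroup.m_closed[OF H(1) subgroup.m_inv_closed[OF H(1) h(1)]])
  then show "\<sigma> \<in> H" using hA \<sigma> by (simp add: A.m_assoc[symmetric])
qed

end


section \<open>Closed subgroups\<close>

lemma topspace_logic_topology:
  assumes "\<And>p. p \<in> P \<Longrightarrow> verum \<in> p"
  shows "topspace (logic_topology C A V P) = P"
  using assms verum(2)[of C A V] unfolding logic_topology_def topology_generated_by_topspace
  by blast

text \<open>The basic open sets are closed under finite intersections, by conjunction, and under
  complements, by negation. So a point outside \<open>Z\<close> is separated from \<open>Z\<close> by a single formula that
  belongs to all members of \<open>Z\<close>.\<close>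

lemma closedin_logic_topology:
  assumes types: "\<And>p. p \<in> P \<Longrightarrow> \<exists>s. p = tp C A V s"
    and Z: "closedin (logic_topology C A V P) Z"
  shows "\<exists>\<Phi> \<subseteq> lform C A V. Z = {p \<in> P. \<Phi> \<subseteq> p}"
proof -
  let ?B = "(\<lambda>\<phi>. {p \<in> P. \<phi> \<in> p}) ` lform C A V"
  have "verum \<in> p" if "p \<in> P" for p using types[OF that] by (auto simp: tp_def)
  then have top: "topspace (logic_topology C A V P) = P" by (rule topspace_logic_topology)
  have open_compl: "generate_topology_on ?B (P - Z)"
    using Z unfolding closedin_def top unfolding logic_topology_def
    by (simp add: openin_topology_generated_by_iff)
  have base: "p \<in> P \<and> (\<exists>\<phi>\<in>lform C A V. \<phi> \<in> p \<and> {q \<in> P. \<phi> \<in> q} \<subseteq> W)"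
    if "generate_topology_on ?B W" "p \<in> W" for W p
    using that
  proof (induction arbitrary: p)
    case (Int W W')
    have "p \<in> P \<and> (\<exists>\<phi>\<in>lform C A V. \<phi> \<in> p \<and> {q \<in> P. \<phi> \<in> q} \<subseteq> W)"
      by (rule Int.IH(1)) (use Int.prems in blast)
    moreover have "p \<in> P \<and> (\<exists>\<phi>\<in>lform C A V. \<phi> \<in> p \<and> {q \<in> P. \<phi> \<in> q} \<subseteq> W')"
      by (rule Int.IH(2)) (use Int.prems in blast)
    ultimately obtain \<phi> \<psi> where p: "p \<in> P"
      and \<phi>: "\<phi> \<in> lform C A V" "\<phi> \<in> p" "{q \<in> P. \<phi> \<in> q} \<subseteq> W"
      and \<psi>: "\<psi> \<in> lform C A V" "\<psi> \<in> p" "{q \<in> P. \<psi> \<in> q} \<subseteq> W'" by blast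
    have Conj: "Conj \<phi> \<psi> \<in> q \<longleftrightarrow> \<phi> \<in> q \<and> \<psi> \<in> q" if "q \<in> P" for q
      using types[OF that] \<phi>(1) \<psi>(1) by (auto simp: tp_def lform_def)
    have "Conj \<phi> \<psi> \<in> lform C A V" using \<phi>(1) \<psi>(1) by (simp add: lform_def)
    moreover have "Conj \<phi> \<psi> \<in> p" using Conj[OF p] \<phi>(2) \<psi>(2) by blast
    moreover have "{q \<in> P. Conj \<phi> \<psi> \<in> q} \<subseteq> W \<inter> W'" using Conj \<phi>(3) \<psi>(3) by blast
    ultimately show ?case using p by blast
  next
    case (UN K)
    then obtain W where W: "W \<in> K" "p \<in> W" by blast
    have "p \<in> P \<and> (\<exists>\<phi>\<in>lform C A V. \<phi> \<in> p \<and> {q \<in> P. \<phi> \<in> q} \<subseteq> W)" by (rule UN.IH[OF W])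
    then show ?case using W(1) by blast
  qed auto
  define \<Phi> where "\<Phi> = {\<phi> \<in> lform C A V. \<forall>p\<in>Z. \<phi> \<in> p}"
  have "Z \<subseteq> P" using closedin_subset[OF Z] top by simp
  moreover have "p \<in> Z" if p: "p \<in> P" "\<Phi> \<subseteq> p" for p
  proof (rule ccontr)
    assume "p \<notin> Z"
    then obtain \<phi> where \<phi>: "\<phi> \<in> lform C A V" "\<phi> \<in> p" "{q \<in> P. \<phi> \<in> q} \<subseteq> P - Z"
      using base[OF open_compl] p(1) by blast
    have Neg: "Neg \<phi> \<in> q \<longleftrightarrow> \<phi> \<notin> q" if "q \<in> P" for q
      using types[OF that] \<phi>(1) by (auto simp: tp_def)
    have "Neg \<phi> \<in> \<Phi>" using Neg \<phi>(1,3) \<open>Z \<subseteq> P\<close> unfolding \<Phi>_def by auto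
    then show False using Neg[OF p(1)] p(2) \<phi>(2) by blast
  qed
  ultimately have "Z = {p \<in> P. \<Phi> \<subseteq> p}" unfolding \<Phi>_def by blast
  moreover have "\<Phi> \<subseteq> lform C A V" unfolding \<Phi>_def by blast
  ultimately show ?thesis by blast
qed

context relativized_setup
begin

abbreviation type_of :: "'k set \<Rightarrow> ('k \<Rightarrow> 'k \<Rightarrow> 'a) \<Rightarrow> (('k \<Rightarrow> 'a) \<Rightarrow> ('k \<Rightarrow> 'a)) \<Rightarrow>
    ('f, 'r, 'a, 'k \<times> 'k) fm set" where
  "type_of I b \<sigma> \<equiv> tp_over C X I (\<sigma> \<circ> b) b"

lemma mem_type_of:
  "\<phi> \<in> type_of I b \<sigma> \<longleftrightarrow>
    \<phi> \<in> lform C (entries X I b) (I \<times> X) \<and> holds C (\<lambda>(i, j). \<sigma> (b i) j) \<phi>"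
  by (simp add: tp_over_def tp_def case_prod_unfold comp_def)

lemma infinite_pair_variables: "infinite (UNIV :: ('k \<times> 'k) set)"
  using infinite_Field finite_subset[OF subset_UNIV] by (auto simp: finite_prod)

text \<open>An automorphism over \<open>b\<close> taking \<open>\<sigma>(b)\<close> to \<open>\<tau>(b)\<close> fixes \<open>e\<close>, and its restriction to \<open>\<Sigma>\<close> lies in
  \<open>Autf\<^sub>L(\<Sigma>)\<close> because \<open>b\<close> is a Lascar tuple.\<close>

lemma Gal_proj_eq_of_type_eq:
  assumes b: "Lascar_tuple C \<kappa> \<alpha> e X \<Sigma> I b" and dcl: "in_dcl C \<alpha> e (entries X I b)"
    and \<sigma>: "\<sigma> \<in> carrier Aut_\<Sigma>" and \<tau>: "\<tau> \<in> carrier Aut_\<Sigma>"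
    and eq: "type_of I b \<sigma> = type_of I b \<tau>"
  shows "\<pi> \<sigma> = \<pi> \<tau>"
proof -
  have tup: "tuple_of \<kappa> R I b" using b by (simp add: Lascar_tuple_def)
  note bR = tuple_of_realization[OF tup]
  have "small \<kappa> (I \<times> X)" using tup small_X by (simp add: tuple_of_def small_Times)
  then have "\<exists>g\<in>Auts C. (\<forall>m\<in>entries X I b. g m = m) \<and>
      (\<forall>v\<in>I \<times> X. g ((\<lambda>(i, j). \<sigma> (b i) j) v) = (\<lambda>(i, j). \<tau> (b i) j) v)"
  proof (rule same_type_conjugate[OF small_entries[OF tup]])
    fix \<phi> and t :: "nat \<Rightarrow> 'k \<times> 'k"
    assume \<phi>: "\<phi> \<in> lform C (entries X I b) (UNIV :: nat set)" and t: "range t \<subseteq> I \<times> X"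
      and holds: "holds C ((\<lambda>(i, j). \<sigma> (b i) j) \<circ> t) \<phi>"
    let ?\<psi> = "subst_fm (\<lambda>n. Var (t n)) \<phi>"
    have "?\<psi> \<in> lform C (entries X I b) (I \<times> X)"
      by (rule subst_fm_lform[OF \<phi>]) (use t in auto)
    moreover have iff: "holds C s ?\<psi> \<longleftrightarrow> holds C (s \<circ> t) \<phi>" for s
      by (simp add: holds_subst[OF infinite_pair_variables] comp_def)
    ultimately have "?\<psi> \<in> type_of I b \<sigma>" unfolding mem_type_of using holds by blast
    then have "?\<psi> \<in> type_of I b \<tau>" unfolding eq .
    then show "holds C ((\<lambda>(i, j). \<tau> (b i) j) \<circ> t) \<phi>" unfolding mem_type_of iff by blast
  qed
  then obtain g where g: "g \<in> Auts C" "\<forall>m\<in>entries X I b. g m = m"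
    and g\<sigma>: "\<And>i j. i \<in> I \<Longrightarrow> j \<in> X \<Longrightarrow> g (\<sigma> (b i) j) = \<tau> (b i) j" by auto
  have gA: "g \<in> Aut_e" using g dcl unfolding in_dcl_iff by blast
  let ?\<rho> = "res g"
  have \<rho>A: "?\<rho> \<in> carrier Aut_\<Sigma>" using gA by (simp add: carrier_Aut)
  have "?\<rho> (b i) = b i" if "i \<in> I" for i
    using g(2) that bR[OF that]
    by (auto simp: res_apply compose_eq_realization_iff entries_def)
  then have \<rho>: "?\<rho> \<in> Autf_\<Sigma>" by (rule Lascar_tuple_fixed[OF b \<rho>A])
  \<comment> \<open>Since \<open>\<rho>\<close> takes \<open>\<sigma>(b)\<close> to \<open>\<tau>(b)\<close>, the product \<open>n = \<sigma>\<inverse> \<rho>\<inverse> \<tau>\<close> fixes \<open>b\<close>; and \<open>\<tau> \<sigma>\<inverse> = \<rho> (\<sigma> n \<sigma>\<inverse>)\<close>.\<close>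
  let ?n = "m_inv Aut_\<Sigma> \<sigma> \<otimes>\<^bsub>Aut_\<Sigma>\<^esub> (m_inv Aut_\<Sigma> ?\<rho> \<otimes>\<^bsub>Aut_\<Sigma>\<^esub> \<tau>)"
  have "?n \<in> Autf_\<Sigma>"
  proof (rule Lascar_tuple_fixed[OF b])
    fix i assume i: "i \<in> I"
    have "?\<rho> (\<sigma> (b i)) = \<tau> (b i)"
      using g\<sigma>[OF i] Aut_realization[OF \<sigma> bR[OF i]] Aut_realization[OF \<tau> bR[OF i]]
      by (simp add: res_apply compose_eq_realization_iff)
    then have "m_inv Aut_\<Sigma> ?\<rho> (\<tau> (b i)) = \<sigma> (b i)"
      using inv_apply(1)[OF \<rho>A Aut_realization[OF \<sigma> bR[OF i]]] by simp
    then show "?n (b i) = b i"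
      using \<rho>A \<sigma> \<tau> bR[OF i] by (simp add: mult_apply Aut_realization inv_apply)
  qed (use \<rho>A \<sigma> \<tau> in simp)
  then have "?\<rho> \<otimes>\<^bsub>Aut_\<Sigma>\<^esub> (\<sigma> \<otimes>\<^bsub>Aut_\<Sigma>\<^esub> ?n \<otimes>\<^bsub>Aut_\<Sigma>\<^esub> m_inv Aut_\<Sigma> \<sigma>) \<in> Autf_\<Sigma>"
    by (rule subgroup.m_closed[OF subgroup_Autf \<rho> conj_Autf[OF \<sigma>]])
  moreover have "?\<rho> \<otimes>\<^bsub>Aut_\<Sigma>\<^esub> (\<sigma> \<otimes>\<^bsub>Aut_\<Sigma>\<^esub> ?n \<otimes>\<^bsub>Aut_\<Sigma>\<^esub> m_inv Aut_\<Sigma> \<sigma>) = \<tau> \<otimes>\<^bsub>Aut_\<Sigma>\<^esub> m_inv Aut_\<Sigma> \<sigma>"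
    using \<rho>A \<sigma> \<tau> by (simp add: A.m_assoc[symmetric])
  ultimately have "\<tau> \<otimes>\<^bsub>Aut_\<Sigma>\<^esub> m_inv Aut_\<Sigma> \<sigma> \<in> Autf_\<Sigma>" by simp
  then have "\<pi> (\<tau> \<otimes>\<^bsub>Aut_\<Sigma>\<^esub> m_inv Aut_\<Sigma> \<sigma> \<otimes>\<^bsub>Aut_\<Sigma>\<^esub> \<sigma>) = \<pi> \<sigma>" by (rule Gal_proj_mult[OF _ \<sigma>])
  then show ?thesis using \<sigma> \<tau> by (simp add: A.m_assoc)
qed

lemma Gal_of_type_eq:
  assumes "Lascar_tuple C \<kappa> \<alpha> e X \<Sigma> I b" "in_dcl C \<alpha> e (entries X I b)" "\<sigma> \<in> carrier Aut_\<Sigma>"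
  shows "Gal_of_type C \<kappa> \<alpha> e X \<Sigma> I b (type_of I b \<sigma>) = \<pi> \<sigma>"
  unfolding Gal_of_type_def
proof (rule the_equality)
  show "\<exists>\<tau>\<in>carrier Aut_\<Sigma>. type_of I b \<sigma> = type_of I b \<tau> \<and> \<pi> \<sigma> = \<pi> \<tau>" using assms(3) by blast
  show "g = \<pi> \<sigma>" if "\<exists>\<tau>\<in>carrier Aut_\<Sigma>. type_of I b \<sigma> = type_of I b \<tau> \<and> g = \<pi> \<tau>" for g
    using that Gal_proj_eq_of_type_eq[OF assms(1,2)] assms(3) by blast
qed

text \<open>By definition of the quotient topology, the set of types of those \<open>\<sigma>(b)\<close> with \<open>\<pi> \<sigma> \<in> \<pi>[H]\<close> is
  closed, so it is given by a set of formulas; and \<open>\<pi> \<sigma> \<in> \<pi>[H]\<close> means \<open>\<sigma> \<in> H\<close>.\<close>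

lemma closed_subgroup_type_definable:
  assumes b: "Lascar_tuple C \<kappa> \<alpha> e X \<Sigma> I b" and dcl: "in_dcl C \<alpha> e (entries X I b)"
    and H: "subgroup H Aut_\<Sigma>" "Autf_\<Sigma> \<subseteq> H"
    and closed: "closedin (Gal_topology C \<kappa> \<alpha> e X \<Sigma> I b) (\<pi> ` H)"
  shows "\<exists>\<Phi> \<subseteq> lform C (entries X I b) (I \<times> X).
    \<forall>\<sigma>\<in>carrier Aut_\<Sigma>. \<sigma> \<in> H \<longleftrightarrow> (\<forall>\<phi>\<in>\<Phi>. holds C (\<lambda>(i, j). \<sigma> (b i) j) \<phi>)"
proof -
  let ?A = "entries X I b" and ?V = "I \<times> X" and ?P = "type_space C \<alpha> e X \<Sigma> I b"
  let ?L = "logic_topology C ?A ?V ?P" and ?\<nu> = "Gal_of_type C \<kappa> \<alpha> e X \<Sigma> I b"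
  note \<nu> = Gal_of_type_eq[OF b dcl]
  have types: "\<exists>s. p = tp C ?A ?V s" if "p \<in> ?P" for p
    using that unfolding type_space_def tp_over_def by blast
  have "verum \<in> p" if "p \<in> ?P" for p using types[OF that] by (auto simp: tp_def)
  then have top: "topspace ?L = ?P" by (rule topspace_logic_topology)
  have "?\<nu> ` topspace ?L = \<pi> ` carrier Aut_\<Sigma>"
    unfolding top unfolding type_space_def image_image by (rule image_cong) (simp_all add: \<nu>)
  also have "\<dots> = carrier (Gal_L C \<kappa> \<alpha> e X \<Sigma>)"
    by (auto simp: Gal_L_def FactGroup_def RCOSETS_def Gal_proj_def)
  finally have "quotient_map ?L (Gal_topology C \<kappa> \<alpha> e X \<Sigma> I b) ?\<nu>"
    unfolding Gal_topology_def by (rule quotient_map_quotient_topology)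
  then have "closedin ?L {p \<in> topspace ?L. ?\<nu> p \<in> \<pi> ` H}"
    by (intro closedin_continuous_map_preimage[OF _ closed] quotient_imp_continuous_map)
  then have "\<exists>\<Phi> \<subseteq> lform C ?A ?V. {p \<in> ?P. ?\<nu> p \<in> \<pi> ` H} = {p \<in> ?P. \<Phi> \<subseteq> p}"
    unfolding top by (rule closedin_logic_topology[rotated]) (rule types)
  then obtain \<Phi> where \<Phi>: "\<Phi> \<subseteq> lform C ?A ?V" "{p \<in> ?P. ?\<nu> p \<in> \<pi> ` H} = {p \<in> ?P. \<Phi> \<subseteq> p}"
    by (elim exE conjE)
  have "\<sigma> \<in> H \<longleftrightarrow> (\<forall>\<phi>\<in>\<Phi>. holds C (\<lambda>(i, j). \<sigma> (b i) j) \<phi>)" if \<sigma>: "\<sigma> \<in> carrier Aut_\<Sigma>" for \<sigma>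
  proof -
    have P: "type_of I b \<sigma> \<in> ?P" using \<sigma> by (simp add: type_space_def)
    have "type_of I b \<sigma> \<in> {p \<in> ?P. ?\<nu> p \<in> \<pi> ` H} \<longleftrightarrow> type_of I b \<sigma> \<in> {p \<in> ?P. \<Phi> \<subseteq> p}"
      by (simp only: \<Phi>(2))
    then have "\<pi> \<sigma> \<in> \<pi> ` H \<longleftrightarrow> \<Phi> \<subseteq> type_of I b \<sigma>"
      unfolding mem_Collect_eq \<nu>[OF \<sigma>] using P by blast
    then show ?thesis using Gal_proj_mem_iff[OF H \<sigma>] \<Phi>(1) by (auto simp: mem_type_of subset_iff)
  qed
  then show ?thesis using \<Phi>(1) by blast
qed

text \<open>For a tuple \<open>b\<close> as above, the conditions that an automorphism \<open>f\<close> fixes \<open>e\<close> and restricts to an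
  element of \<open>H\<close> are type-definable in terms of the images under \<open>f\<close> of a small set; so
  compactness applies to them together with \<open>f(c) = d\<close>.\<close>

lemma equiv_by_finite_character:
  assumes b: "Lascar_tuple C \<kappa> \<alpha> e X \<Sigma> B b" and dcl: "in_dcl C \<alpha> e (entries X B b)"
    and H: "subgroup H Aut_\<Sigma>" "Autf_\<Sigma> \<subseteq> H"
    and closed: "closedin (Gal_topology C \<kappa> \<alpha> e X \<Sigma> B b) (\<pi> ` H)"
    and c: "tuple_of \<kappa> R I c" and d: "tuple_of \<kappa> R I d"
  shows "equiv_by H I c d \<longleftrightarrow> (\<forall>J \<subseteq> I. finite J \<longrightarrow> equiv_by H J c d)"
proof
  assume "equiv_by H I c d"
  then show "\<forall>J \<subseteq> I. finite J \<longrightarrow> equiv_by H J c d" unfolding equiv_by_def by blast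
next
  assume fin: "\<forall>J \<subseteq> I. finite J \<longrightarrow> equiv_by H J c d"
  have tup: "tuple_of \<kappa> R B b" using b by (simp add: Lascar_tuple_def)
  obtain \<Phi> where \<Phi>: "\<Phi> \<subseteq> lform C (entries X B b) (B \<times> X)"
    "\<And>\<sigma>. \<sigma> \<in> carrier Aut_\<Sigma> \<Longrightarrow> \<sigma> \<in> H \<longleftrightarrow> (\<forall>\<phi>\<in>\<Phi>. holds C (\<lambda>(i, j). \<sigma> (b i) j) \<phi>)"
    using closed_subgroup_type_definable[OF b dcl H closed] by blast
  obtain A\<^sub>e \<Gamma>\<^sub>e where e: "small \<kappa> A\<^sub>e" "\<Gamma>\<^sub>e \<subseteq> lform C A\<^sub>e (Inl ` A\<^sub>e)"
    "\<And>f. f \<in> Auts C \<Longrightarrow> f \<in> Aut_e \<longleftrightarrow> (\<forall>\<phi>\<in>\<Gamma>\<^sub>e. holds C (images f) \<phi>)"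
    using Aut_e_type_definable by blast
  define A where "A = A\<^sub>e \<union> entries X B b"
  have A: "small \<kappa> A" unfolding A_def by (intro small_Un e(1) small_entries[OF tup])
  define \<rho> :: "'k \<times> 'k \<Rightarrow> ('f, 'a, 'a + nat) tm" where "\<rho> = (\<lambda>(i, j). Var (Inl (b i j)))"
  define \<Gamma> where "\<Gamma> = \<Gamma>\<^sub>e \<union> subst_fm \<rho> ` \<Phi>"
  have \<Gamma>_iff: "(\<forall>\<phi>\<in>\<Gamma>. holds C (images f) \<phi>) \<longleftrightarrow> f \<in> Aut_e \<and> res f \<in> H" if f: "f \<in> Auts C" for f
  proof (cases "f \<in> Aut_e")
    case True
    have "holds C (images f) (subst_fm \<rho> \<phi>) \<longleftrightarrow> holds C (\<lambda>(i, j). res f (b i) j) \<phi>" if "\<phi> \<in> \<Phi>" for \<phi>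
      unfolding holds_images_subst
    proof (rule sat_cong)
      fix v assume "v \<in> fv \<phi>"
      moreover have "fv \<phi> \<subseteq> B \<times> X" using \<Phi>(1) \<open>\<phi> \<in> \<Phi>\<close> by (auto simp: lform_def)
      ultimately obtain i j where "v = (i, j)" "i \<in> B" "j \<in> X" by blast
      then show "eval C (images f) (\<rho> v) = (\<lambda>(i, j). res f (b i) j) v"
        using tuple_of_realization[OF tup] by (simp add: \<rho>_def res_apply compose_def)
    qed
    then have "(\<forall>\<phi>\<in>subst_fm \<rho> ` \<Phi>. holds C (images f) \<phi>) \<longleftrightarrow> res f \<in> H"
      using \<Phi>(2)[of "res f"] True by (simp add: carrier_Aut)
    then show ?thesis unfolding \<Gamma>_def ball_Un e(3)[OF f, symmetric] by blast
  next
    case False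
    then show ?thesis unfolding \<Gamma>_def ball_Un e(3)[OF f, symmetric] by blast
  qed
  have cR: "c i \<in> R" and dR: "d i \<in> R" if "i \<in> I" for i
    using tuple_of_realization[OF c that] tuple_of_realization[OF d that] .
  define pair where "pair = (\<lambda>(i, j). (c i j, d i j))"
  have IX: "small \<kappa> (I \<times> X)" using c small_X by (simp add: tuple_of_def small_Times)
  have "\<exists>f\<in>Auts C. (\<forall>(x, y)\<in>pair ` (I \<times> X). f x = y) \<and> (\<forall>\<phi>\<in>\<Gamma>. holds C (images f) \<phi>)"
  proof (rule automorphism_compactness[OF A A])
    have "subst_fm \<rho> \<phi> \<in> lform C A (Inl ` A)" if "\<phi> \<in> \<Phi>" for \<phi>
    proof (rule subst_fm_lform)
      show "\<phi> \<in> lform C (entries X B b) (B \<times> X)" using \<Phi>(1) that by blast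
      show "wf_tm C (\<rho> v) \<and> tm_pars (\<rho> v) \<subseteq> A \<and> tm_vars (\<rho> v) \<subseteq> Inl ` A" if "v \<in> B \<times> X" for v
        using that by (auto simp: \<rho>_def A_def entries_def intro!: imageI)
    qed (simp add: A_def)
    moreover have "\<Gamma>\<^sub>e \<subseteq> lform C A (Inl ` A)"
      using e(2) lform_mono[of _ C A\<^sub>e "Inl ` A\<^sub>e" A "Inl ` A"] unfolding A_def by blast
    ultimately show "\<Gamma> \<subseteq> lform C A (Inl ` A)" unfolding \<Gamma>_def by auto
    have "Domain (pair ` (I \<times> X)) = fst ` pair ` (I \<times> X)" "Range (pair ` (I \<times> X)) = snd ` pair ` (I \<times> X)"
      by (simp_all add: Domain_fst Range_snd)
    then show "small \<kappa> (Domain (pair ` (I \<times> X)))" "small \<kappa> (Range (pair ` (I \<times> X)))"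
      using IX by (simp_all only: small_image)
    fix Q' assume Q': "Q' \<subseteq> pair ` (I \<times> X)" "finite Q'"
    obtain K where K: "K \<subseteq> I \<times> X" "finite K" "Q' = pair ` K"
      using finite_subset_image[OF Q'(2,1)] by blast
    have "fst ` K \<subseteq> I" "finite (fst ` K)" using K by auto
    then have "equiv_by H (fst ` K) c d" using fin by blast
    then obtain h where h: "h \<in> H" "\<And>i. i \<in> fst ` K \<Longrightarrow> h (c i) = d i"
      unfolding equiv_by_def by blast
    obtain f where f: "f \<in> Aut_e" "h = res f"
      using subgroup.mem_carrier[OF H(1) h(1)] unfolding carrier_Aut by blast
    have "f (c i j) = d i j" if "(i, j) \<in> K" for i j
    proof -
      have "i \<in> I" "j \<in> X" using K(1) that by auto
      moreover have "i \<in> fst ` K" using that by force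
      ultimately show ?thesis
        using h(2) f(2) cR dR by (metis res_apply compose_eq_realization_iff)
    qed
    then have "\<forall>(x, y)\<in>Q'. f x = y" unfolding K(3) pair_def by auto
    moreover have "\<forall>\<phi>\<in>\<Gamma>. holds C (images f) \<phi>"
      using \<Gamma>_iff[OF Aut_e_Auts[OF f(1)]] f h(1) by blast
    ultimately show "\<exists>f\<in>Auts C. (\<forall>(x, y)\<in>Q'. f x = y) \<and> (\<forall>\<phi>\<in>\<Gamma>. holds C (images f) \<phi>)"
      using Aut_e_Auts[OF f(1)] by blast
  qed
  then obtain f where f: "f \<in> Auts C" "\<forall>(x, y)\<in>pair ` (I \<times> X). f x = y"
    "\<forall>\<phi>\<in>\<Gamma>. holds C (images f) \<phi>" by blast
  have "f \<in> Aut_e" "res f \<in> H" using \<Gamma>_iff[OF f(1)] f(3) by blast+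
  moreover have "f (c i j) = d i j" if "i \<in> I" "j \<in> X" for i j
    using f(2) that unfolding pair_def by auto
  then have "res f (c i) = d i" if "i \<in> I" for i
    using that cR dR by (simp add: res_apply compose_eq_realization_iff)
  ultimately show "equiv_by H I c d" unfolding equiv_by_def by blast
qed

end

theorem lemma2p10:
  fixes T :: "('f, 'r, 'a, nat) fm set"
    and C :: "('f, 'r, 'a) fo_structure"
    and \<kappa> :: "'k rel"
    and \<alpha> X :: "'k set"
    and e :: "('k \<Rightarrow> 'a) set"
    and \<Sigma> :: "('f, 'r, 'a, 'k) fm set"
    and H :: "(('k \<Rightarrow> 'a) \<Rightarrow> ('k \<Rightarrow> 'a)) set"
  assumes "monster_model T C \<kappa>"
    and "hyperimaginary C \<kappa> \<alpha> e"
    and "partial_type C \<kappa> X \<Sigma>"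
    and "invariant_over C \<alpha> e X \<Sigma>"
    and "\<exists>I\<^sub>0 c\<^sub>0. tuple_of \<kappa> (realizations C X \<Sigma>) I\<^sub>0 c\<^sub>0 \<and> in_dcl C \<alpha> e (entries X I\<^sub>0 c\<^sub>0)"
    and "subgroup H (Aut_type C \<alpha> e X \<Sigma>)"
    and "Autf_L_type C \<kappa> \<alpha> e X \<Sigma> \<subseteq> H"
  shows
    "(\<forall>B b. Lascar_tuple C \<kappa> \<alpha> e X \<Sigma> B b \<and> in_dcl C \<alpha> e (entries X B b) \<and>
        closedin (Gal_topology C \<kappa> \<alpha> e X \<Sigma> B b) (Gal_proj C \<kappa> \<alpha> e X \<Sigma> ` H) \<longrightarrow>
        (\<forall>I c d. tuple_of \<kappa> (realizations C X \<Sigma>) I c \<and> tuple_of \<kappa> (realizations C X \<Sigma>) I d \<longrightarrow>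
           (equiv_by H I c d \<longleftrightarrow> (\<forall>J \<subseteq> I. finite J \<longrightarrow> equiv_by H J c d))) \<and>
        (\<forall>\<sigma> \<in> carrier (Aut_type C \<alpha> e X \<Sigma>).
           (\<sigma> \<in> H \<longleftrightarrow>
              (\<forall>I c. tuple_of \<kappa> (realizations C X \<Sigma>) I c \<longrightarrow> equiv_by H I (\<sigma> \<circ> c) c)) \<and>
           (\<sigma> \<in> H \<longleftrightarrow>
              (\<forall>I c. tuple_of \<kappa> (realizations C X \<Sigma>) I c \<and> finite I \<longrightarrow> equiv_by H I (\<sigma> \<circ> c) c)))) \<and>
     (\<forall>\<sigma> \<in> carrier (Aut_type C \<alpha> e X \<Sigma>).
        \<sigma> \<in> H \<longleftrightarrow>
          (\<forall>I c. tuple_of \<kappa> (realizations C X \<Sigma>) I c \<longrightarrow> equiv_by H I (\<sigma> \<circ> c) c))"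
proof -
  interpret relativized_setup T C \<kappa> \<alpha> e X \<Sigma>
    using assms(1-4) by unfold_locales
  note H = assms(6,7)
  note fixes_classes = mem_subgroup_iff_fixes_classes[OF H]
  have finite_character: "equiv_by H I c d \<longleftrightarrow> (\<forall>J \<subseteq> I. finite J \<longrightarrow> equiv_by H J c d)"
    if "Lascar_tuple C \<kappa> \<alpha> e X \<Sigma> B b \<and> in_dcl C \<alpha> e (entries X B b) \<and>
        closedin (Gal_topology C \<kappa> \<alpha> e X \<Sigma> B b) (\<pi> ` H)"
      "tuple_of \<kappa> R I c" "tuple_of \<kappa> R I d" for B b I c d
    using that by (intro equiv_by_finite_character[OF _ _ H]) blast+
  have finite_classes: "\<sigma> \<in> H \<longleftrightarrow>
      (\<forall>I c. tuple_of \<kappa> R I c \<and> finite I \<longrightarrow> equiv_by H I (\<sigma> \<circ> c) c)"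
    if b: "Lascar_tuple C \<kappa> \<alpha> e X \<Sigma> B b \<and> in_dcl C \<alpha> e (entries X B b) \<and>
        closedin (Gal_topology C \<kappa> \<alpha> e X \<Sigma> B b) (\<pi> ` H)"
      and \<sigma>: "\<sigma> \<in> carrier Aut_\<Sigma>" for B b \<sigma>
  proof
    assume "\<sigma> \<in> H"
    then show "\<forall>I c. tuple_of \<kappa> R I c \<and> finite I \<longrightarrow> equiv_by H I (\<sigma> \<circ> c) c"
      using fixes_classes[OF \<sigma>] by blast
  next
    assume fin: "\<forall>I c. tuple_of \<kappa> R I c \<and> finite I \<longrightarrow> equiv_by H I (\<sigma> \<circ> c) c"
    have "equiv_by H I (\<sigma> \<circ> c) c" if c: "tuple_of \<kappa> R I c" for I c
      unfolding finite_character[OF b tuple_of_comp[OF c \<sigma>] c]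
    proof (intro allI impI)
      fix J assume "J \<subseteq> I" "finite J"
      moreover from this have "tuple_of \<kappa> R J c"
        using c by (auto simp: tuple_of_def small_finite)
      ultimately show "equiv_by H J (\<sigma> \<circ> c) c" using fin by blast
    qed
    then show "\<sigma> \<in> H" using fixes_classes[OF \<sigma>] by blast
  qed
  show ?thesis
    by (intro conjI allI impI ballI; (elim conjE)?)
      (intro finite_character conjI fixes_classes finite_classes; assumption)+
qed

end
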